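(* Let $C: f=0$ be a reduced (singular) curve in $\mathbb{P}^2$ (over $\mathbb{C}$) of degree $d$ having only simple singularities. Then $C$ is not free if either $d$ is odd and $$d>\frac{3}{2\alpha_C-1},$$ or $d$ is even and $$d>\frac{2}{2\alpha_C-1}.$$
   Context: Simple singularities are the plane curve singularities of type $A_k$ ($k\geq 1$), $D_k$ ($k\geq 4$), $E_6$, $E_7$, $E_8$. The number $\alpha_C$ is the minimum of the Arnold exponents (log canonical thresholds) $\alpha_p$ of the germs $(C,p)$ over all singular points $p$ of $C$; if the germ $(C,p)$ is weighted homogeneous of type $(w_1,w_2;1)$ with $0<w_j\leq 1/2$, then $\alpha_p=w_1+w_2$. For a reduced curve $C: f=0$ of degree $d$ in $\mathbb{P}^2$, with $f\in \mathbb{C}[x,y,z]$ homogeneous, the sheaf of logarithmic vector fields $T\langle C\rangle$ is the rank two vector bundle on $\mathbb{P}^2$ which is the kernel of the map $\mathcal{O}_{\mathbb{P}^2}(1)^3 \to \mathcal{J}_f(d)$, $(a,b,c)\mapsto af_x+bf_y+cf_z$, where $\mathcal{J}_f\subset \mathcal{O}_{\mathbb{P}^2}$ is the ideal sheaf generated by the partial derivatives $f_x,f_y,f_z$. The curve $C$ is free (as a divisor) if $T\langle C\rangle$ splits as a direct sum of two line bundles. *)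

theory Defs
  imports "HOL-Analysis.Analysis" "HOL-Computational_Algebra.Computational_Algebra"
begin

section \<open>Homogeneous polynomials in three variables\<close>

text \<open>
  \<open>\<complex>[x,y,z]\<close> is represented as \<open>\<complex>[x][y][z]\<close>: the coefficient of \<open>x^i y^j z^k\<close> in \<open>f\<close> is
  \<open>coeff (coeff (coeff f k) j) i\<close>. The zero polynomial is homogeneous of every degree.
\<close>

type_synonym poly3 = "complex poly poly poly"

definition homogeneous :: "nat \<Rightarrow> poly3 \<Rightarrow> bool" where
  "homogeneous d f \<longleftrightarrow> (\<forall>i j k. coeff (coeff (coeff f k) j) i \<noteq> 0 \<longrightarrow> i + j + k = d)"

definition eval :: "poly3 \<Rightarrow> complex ^ 3 \<Rightarrow> complex" where
  "eval f p = poly (poly (poly f [:[:p $ 3:]:]) [:p $ 2:]) (p $ 1)"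

definition gradient :: "poly3 \<Rightarrow> complex ^ 3 \<Rightarrow> complex ^ 3" where
  "gradient f p = vector
     [eval (map_poly (map_poly pderiv) f) p, eval (map_poly pderiv f) p, eval (pderiv f) p]"


section \<open>Singular points and local equations\<close>

text \<open>
  Points of the projective plane are given by homogeneous coordinates, i.e. nonzero vectors, and
  subsets of it by the cones over them (with the origin removed).
\<close>

definition singular_points :: "poly3 \<Rightarrow> (complex ^ 3) set" where
  "singular_points f = {p. p \<noteq> 0 \<and> eval f p = 0 \<and> gradient f p = 0}"

text \<open>
  The equation of the curve in a standard affine chart around \<open>p\<close>, with \<open>p\<close> moved to the origin.
  The distinguished coordinate is normalised to its value at \<open>p\<close> rather than to 1; for
  homogeneous \<open>f\<close> this changes the germ only by a rescaling of the coordinates and of the equation.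
\<close>

definition local_equation :: "poly3 \<Rightarrow> complex ^ 3 \<Rightarrow> complex \<times> complex \<Rightarrow> complex" where
  "local_equation f p = (\<lambda>(s, t).
     if p $ 1 \<noteq> 0 then eval f (p + vector [0, s, t])
     else if p $ 2 \<noteq> 0 then eval f (p + vector [s, 0, t])
     else eval f (p + vector [s, t, 0]))"


section \<open>Simple singularities\<close>

definition holomorphic2_on :: "(complex \<times> complex \<Rightarrow> complex) \<Rightarrow> (complex \<times> complex) set \<Rightarrow> bool" where
  "holomorphic2_on g U \<longleftrightarrow>
     (\<forall>x\<in>U. \<exists>a b. (g has_derivative (\<lambda>(h, k). a * h + b * k)) (at x))"

definition biholomorphic2 ::
  "(complex \<times> complex \<Rightarrow> complex \<times> complex) \<Rightarrow> (complex \<times> complex) set \<Rightarrow> (complex \<times> complex) set \<Rightarrow> bool"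
  where
  "biholomorphic2 \<phi> U V \<longleftrightarrow> open U \<and> open V \<and> bij_betw \<phi> U V \<and>
     holomorphic2_on (fst \<circ> \<phi>) U \<and> holomorphic2_on (snd \<circ> \<phi>) U \<and>
     holomorphic2_on (fst \<circ> the_inv_into U \<phi>) V \<and> holomorphic2_on (snd \<circ> the_inv_into U \<phi>) V"

text \<open>Isomorphism of the plane curve germs \<open>g = 0\<close> and \<open>h = 0\<close> at the origin: the equations agree
  up to a holomorphic change of coordinates and a holomorphic unit.\<close>

definition germ_equivalent ::
  "(complex \<times> complex \<Rightarrow> complex) \<Rightarrow> (complex \<times> complex \<Rightarrow> complex) \<Rightarrow> bool" where
  "germ_equivalent g h \<longleftrightarrow> (\<exists>U V \<phi> u. 0 \<in> U \<and> biholomorphic2 \<phi> U V \<and> \<phi> 0 = 0 \<and>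
     holomorphic2_on u U \<and> (\<forall>x\<in>U. u x \<noteq> 0 \<and> g (\<phi> x) = u x * h x))"

inductive simple_normal_form :: "(complex \<times> complex \<Rightarrow> complex) \<Rightarrow> bool" where
  A: "k \<ge> 1 \<Longrightarrow> simple_normal_form (\<lambda>(x, y). x ^ 2 + y ^ (k + 1))"
| D: "k \<ge> 4 \<Longrightarrow> simple_normal_form (\<lambda>(x, y). x ^ 2 * y + y ^ (k - 1))"
| E6: "simple_normal_form (\<lambda>(x, y). x ^ 3 + y ^ 4)"
| E7: "simple_normal_form (\<lambda>(x, y). x ^ 3 + x * y ^ 3)"
| E8: "simple_normal_form (\<lambda>(x, y). x ^ 3 + y ^ 5)"

definition only_simple_singularities :: "poly3 \<Rightarrow> bool" where
  "only_simple_singularities f \<longleftrightarrow>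
     (\<forall>p\<in>singular_points f. \<exists>h. simple_normal_form h \<and> germ_equivalent (local_equation f p) h)"


section \<open>Arnold exponents\<close>

text \<open>
  The log canonical threshold of a germ \<open>g\<close> at the origin of \<open>\<complex>\<^sup>2\<close> is the supremum of all
  \<open>c > 0\<close> such that \<open>\<bar>g\<bar>^(-2c)\<close> is Lebesgue integrable near the origin. (The convention
  \<open>0 powr a = 0\<close> is harmless, as the zero set of \<open>g\<close> is a null set when \<open>g\<close> is not zero.)
\<close>

definition log_canonical_threshold :: "(complex \<times> complex \<Rightarrow> complex) \<Rightarrow> real" where
  "log_canonical_threshold g =
     Sup {c. c > 0 \<and> (\<exists>r>0. set_integrable lborel (ball 0 r) (\<lambda>x. norm (g x) powr (- 2 * c)))}"

definition arnold_exponent :: "poly3 \<Rightarrow> complex ^ 3 \<Rightarrow> real" where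
  "arnold_exponent f p = log_canonical_threshold (local_equation f p)"

text \<open>A reduced curve has finitely many singular points and the exponent does not depend on
  the homogeneous coordinates chosen, so that the infimum is a minimum if there is a singular point.\<close>

definition curve_exponent :: "poly3 \<Rightarrow> real" where
  "curve_exponent f = (INF p\<in>singular_points f. arnold_exponent f p)"


section \<open>Line bundles and the sheaf of logarithmic vector fields\<close>

definition zariski_open :: "(complex ^ 3) set \<Rightarrow> bool" where
  "zariski_open U \<longleftrightarrow>
     (\<exists>F. (\<forall>g\<in>F. \<exists>n. homogeneous n g) \<and> U = {p. p \<noteq> 0 \<and> (\<exists>g\<in>F. eval g p \<noteq> 0)})"

text \<open>
  Sections over \<open>U\<close> are functions on the cone over \<open>U\<close>, extended by 0 to the whole space, so that
  the module operations are pointwise and restriction is multiplication by an indicator function.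
\<close>

definition restr :: "(complex ^ 3) set \<Rightarrow> (complex ^ 3 \<Rightarrow> 'b::zero) \<Rightarrow> complex ^ 3 \<Rightarrow> 'b" where
  "restr V s = (\<lambda>p. if p \<in> V then s p else 0)"

text \<open>The sections of \<open>\<O>(k)\<close> over \<open>U\<close>: locally quotients of homogeneous polynomials whose degrees
  differ by \<open>k\<close>.\<close>

definition twist_sections :: "int \<Rightarrow> (complex ^ 3) set \<Rightarrow> (complex ^ 3 \<Rightarrow> complex) set" where
  "twist_sections k U = {s. (\<forall>p. p \<notin> U \<longrightarrow> s p = 0) \<and>
     (\<forall>p\<in>U. \<exists>V g h m n. zariski_open V \<and> p \<in> V \<and> V \<subseteq> U \<and>
        homogeneous m g \<and> homogeneous n h \<and> int m = int n + k \<and>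
        (\<forall>q\<in>V. eval h q \<noteq> 0 \<and> s q = eval g q / eval h q))}"

text \<open>The sections over \<open>U\<close> of the kernel of \<open>\<O>(1)^3 \<rightarrow> \<O>(d), (a,b,c) \<mapsto> a f_x + b f_y + c f_z\<close>,
  whose image is contained in \<open>\<J>_f(d)\<close>.\<close>

definition log_vector_fields ::
  "poly3 \<Rightarrow> (complex ^ 3) set \<Rightarrow> (complex ^ 3 \<Rightarrow> complex ^ 3) set" where
  "log_vector_fields f U = {\<sigma>. (\<forall>i. (\<lambda>p. \<sigma> p $ i) \<in> twist_sections 1 U) \<and>
     (\<forall>p\<in>U. (\<Sum>i\<in>UNIV. \<sigma> p $ i * gradient f p $ i) = 0)}"

definition module_sheaf :: "((complex ^ 3) set \<Rightarrow> (complex ^ 3 \<Rightarrow> complex ^ 3) set) \<Rightarrow> bool" where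
  "module_sheaf L \<longleftrightarrow>
     (\<forall>U. zariski_open U \<longrightarrow>
        (\<forall>\<sigma>\<in>L U. \<forall>p. p \<notin> U \<longrightarrow> \<sigma> p = 0) \<and>
        (\<lambda>_. 0) \<in> L U \<and>
        (\<forall>\<sigma>\<in>L U. \<forall>\<tau>\<in>L U. (\<lambda>p. \<sigma> p + \<tau> p) \<in> L U) \<and>
        (\<forall>a\<in>twist_sections 0 U. \<forall>\<sigma>\<in>L U. (\<lambda>p. a p *s \<sigma> p) \<in> L U) \<and>
        (\<forall>V. zariski_open V \<longrightarrow> V \<subseteq> U \<longrightarrow> (\<forall>\<sigma>\<in>L U. restr V \<sigma> \<in> L V)) \<and>
        (\<forall>\<sigma>. (\<forall>p. p \<notin> U \<longrightarrow> \<sigma> p = 0) \<longrightarrow>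
             (\<forall>p\<in>U. \<exists>V. zariski_open V \<and> p \<in> V \<and> V \<subseteq> U \<and> restr V \<sigma> \<in> L V) \<longrightarrow> \<sigma> \<in> L U))"

text \<open>A line bundle is a sheaf of modules which is locally free of rank one, i.e. locally isomorphic
  to the structure sheaf \<open>\<O> = \<O>(0)\<close>; \<open>e\<close> is the image of 1 under such an isomorphism.\<close>

definition line_bundle :: "((complex ^ 3) set \<Rightarrow> (complex ^ 3 \<Rightarrow> complex ^ 3) set) \<Rightarrow> bool" where
  "line_bundle L \<longleftrightarrow> module_sheaf L \<and>
     (\<forall>p. p \<noteq> 0 \<longrightarrow> (\<exists>U. zariski_open U \<and> p \<in> U \<and> (\<exists>e\<in>L U. \<forall>V. zariski_open V \<longrightarrow> V \<subseteq> U \<longrightarrow>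
        bij_betw (\<lambda>a q. a q *s e q) (twist_sections 0 V) (L V))))"

text \<open>A decomposition as a direct sum is internal: the summands are subsheaves, and the addition
  map from their direct sum is an isomorphism.\<close>

definition free_curve :: "poly3 \<Rightarrow> bool" where
  "free_curve f \<longleftrightarrow> (\<exists>L M. line_bundle L \<and> line_bundle M \<and>
     (\<forall>U. zariski_open U \<longrightarrow>
        bij_betw (\<lambda>(\<sigma>, \<tau>) p. \<sigma> p + \<tau> p) (L U \<times> M U) (log_vector_fields f U)))"

end

theory Submission
  imports Defs "HOL-Complex_Analysis.Cauchy_Integral_Formula" "HOL-Computational_Algebra.Field_as_Ring"
begin

text \<open>
  A direct summand \<open>L\<close> of \<open>T\<langle>C\<rangle>\<close> is spanned, wherever it has sections, by a primitive vector of
  homogeneous polynomials, because the polynomial ring is factorial. Restricting the two vectors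
  belonging to the two summands to a line which avoids the singular points shows that their degrees
  add up to \<open>d - 1\<close>. Hence there is a nonzero vector field \<open>\<delta>\<close> on \<open>\<complex>\<^sup>3\<close> with homogeneous
  coefficients of degree \<open>m \<le> (d - 1)/2\<close> such that \<open>\<delta> f = 0\<close>, and the assumption on \<open>d\<close> says that
  \<open>s := (m + 2)/d < \<alpha>_C\<close>, so that \<open>F := \<bar>f\<bar>^(-2s)\<close> is locally integrable away from the origin.

  Such a \<open>\<delta>\<close> vanishes. Since \<open>\<delta> f = 0\<close>, the field \<open>\<delta>\<close> also annihilates the regularisations
  \<open>(\<bar>f\<bar>\<^sup>2 + \<epsilon>)^(-s)\<close>, which permits integration by parts. With a radial cut-off \<open>\<tau>(\<bar>x\<bar>\<^sup>2)\<close> and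
  \<open>D := div \<delta>\<close> this gives \<open>\<integral> F \<tau> \<bar>D\<bar>\<^sup>2 + \<integral> F \<tau>' D \<langle>x, \<delta>\<rangle> = 0\<close>. The choice of \<open>s\<close> makes the second
  integrand homogeneous of such a degree that the integral vanishes by scaling, whence \<open>D = 0\<close>. A
  second integration by parts, applied to \<open>\<tau> F (\<bar>\<delta>\<bar>\<^sup>2 x - \<langle>x, \<delta>\<rangle> \<delta>)\<close>, then yields
  \<open>\<integral> F \<tau>' \<bar>x \<times> \<delta>\<bar>\<^sup>2 = 0\<close>. Here scaling turns \<open>\<tau>'\<close> into a function of constant sign, so \<open>\<delta>\<close> is
  a multiple of the Euler field, and \<open>\<delta> f = 0\<close> forces \<open>\<delta> = 0\<close>. On the projective plane this is the
  vanishing of square integrable holomorphic 1-forms with values in a flat unitary line bundle.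
\<close>

text \<open>The exponent \<open>s\<close> is dictated by the second integration by parts. There the
  divergence of the bivector field built from \<open>x\<close> and \<delta> contributes
  \<open>m + 2\<close>, the Euler relation for \<open>f\<close> contributes \<open>s * d\<close>,
  and the terms without a derivative of the cut-off cancel in the limit exactly if these agree. With
  2m + 1 \<le> d the hypothesis on \<open>d\<close> gives s < \<alpha>_C; for even \<open>d\<close>
  parity sharpens the bound to 2m + 2 \<le> d, hence the constants 3 and 2. Clearing the denominator
  2 \<alpha>_C - 1 requires \<alpha>_C > 1/2. Simplicity of the singularities enters through this
  inequality and through the isolation of singular points.

  The dilation by 2 stands in for polar coordinates. In u = |x|^2 the cut-off is
  \<open>ramp u - ramp (u / 4)\<close>, and the dilation moves one half of its derivative onto the
  other. In real dimension 6, an integrand of degree -4 tested against \<open>T'\<close> then gives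
  0, and one of degree -2 gives -3 times an integral against the nonnegative
  \<open>hat\<close>.\<close>

no_notation fps_nth (infixl \<open>$\<close> 75)


section \<open>Polynomials in three variables\<close>

lemma eval_add [simp]: "eval (f + g) p = eval f p + eval g p"
  by (simp add: eval_def)
lemma eval_mult [simp]: "eval (f * g) p = eval f p * eval g p"
  by (simp add: eval_def)
lemma eval_0 [simp]: "eval 0 p = 0"
  by (simp add: eval_def)
lemma eval_1 [simp]: "eval 1 p = 1"
  by (simp add: eval_def)
lemma eval_diff [simp]: "eval (f - g) p = eval f p - eval g p"
  by (simp add: eval_def)
lemma eval_uminus [simp]: "eval (- f) p = - eval f p"
  by (simp add: eval_def)
lemma eval_power [simp]: "eval (f ^ n) p = eval f p ^ n"
  by (induction n) auto
lemma eval_sum [simp]: "eval (sum F A) p = (\<Sum>i\<in>A. eval (F i) p)"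
  by (induction A rule: infinite_finite_induct) auto

definition pd :: "3 \<Rightarrow> poly3 \<Rightarrow> poly3" where
  "pd i f = (if i = 1 then map_poly (map_poly pderiv) f else if i = 2 then map_poly pderiv f else pderiv f)"

definition var :: "3 \<Rightarrow> poly3" where
  "var i = (if i = 1 then [:[:[:0, 1:]:]:] else if i = 2 then [:[:0, 1:]:] else [:0, 1:])"

lemma pd_simps: "pd 1 f = map_poly (map_poly pderiv) f" "pd 2 f = map_poly pderiv f" "pd 3 f = pderiv f"
  by (simp_all add: pd_def)

lemma gradient_nth: "gradient f p $ i = eval (pd i f) p"
  using exhaust_3[of i] by (auto simp: gradient_def pd_simps)

lemma eval_var [simp]: "eval (var i) p = p $ i"
  using exhaust_3[of i] by (auto simp: eval_def var_def)

lemma eval_pCons: "eval (pCons a f) p = poly (poly a [:p $ 2:]) (p $ 1) + p $ 3 * eval f p"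
  by (simp add: eval_def)

lemma has_derivative_nth3: "((\<lambda>p::complex^3. p $ i) has_derivative (\<lambda>h. h $ i)) (at p)"
  by (rule bounded_linear_imp_has_derivative, rule bounded_linear_vec_nth)

lemma has_derivative_poly1:
  "((\<lambda>p::complex^3. poly a (p $ 1)) has_derivative (\<lambda>h. poly (pderiv a) (p $ 1) * h $ 1)) (at p)"
proof -
  have "(poly a has_derivative (\<lambda>h. poly (pderiv a) (p $ 1) * h)) (at (p $ 1))"
    using poly_DERIV[of a "p $ 1"] by (simp add: has_field_derivative_def)
  from has_derivative_compose[OF has_derivative_nth3 this] show ?thesis by simp
qed

lemma has_derivative_poly2:
  "((\<lambda>p::complex^3. poly (poly a [:p $ 2:]) (p $ 1)) has_derivative
     (\<lambda>h. poly (poly (map_poly pderiv a) [:p $ 2:]) (p $ 1) * h $ 1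
        + poly (poly (pderiv a) [:p $ 2:]) (p $ 1) * h $ 2)) (at p)"
proof (induction a)
  case 0
  then show ?case by simp
next
  case (pCons a q)
  have "((\<lambda>p::complex^3. poly a (p $ 1) + p $ 2 * poly (poly q [:p $ 2:]) (p $ 1)) has_derivative
    (\<lambda>h. poly (pderiv a) (p $ 1) * h $ 1 + (p $ 2 * (poly (poly (map_poly pderiv q) [:p $ 2:]) (p $ 1) * h $ 1
        + poly (poly (pderiv q) [:p $ 2:]) (p $ 1) * h $ 2) + h $ 2 * poly (poly q [:p $ 2:]) (p $ 1)))) (at p)"
    by (intro has_derivative_add has_derivative_mult has_derivative_nth3 has_derivative_poly1 pCons.IH)
  then show ?case
    by (simp add: map_poly_pCons pderiv_pCons algebra_simps)
qed

lemma has_derivative_eval: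
  "(eval f has_derivative (\<lambda>h. \<Sum>i\<in>UNIV. gradient f p $ i * h $ i)) (at p)"
proof (induction f)
  case 0
  have "eval 0 = (\<lambda>_. 0)" by (rule ext) simp
  then show ?case
    by (simp add: sum_3 gradient_nth pd_simps)
next
  case (pCons a q)
  have "((\<lambda>p::complex^3. poly (poly a [:p $ 2:]) (p $ 1) + p $ 3 * eval q p) has_derivative
    (\<lambda>h. (poly (poly (map_poly pderiv a) [:p $ 2:]) (p $ 1) * h $ 1
        + poly (poly (pderiv a) [:p $ 2:]) (p $ 1) * h $ 2) + (p $ 3 * (\<Sum>i\<in>UNIV. gradient q p $ i * h $ i) + h $ 3 * eval q p))) (at p)"
    by (intro has_derivative_add has_derivative_mult has_derivative_nth3 has_derivative_poly2 pCons.IH)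
  then show ?case
    by (simp add: sum_3 gradient_nth pd_simps map_poly_pCons pderiv_pCons algebra_simps eval_pCons[abs_def])
qed

lemma continuous_on_eval [continuous_intros]:
  assumes "continuous_on S g" shows "continuous_on S (\<lambda>x. eval f (g x))"
proof -
  have "continuous_on UNIV (eval f)"
    by (intro continuous_at_imp_continuous_on ballI has_derivative_continuous[OF has_derivative_eval])
  from continuous_on_compose2[OF this assms] show ?thesis by simp
qed

lemma poly_altdef_le:
  fixes p :: "'a::comm_semiring_1 poly"
  assumes "degree p \<le> n"
  shows "poly p x = (\<Sum>i\<le>n. coeff p i * x ^ i)"
  unfolding poly_altdef using assms
  by (intro sum.mono_neutral_left) (auto simp: coeff_eq_0)

lemma const_poly_power: "[:c:] ^ n = [:c ^ n:]" for c :: "'a::comm_semiring_1"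
  by (induction n) (auto simp: mult.commute)

text \<open>One bound \<open>N\<close> for all three nested degrees turns the nested evaluation into
  a rectangular sum of monomials, from which the behaviour under scaling and along lines is read off
  term by term.\<close>

lemma eval_altdef:
  "\<exists>N. \<forall>p. eval f p = (\<Sum>k\<le>N. \<Sum>j\<le>N. \<Sum>i\<le>N. coeff (coeff (coeff f k) j) i * (p$1) ^ i * (p$2) ^ j * (p$3) ^ k)"
proof -
  define N where "N = Max (insert (degree f) (\<Union>k\<le>degree f. insert (degree (coeff f k)) (\<Union>j\<le>degree (coeff f k). {degree (coeff (coeff f k) j)})))"
  have fin: "finite (insert (degree f) (\<Union>k\<le>degree f. insert (degree (coeff f k)) (\<Union>j\<le>degree (coeff f k). {degree (coeff (coeff f k) j)})))"
    by auto
  have N1: "degree f \<le> N" unfolding N_def by (rule Max_ge[OF fin]) auto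
  have N2: "degree (coeff f k) \<le> N" for k
  proof (cases "k \<le> degree f")
    case True then show ?thesis unfolding N_def by (intro Max_ge[OF fin]) auto
  qed (simp add: coeff_eq_0)
  have N3: "degree (coeff (coeff f k) j) \<le> N" for k j
  proof (cases "k \<le> degree f \<and> j \<le> degree (coeff f k)")
    case True then show ?thesis unfolding N_def by (intro Max_ge[OF fin]) auto
  qed (auto simp: coeff_eq_0 not_le)
  have "eval f p = (\<Sum>k\<le>N. \<Sum>j\<le>N. \<Sum>i\<le>N. coeff (coeff (coeff f k) j) i * (p$1) ^ i * (p$2) ^ j * (p$3) ^ k)" for p
  proof -
    have "eval f p = poly (poly (\<Sum>k\<le>N. coeff f k * [:[:(p $ 3) ^ k:]:]) [:p $ 2:]) (p $ 1)"
      by (simp add: eval_def poly_altdef_le[OF N1] const_poly_power)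
    also have "\<dots> = (\<Sum>k\<le>N. poly (poly (coeff f k) [:p $ 2:]) (p $ 1) * (p $ 3) ^ k)"
      by (simp add: poly_sum mult.commute)
    also have "\<dots> = (\<Sum>k\<le>N. (\<Sum>j\<le>N. \<Sum>i\<le>N. coeff (coeff (coeff f k) j) i * (p$1) ^ i * (p$2) ^ j) * (p $ 3) ^ k)"
    proof (rule sum.cong[OF refl])
      fix k
      have "poly (coeff f k) [:p $ 2:] = (\<Sum>j\<le>N. coeff (coeff f k) j * [:(p $ 2) ^ j:])"
        by (simp add: poly_altdef_le[OF N2] const_poly_power)
      then have "poly (poly (coeff f k) [:p $ 2:]) (p $ 1) = (\<Sum>j\<le>N. poly (coeff (coeff f k) j) (p $ 1) * (p $ 2) ^ j)"
        by (simp add: poly_sum mult.commute)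
      also have "\<dots> = (\<Sum>j\<le>N. \<Sum>i\<le>N. coeff (coeff (coeff f k) j) i * (p$1) ^ i * (p$2) ^ j)"
        by (simp add: poly_altdef_le[OF N3] sum_distrib_right)
      finally show "poly (poly (coeff f k) [:p $ 2:]) (p $ 1) * (p $ 3) ^ k =
         (\<Sum>j\<le>N. \<Sum>i\<le>N. coeff (coeff (coeff f k) j) i * (p$1) ^ i * (p$2) ^ j) * (p $ 3) ^ k" by simp
    qed
    finally show ?thesis by (simp add: sum_distrib_right)
  qed
  then show ?thesis by blast
qed

lemma eval_scale:
  assumes "homogeneous d f"
  shows "eval f (c *s p) = c ^ d * eval f p"
proof -
  obtain N where N: "\<And>p. eval f p = (\<Sum>k\<le>N. \<Sum>j\<le>N. \<Sum>i\<le>N. coeff (coeff (coeff f k) j) i * (p$1) ^ i * (p$2) ^ j * (p$3) ^ k)"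
    using eval_altdef by blast
  have "a * (c * x) ^ i * (c * y) ^ j * (c * z) ^ k = c ^ d * (a * x ^ i * y ^ j * z ^ k)"
    if "a \<noteq> 0 \<longrightarrow> i + j + k = d" for a x y z :: complex and i j k
    using that by (auto simp: power_mult_distrib power_add)
  then show ?thesis
    using assms unfolding N homogeneous_def by (auto simp: sum_distrib_left intro!: sum.cong)
qed

lemma homogeneous_0 [simp]: "homogeneous d 0"
  by (simp add: homogeneous_def)

lemma homogeneous_const: "homogeneous 0 [:[:[:c:]:]:]"
  by (auto simp: homogeneous_def coeff_pCons split: nat.splits)

lemma homogeneous_1: "homogeneous 0 1"
  using homogeneous_const[of 1] by (simp add: one_pCons)

lemma homogeneous_var: "homogeneous 1 (var i)"
  by (auto simp: homogeneous_def var_def coeff_pCons split: nat.splits)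

lemma homogeneous_add: "homogeneous d f \<Longrightarrow> homogeneous d g \<Longrightarrow> homogeneous d (f + g)"
  unfolding homogeneous_def by (metis coeff_add add_0)

lemma homogeneous_uminus: "homogeneous d f \<Longrightarrow> homogeneous d (- f)"
  unfolding homogeneous_def by simp

lemma homogeneous_diff: "homogeneous d f \<Longrightarrow> homogeneous d g \<Longrightarrow> homogeneous d (f - g)"
  using homogeneous_add[of d f "- g"] homogeneous_uminus by simp

lemma homogeneous_sum: "(\<And>i. i \<in> A \<Longrightarrow> homogeneous d (F i)) \<Longrightarrow> homogeneous d (sum F A)"
  by (induction A rule: infinite_finite_induct) (auto intro: homogeneous_add)

lemma homogeneous_mult:
  assumes "homogeneous m f" "homogeneous n g"
  shows "homogeneous (m + n) (f * g)"
  unfolding homogeneous_def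
proof (intro allI impI)
  fix i j k
  assume "coeff (coeff (coeff (f * g) k) j) i \<noteq> 0"
  then have "(\<Sum>k'\<le>k. \<Sum>j'\<le>j. \<Sum>i'\<le>i. coeff (coeff (coeff f k') j') i' * coeff (coeff (coeff g (k - k')) (j - j')) (i - i')) \<noteq> 0"
    by (simp add: coeff_mult coeff_sum)
  then obtain k' j' i' where *: "k' \<le> k" "j' \<le> j" "i' \<le> i" "coeff (coeff (coeff f k') j') i' \<noteq> 0"
     "coeff (coeff (coeff g (k - k')) (j - j')) (i - i') \<noteq> 0"
    by (auto elim!: sum.not_neutral_contains_not_neutral)
  then have "i' + j' + k' = m" "(i - i') + (j - j') + (k - k') = n"
    using assms unfolding homogeneous_def by blast+
  then show "i + j + k = m + n" using *(1-3) by simp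
qed

lemma homogeneous_power: "homogeneous m f \<Longrightarrow> homogeneous (n * m) (f ^ n)"
  by (induction n) (auto intro: homogeneous_1 homogeneous_mult)

text \<open>The degree is recorded as \<open>i + j + k + 1 = d\<close> instead of with
  \<open>d - 1\<close>, so that \<open>d = 0\<close> is covered too: there no coefficient of the
  derivative can be nonzero.\<close>

lemma coeff_pd_homogeneous:
  assumes "homogeneous d f" "coeff (coeff (coeff (pd l f) k) j) i \<noteq> 0"
  shows "i + j + k + 1 = d"
proof -
  note * = assms(2)
    consider "l = 1" | "l = 2" | "l = 3" using exhaust_3[of l] by blast
    then show ?thesis
    proof cases
      case 1
      then have "coeff (coeff (coeff f k) j) (Suc i) \<noteq> 0"
        using * by (auto simp: pd_simps coeff_map_poly coeff_pderiv)
      then show ?thesis using assms unfolding homogeneous_def by fastforce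
    next
      case 2
      then have "coeff (of_nat (Suc j) * coeff (coeff f k) (Suc j)) i \<noteq> 0"
        using * by (simp add: pd_simps coeff_map_poly coeff_pderiv del: of_nat_Suc)
      then have "coeff (coeff (coeff f k) (Suc j)) i \<noteq> 0"
        by (auto simp: of_nat_poly simp del: of_nat_Suc)
      then show ?thesis using assms unfolding homogeneous_def by fastforce
    next
      case 3
      then have "coeff (coeff (of_nat (Suc k) * coeff f (Suc k)) j) i \<noteq> 0"
        using * by (simp add: pd_simps coeff_pderiv del: of_nat_Suc)
      then have "coeff (coeff (coeff f (Suc k)) j) i \<noteq> 0"
        by (auto simp: of_nat_poly simp del: of_nat_Suc)
      then show ?thesis using assms unfolding homogeneous_def by fastforce
    qed
qed

lemma homogeneous_pd: "homogeneous d f \<Longrightarrow> homogeneous (d - 1) (pd l f)"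
  using coeff_pd_homogeneous[of d f l] unfolding homogeneous_def[of "d - 1"] by fastforce

lemma pd_eq_0: "homogeneous 0 f \<Longrightarrow> pd l f = 0"
  using coeff_pd_homogeneous[of 0 f l] by (intro poly_eqI) fastforce

text \<open>One variable is removed at a time: evaluation inserts constant polynomials, there are
  infinitely many of these, and a nonzero polynomial over an integral domain has finitely many
  roots.\<close>

lemma eval_eq_0_imp:
  assumes "\<And>p. eval f p = 0" shows "f = 0"
proof -
  have inf: "infinite (UNIV :: complex set)" by (rule infinite_UNIV_char_0)
  have 1: "poly (poly (poly f [:[:z:]:]) [:y:]) x = 0" for x y z
    using assms[of "vector [x, y, z]"] by (simp add: eval_def)
  have 2: "poly (poly f [:[:z:]:]) [:y:] = 0" for y z
    using 1 poly_all_0_iff_0 by blast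
  have "poly f [:[:z:]:] = 0" for z
  proof (rule ccontr)
    assume "poly f [:[:z:]:] \<noteq> 0"
    then have "finite {w. poly (poly f [:[:z:]:]) w = 0}" by (rule poly_roots_finite)
    moreover have "range (\<lambda>y::complex. [:y:]) \<subseteq> {w. poly (poly f [:[:z:]:]) w = 0}" using 2 by auto
    moreover have "infinite (range (\<lambda>y::complex. [:y:]))"
      by (subst finite_image_iff) (auto simp: inj_on_def inf)
    ultimately show False using finite_subset by blast
  qed
  show "f = 0"
  proof (rule ccontr)
    assume "f \<noteq> 0"
    then have "finite {w. poly f w = 0}" by (rule poly_roots_finite)
    moreover have "range (\<lambda>y::complex. [:[:y:]:]) \<subseteq> {w. poly f w = 0}"
      using \<open>\<And>z. poly f [:[:z:]:] = 0\<close> by auto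
    moreover have "infinite (range (\<lambda>y::complex. [:[:y:]:]))"
      by (subst finite_image_iff) (auto simp: inj_on_def inf)
    ultimately show False using finite_subset by blast
  qed
qed

lemma eval_line: "\<exists>P. \<forall>t. eval f (p + t *s q) = poly P t"
proof -
  obtain N where N: "\<And>p. eval f p = (\<Sum>k\<le>N. \<Sum>j\<le>N. \<Sum>i\<le>N. coeff (coeff (coeff f k) j) i * (p$1) ^ i * (p$2) ^ j * (p$3) ^ k)"
    using eval_altdef by blast
  have "eval f (p + t *s q) = poly (\<Sum>k\<le>N. \<Sum>j\<le>N. \<Sum>i\<le>N. [:coeff (coeff (coeff f k) j) i:] * [:p$1, q$1:] ^ i * [:p$2, q$2:] ^ j * [:p$3, q$3:] ^ k) t" for t
    unfolding N by (simp add: poly_sum algebra_simps)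
  then show ?thesis by blast
qed

lemma scaleR_smult: "r *\<^sub>R x = of_real r *s (x :: complex^3)"
  by (simp add: vec_eq_iff scaleR_conv_of_real[where 'a = complex])

lemma bounded_linear_vector_scalar_left: "bounded_linear (\<lambda>t::complex. t *s (p::complex^3))"
  by (simp add: linear_conv_bounded_linear[symmetric])
     (auto intro!: linearI simp: vec_eq_iff algebra_simps)

text \<open>Differentiate \<open>eval f (t *s p) = t ^ d * eval f p\<close> at \<open>t = 1\<close>,
  once by the chain rule and once by the power rule.\<close>

lemma euler_gradient:
  assumes "homogeneous d f"
  shows "(\<Sum>i\<in>UNIV. p $ i * gradient f p $ i) = of_nat d * eval f p"
proof -
  have 1: "((\<lambda>t. eval f (t *s p)) has_derivative (\<lambda>h. \<Sum>i\<in>UNIV. gradient f (1 *s p) $ i * (h *s p) $ i)) (at (1::complex))"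
    by (rule has_derivative_compose[where g = "eval f", OF _ has_derivative_eval])
       (rule bounded_linear_imp_has_derivative[OF bounded_linear_vector_scalar_left])
  have "((\<lambda>t. t ^ d * eval f p) has_field_derivative (of_nat d * eval f p)) (at 1)"
    by (rule derivative_eq_intros refl | simp)+
  then have 2: "((\<lambda>t. eval f (t *s p)) has_derivative (\<lambda>h. of_nat d * eval f p * h)) (at 1)"
    by (simp add: has_field_derivative_def eval_scale[OF assms])
  from fun_cong[OF has_derivative_unique[OF 1 2], of 1] show ?thesis
    by (simp add: mult.commute)
qed

section \<open>Affine substitutions in Lebesgue integrals\<close>

lemma lborel_nn_integral_affine:
  fixes h :: "'a::euclidean_space \<Rightarrow> ennreal"
  assumes [measurable]: "h \<in> borel_measurable borel" and "c \<noteq> 0"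
  shows "(\<integral>\<^sup>+x. h x \<partial>lborel) = ennreal (\<bar>c\<bar> ^ DIM('a)) * (\<integral>\<^sup>+x. h (t + c *\<^sub>R x) \<partial>lborel)"
  by (subst lborel_affine[OF assms(2), of t])
     (simp add: nn_integral_density nn_integral_distr nn_integral_cmult)

lemma lborel_integral_affine:
  fixes h :: "'a::euclidean_space \<Rightarrow> 'b::{banach, second_countable_topology}"
  assumes [measurable]: "h \<in> borel_measurable borel" and "c \<noteq> 0"
  shows "integral\<^sup>L lborel h = \<bar>c\<bar> ^ DIM('a) *\<^sub>R integral\<^sup>L lborel (\<lambda>x. h (t + c *\<^sub>R x))"
  by (subst lborel_affine[OF assms(2), of t])
     (simp add: integral_density integral_distr)

lemma lborel_integrable_affine:
  fixes h :: "'a::euclidean_space \<Rightarrow> 'b::{banach, second_countable_topology}"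
  assumes [measurable]: "h \<in> borel_measurable borel" and "c \<noteq> 0"
  shows "integrable lborel h \<longleftrightarrow> integrable lborel (\<lambda>x. h (t + c *\<^sub>R x))"
proof -
  have "integrable lborel (\<lambda>x. \<bar>c\<bar> ^ DIM('a) *\<^sub>R h (t + c *\<^sub>R x)) \<longleftrightarrow> integrable lborel (\<lambda>x. h (t + c *\<^sub>R x))"
    (is "integrable _ ?g \<longleftrightarrow> _")
  proof
    assume "integrable lborel ?g"
    then have "integrable lborel (\<lambda>x. inverse (\<bar>c\<bar> ^ DIM('a)) *\<^sub>R ?g x)" by (rule integrable_scaleR_right)
    moreover have "inverse (\<bar>c\<bar> ^ DIM('a)) *\<^sub>R ?g x = h (t + c *\<^sub>R x)" for x
      using assms(2) by (simp only: scaleR_scaleR) simp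
    ultimately show "integrable lborel (\<lambda>x. h (t + c *\<^sub>R x))" by simp
  qed simp
  then show ?thesis
    by (subst lborel_affine[OF assms(2), of t]) (simp add: integrable_density integrable_distr_eq)
qed


section \<open>Integration by parts\<close>

lemma integrable_compact_support:
  fixes g :: "'a::euclidean_space \<Rightarrow> complex"
  assumes "continuous_on UNIV g" "\<And>x. norm x > R \<Longrightarrow> g x = 0"
  shows "integrable lborel g"
proof -
  have "integrable lborel (\<lambda>x. indicator (cball 0 R) x *\<^sub>R g x)"
    using assms(1) by (intro borel_integrable_compact compact_cball continuous_on_subset[OF assms(1)]) auto
  moreover have "(\<lambda>x. indicator (cball 0 R) x *\<^sub>R g x) = g"
    using assms(2) by (force simp: indicator_def)
  ultimately show ?thesis by simp
qed

text \<open>The derivative in direction \<open>v\<close> is the limit of the difference quotients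
  \<open>q n\<close>, each of which integrates to 0 by translation invariance; dominated convergence
  passes to the limit.\<close>

lemma integral_derivative_compact_support:
  fixes \<Psi> :: "'a::euclidean_space \<Rightarrow> complex"
  assumes der: "\<And>x. (\<Psi> has_derivative D x) (at x)"
    and cont: "continuous_on UNIV (\<lambda>x. D x v)"
    and supp: "\<And>x. norm x > R \<Longrightarrow> \<Psi> x = 0"
  shows "integral\<^sup>L lborel (\<lambda>x. D x v) = 0"
proof -
  have contP: "continuous_on UNIV \<Psi>"
    by (intro continuous_at_imp_continuous_on ballI has_derivative_continuous[OF der])
  have Dsupp: "D x v = 0" if "norm x > R" for x
  proof -
    have "open {x::'a. norm x > R}" by (intro open_Collect_less continuous_intros)
    then have "((\<lambda>_. 0) has_derivative D x) (at x)"
      by (rule has_derivative_transform_within_open[OF der]) (use that supp in auto)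
    then have "D x = (\<lambda>_. 0)" by (rule has_derivative_unique) simp
    then show ?thesis by simp
  qed
  have intP: "integrable lborel \<Psi>" by (rule integrable_compact_support[OF contP supp])
  have "bounded ((\<lambda>x. D x v) ` cball 0 R)"
    by (intro compact_imp_bounded compact_continuous_image continuous_on_subset[OF cont]) auto
  then obtain B0 where "\<forall>x\<in>cball 0 R. norm (D x v) \<le> B0" by (auto simp: bounded_iff)
  then have B: "norm (D x v) \<le> max B0 0" for x
    using Dsupp[of x] by (cases "norm x > R") (auto simp: le_max_iff_disj)
  define B where "B = max B0 0"
  define q where "q n x = of_nat (Suc n) * (\<Psi> (x + v /\<^sub>R real (Suc n)) - \<Psi> x)" for n x
  \<comment> \<open>The mean value inequality along the segment bounds all quotients by the same
    constant.\<close>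
  have mv: "norm (\<Psi> (x + t *\<^sub>R v) - \<Psi> x) \<le> B * t" if "t \<ge> 0" for t x
  proof -
    have d: "((\<lambda>t. \<Psi> (x + t *\<^sub>R v)) has_derivative (\<lambda>h. h *\<^sub>R D (x + t *\<^sub>R v) v)) (at t within {0..t'})" for t t'
    proof -
      have "((\<lambda>t. x + t *\<^sub>R v) has_derivative (\<lambda>h. h *\<^sub>R v)) (at t within {0..t'})"
        by (auto intro!: derivative_eq_intros)
      from has_derivative_compose[OF this der]
      have "((\<lambda>t. \<Psi> (x + t *\<^sub>R v)) has_derivative (\<lambda>h. D (x + t *\<^sub>R v) (h *\<^sub>R v))) (at t within {0..t'})" .
      then show ?thesis
        using linear_cmul[OF has_derivative_linear[OF der]] by simp
    qed
    have "norm ((\<lambda>t. \<Psi> (x + t *\<^sub>R v)) t - (\<lambda>t. \<Psi> (x + t *\<^sub>R v)) 0) \<le> B * norm (t - 0)"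
    proof (rule differentiable_bound[where S = "{0..t}", OF _ d])
      fix r
      show "onorm (\<lambda>h. h *\<^sub>R D (x + r *\<^sub>R v) v) \<le> B"
        using B[of "x + r *\<^sub>R v"] by (intro onorm_le) (auto simp: B_def mult.commute intro!: mult_left_mono)
    qed (use that in auto)
    then show ?thesis using that by simp
  qed
  have int_q: "integral\<^sup>L lborel (q n) = 0" for n
  proof -
    have 1: "integrable lborel (\<lambda>x. \<Psi> (x + v /\<^sub>R real (Suc n)))"
      using lborel_integrable_affine[of \<Psi> 1 "v /\<^sub>R real (Suc n)"] intP borel_measurable_continuous_onI[OF contP]
      by (simp add: add.commute del: of_nat_Suc)
    have 2: "integral\<^sup>L lborel (\<lambda>x. \<Psi> (x + v /\<^sub>R real (Suc n))) = integral\<^sup>L lborel \<Psi>"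
      using lborel_integral_affine[of \<Psi> 1 "v /\<^sub>R real (Suc n)"] borel_measurable_continuous_onI[OF contP]
      by (simp add: add.commute del: of_nat_Suc)
    show ?thesis unfolding q_def using 1 2 intP by (simp add: Bochner_Integration.integral_diff)
  qed
  have "(\<lambda>n. integral\<^sup>L lborel (q n)) \<longlonglongrightarrow> integral\<^sup>L lborel (\<lambda>x. D x v)"
  \<comment> \<open>Outside radius \<open>R + norm v\<close> both \<open>x\<close> and its translate
    lie where \<Psi> vanishes, so a constant on this ball dominates.\<close>
  proof (rule integral_dominated_convergence[where w = "\<lambda>x. indicator (cball 0 (R + norm v)) x * B"])
    show "(\<lambda>x. D x v) \<in> borel_measurable lborel"
      using borel_measurable_continuous_onI[OF cont] by simp
    have "\<Psi> \<in> borel_measurable borel" using borel_measurable_continuous_onI[OF contP] .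
    then show "q n \<in> borel_measurable lborel" for n unfolding q_def by measurable
    show "integrable lborel (\<lambda>x. indicat_real (cball 0 (R + norm v)) x * B)"
      by (intro integrable_mult_left integrable_real_indicator) (auto intro: emeasure_bounded_finite[unfolded infinity_ennreal_def])
    show "AE x in lborel. (\<lambda>n. q n x) \<longlonglongrightarrow> D x v"
    proof (rule AE_I2)
      fix x
      show "(\<lambda>n. q n x) \<longlonglongrightarrow> D x v"
      proof (cases "v = 0")
        case True
        then show ?thesis using linear_0[OF has_derivative_linear[OF der]] by (simp add: q_def)
      next
        case False
        have "((\<lambda>t. \<Psi> (x + t *\<^sub>R v)) has_vector_derivative D x v) (at 0)"
        proof -
          have "((\<lambda>t. x + t *\<^sub>R v) has_derivative (\<lambda>h. h *\<^sub>R v)) (at 0)"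
            by (auto intro!: derivative_eq_intros)
          from has_derivative_compose[OF this, of \<Psi> "D x"] der[of x]
          have "((\<lambda>t. \<Psi> (x + t *\<^sub>R v)) has_derivative (\<lambda>h. D x (h *\<^sub>R v))) (at 0)" by simp
          then show ?thesis
            unfolding has_vector_derivative_def
            using linear_cmul[OF has_derivative_linear[OF der]] by simp
        qed
        then have "((\<lambda>h. norm (\<Psi> (x + h *\<^sub>R v) - \<Psi> x - h *\<^sub>R D x v) / norm h) \<longlongrightarrow> 0) (at 0)"
          by (simp add: has_vector_derivative_def has_derivative_at)
        then have "((\<lambda>h. norm ((\<Psi> (x + h *\<^sub>R v) - \<Psi> x) /\<^sub>R h - D x v)) \<longlongrightarrow> 0) (at 0)"
        proof (rule Lim_transform_eventually)
          have "norm (\<Psi> (x + h *\<^sub>R v) - \<Psi> x - h *\<^sub>R D x v) / norm h = norm ((\<Psi> (x + h *\<^sub>R v) - \<Psi> x) /\<^sub>R h - D x v)"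
            if "h \<noteq> 0" for h
          proof -
            have "(\<Psi> (x + h *\<^sub>R v) - \<Psi> x) /\<^sub>R h - D x v = (\<Psi> (x + h *\<^sub>R v) - \<Psi> x - h *\<^sub>R D x v) /\<^sub>R h"
              using that by (simp add: scaleR_diff_right)
            then show ?thesis by (simp add: divide_inverse_commute)
          qed
          then show "\<forall>\<^sub>F h in at 0. norm (\<Psi> (x + h *\<^sub>R v) - \<Psi> x - h *\<^sub>R D x v) / norm h = norm ((\<Psi> (x + h *\<^sub>R v) - \<Psi> x) /\<^sub>R h - D x v)"
            by (auto simp: eventually_at_filter)
        qed
        then have "((\<lambda>h. (\<Psi> (x + h *\<^sub>R v) - \<Psi> x) /\<^sub>R h) \<longlongrightarrow> D x v) (at 0)"
          by (rule LIM_zero_cancel[OF tendsto_norm_zero_cancel])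
        moreover have "filterlim (\<lambda>n. inverse (real (Suc n))) (at 0) sequentially"
          by (intro filterlim_atI LIMSEQ_inverse_real_of_nat) auto
        ultimately have "(\<lambda>n. (\<Psi> (x + inverse (real (Suc n)) *\<^sub>R v) - \<Psi> x) /\<^sub>R inverse (real (Suc n))) \<longlonglongrightarrow> D x v"
          by (rule filterlim_compose)
        then show ?thesis by (simp add: q_def scaleR_conv_of_real del: of_nat_Suc)
      qed
    qed
    show "AE x in lborel. norm (q n x) \<le> indicat_real (cball 0 (R + norm v)) x * B" for n
    proof (rule AE_I2)
      fix x
      have nv: "norm (v /\<^sub>R real (Suc n)) \<le> norm v"
        by (simp add: divide_simps) (simp add: algebra_simps)
      show "norm (q n x) \<le> indicat_real (cball 0 (R + norm v)) x * B"
      proof (cases "norm x \<le> R + norm v")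
        case True
        have "norm (q n x) = real (Suc n) * norm (\<Psi> (x + inverse (real (Suc n)) *\<^sub>R v) - \<Psi> x)"
          by (simp add: q_def norm_mult del: of_nat_Suc)
        also have "\<dots> \<le> real (Suc n) * (B * inverse (real (Suc n)))"
          by (intro mult_left_mono mv) auto
        also have "\<dots> = B" by (simp del: of_nat_Suc)
        finally show ?thesis using True by (simp add: indicator_def)
      next
        case False
        have "norm x - norm (v /\<^sub>R real (Suc n)) \<le> norm (x + v /\<^sub>R real (Suc n))"
          using norm_triangle_ineq2[of x "- (v /\<^sub>R real (Suc n))"] by simp
        then have "norm (x + v /\<^sub>R real (Suc n)) > R" "norm x > R"
          using nv False norm_ge_zero[of v] by linarith+
        then show ?thesis by (simp add: q_def supp B_def)
      qed
    qed
  qed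
  then show ?thesis using int_q by (simp add: LIMSEQ_const_iff)
qed

text \<open>\<open>a\<close> and \<open>b\<close> consist of the Wirtinger derivatives \<open>\<partial>g/\<partial>x_i\<close> and \<open>\<partial>g/\<partial>\<close>(conjugate of \<open>x_i\<close>).\<close>

definition wirt :: "(complex^3 \<Rightarrow> complex) \<Rightarrow> complex^3 \<Rightarrow> complex^3 \<Rightarrow> complex^3 \<Rightarrow> bool" where
  "wirt g a b x \<longleftrightarrow> (g has_derivative (\<lambda>h. \<Sum>i\<in>UNIV. a $ i * h $ i + b $ i * cnj (h $ i))) (at x)"

lemma wirt_mult:
  assumes "wirt g a b x" "wirt h c d x"
  shows "wirt (\<lambda>x. g x * h x) (h x *s a + g x *s c) (h x *s b + g x *s d) x"
proof -
  have "((\<lambda>x. g x * h x) has_derivative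
     (\<lambda>y. g x * (\<Sum>i\<in>UNIV. c $ i * y $ i + d $ i * cnj (y $ i)) + (\<Sum>i\<in>UNIV. a $ i * y $ i + b $ i * cnj (y $ i)) * h x)) (at x)"
    by (rule has_derivative_mult[OF assms[unfolded wirt_def]])
  then show ?thesis
    by (simp add: wirt_def sum_3 algebra_simps)
qed

lemma wirt_add:
  assumes "wirt g a b x" "wirt h c d x"
  shows "wirt (\<lambda>x. g x + h x) (a + c) (b + d) x"
  using has_derivative_add[OF assms[unfolded wirt_def]]
  by (simp add: wirt_def sum_3 algebra_simps)

lemma wirt_cnj:
  assumes "wirt g a b x"
  shows "wirt (\<lambda>x. cnj (g x)) (\<chi> i. cnj (b $ i)) (\<chi> i. cnj (a $ i)) x"
  using has_derivative_cnj[OF assms[unfolded wirt_def]]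
  by (simp add: wirt_def sum_3 algebra_simps)

lemma wirt_cong: "wirt g a b x \<Longrightarrow> a = a' \<Longrightarrow> b = b' \<Longrightarrow> wirt g a' b' x"
  by simp

lemma wirt_eval: "wirt (eval f) (gradient f x) 0 x"
  using has_derivative_eval[of f x] by (simp add: wirt_def)

text \<open>The form \<open>a h + b cnj h\<close> is the derivative of a real-valued function, hence
  takes real values by uniqueness of derivatives. The real chain rule therefore multiplies it by
  \<phi>', and the Wirtinger shape survives.\<close>

lemma wirt_compose_real:
  assumes "wirt (\<lambda>x. complex_of_real (r x)) a b x" and "(\<phi> has_real_derivative \<phi>') (at (r x))"
  shows "wirt (\<lambda>x. complex_of_real (\<phi> (r x))) (of_real \<phi>' *s a) (of_real \<phi>' *s b) x"
proof -
  let ?D = "\<lambda>h. \<Sum>i\<in>UNIV. a $ i * h $ i + b $ i * cnj (h $ i)"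
  have 1: "((\<lambda>x. complex_of_real (r x)) has_derivative ?D) (at x)"
    using assms(1) by (simp add: wirt_def)
  from has_derivative_Re[OF this] have 2: "(r has_derivative (\<lambda>h. Re (?D h))) (at x)"
    by simp
  from has_derivative_of_real[OF this]
  have "((\<lambda>x. complex_of_real (r x)) has_derivative (\<lambda>h. of_real (Re (?D h)))) (at x)" .
  from has_derivative_unique[OF this 1] have eq: "complex_of_real (Re (?D h)) = ?D h" for h
    by metis
  have "((\<lambda>x. \<phi> (r x)) has_derivative (\<lambda>h. \<phi>' * Re (?D h))) (at x)"
    using has_derivative_compose[OF 2, of \<phi> "(*) \<phi>'"] assms(2) by (simp add: has_field_derivative_def)
  then have "((\<lambda>x. complex_of_real (\<phi> (r x))) has_derivative (\<lambda>h. complex_of_real (\<phi>' * Re (?D h)))) (at x)"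
    by (rule has_derivative_of_real)
  then have "((\<lambda>x. complex_of_real (\<phi> (r x))) has_derivative (\<lambda>h. of_real \<phi>' * ?D h)) (at x)"
    by (simp only: of_real_mult eq)
  then show ?thesis
    by (simp add: wirt_def sum_3 algebra_simps)
qed

text \<open>The conjugate derivative in the j-th coordinate is half the sum of the real directional
  derivative along \<open>axis j 1\<close> and \<open>\<i>\<close> times the one along
  \<open>axis j \<i>\<close>; both of these integrate to 0.\<close>

lemma wirt_integral_0:
  assumes "\<And>x. wirt \<Psi> (a x) (b x) x" "continuous_on UNIV a" "continuous_on UNIV b"
    "\<And>x. norm x > R \<Longrightarrow> \<Psi> x = 0"
  shows "integral\<^sup>L lborel (\<lambda>x. b x $ j) = 0" "integrable lborel (\<lambda>x. b x $ j)"
proof -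
  define D where "D x h = (\<Sum>i\<in>UNIV. a x $ i * h $ i + b x $ i * cnj (h $ i))" for x h
  have der: "(\<Psi> has_derivative D x) (at x)" for x
  proof -
    have "D x = (\<lambda>h. \<Sum>i\<in>UNIV. a x $ i * h $ i + b x $ i * cnj (h $ i))"
      by (rule ext) (simp add: D_def)
    then show ?thesis using assms(1)[of x] by (simp add: wirt_def)
  qed
  have cont: "continuous_on UNIV (\<lambda>x. D x v)" for v
    unfolding D_def by (intro continuous_intros assms)
  have Dsupp: "D x = (\<lambda>_. 0)" if "norm x > R" for x
  proof -
    have "open {x::complex^3. norm x > R}" by (intro open_Collect_less continuous_intros)
    then have "((\<lambda>_. 0) has_derivative D x) (at x)"
      by (rule has_derivative_transform_within_open[OF der]) (use that assms(4) in auto)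
    then show ?thesis by (rule has_derivative_unique) simp
  qed
  have I: "integrable lborel (\<lambda>x. D x v)" for v
    by (rule integrable_compact_support[OF cont, where R = R]) (auto simp: Dsupp)
  have Z: "integral\<^sup>L lborel (\<lambda>x. D x v) = 0" for v
    by (rule integral_derivative_compact_support[OF der cont assms(4)])
  have eq: "b x $ j = (D x (axis j 1) + \<i> * D x (axis j \<i>)) / 2" for x
    using exhaust_3[of j] by (auto simp: D_def sum_3 axis_def algebra_simps)
  show "integrable lborel (\<lambda>x. b x $ j)" unfolding eq using I by simp
  show "integral\<^sup>L lborel (\<lambda>x. b x $ j) = 0" unfolding eq using I Z by simp
qed

lemma gradient_mult: "gradient (f * g) p = eval g p *s gradient f p + eval f p *s gradient g p"
proof -
  have 1: "(eval (f * g) has_derivative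
     (\<lambda>y. eval f p * (\<Sum>i\<in>UNIV. gradient g p $ i * y $ i) + (\<Sum>i\<in>UNIV. gradient f p $ i * y $ i) * eval g p)) (at p)"
    using has_derivative_mult[OF has_derivative_eval[of f p] has_derivative_eval[of g p]] by (simp add: eval_mult[abs_def])
  have "gradient (f * g) p $ i = (eval g p *s gradient f p + eval f p *s gradient g p) $ i" for i
    using fun_cong[OF has_derivative_unique[OF has_derivative_eval 1], of "axis i 1"] exhaust_3[of i]
    by (auto simp: sum_3 axis_def algebra_simps)
  then show ?thesis by (simp add: vec_eq_iff)
qed

lemma gradient_diff: "gradient (f - g) p = gradient f p - gradient g p"
proof -
  have 1: "(eval (f - g) has_derivative
     (\<lambda>y. (\<Sum>i\<in>UNIV. gradient f p $ i * y $ i) - (\<Sum>i\<in>UNIV. gradient g p $ i * y $ i))) (at p)"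
    using has_derivative_diff[OF has_derivative_eval[of f p] has_derivative_eval[of g p]] by (simp add: eval_diff[abs_def])
  have "gradient (f - g) p $ i = (gradient f p - gradient g p) $ i" for i
    using fun_cong[OF has_derivative_unique[OF has_derivative_eval 1], of "axis i 1"] exhaust_3[of i]
    by (auto simp: sum_3 axis_def algebra_simps)
  then show ?thesis by (simp add: vec_eq_iff)
qed

lemma gradient_var: "gradient (var i) p $ j = (if i = j then 1 else 0)"
  using exhaust_3[of i] exhaust_3[of j]
  by (auto simp: gradient_nth pd_simps var_def eval_def map_poly_pCons pderiv_pCons one_pCons)

section \<open>A continuously differentiable cut-off adapted to the dilation by 2\<close>

definition hat :: "real \<Rightarrow> real" where
  "hat u = max 0 (u - 1) - 2 * max 0 (u - 2) + max 0 (u - 3)"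

definition ramp :: "real \<Rightarrow> real" where
  "ramp u = ((max 0 (u - 1))\<^sup>2 - 2 * (max 0 (u - 2))\<^sup>2 + (max 0 (u - 3))\<^sup>2) / 2"

text \<open>\<open>hat\<close> is the tent over [1, 3] with value 1 at 2, written as a second
  difference, and \<open>ramp\<close> is its primitive, rising from 0 to 1. Subtracting the copy at
  \<open>u / 4\<close> leaves a function supported in 1 \<le> u \<le> 12. The factor 4 is the effect
  on u = |x|^2 of the dilation by 2.\<close>

definition cut :: "real \<Rightarrow> real" where "cut u = ramp u - ramp (u / 4)"

definition cut' :: "real \<Rightarrow> real" where "cut' u = hat u - hat (u / 4) / 4"

lemma DERIV_max0_power2: "((\<lambda>v::real. (max 0 v)\<^sup>2) has_real_derivative 2 * max 0 v) (at v)"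
proof -
  consider "v < 0" | "v > 0" | "v = 0" by linarith
  then show ?thesis
  proof cases
    case 1
    have "((\<lambda>v::real. 0) has_real_derivative 0) (at v)" by simp
    then have "((\<lambda>v::real. (max 0 v)\<^sup>2) has_real_derivative 0) (at v)"
      by (rule has_field_derivative_transform_within_open[of _ _ _ "{..<0}"]) (use 1 in auto)
    then show ?thesis using 1 by simp
  next
    case 2
    have "((\<lambda>v::real. v\<^sup>2) has_real_derivative 2 * v) (at v)" by (auto intro!: derivative_eq_intros)
    then have "((\<lambda>v::real. (max 0 v)\<^sup>2) has_real_derivative 2 * v) (at v)"
      by (rule has_field_derivative_transform_within_open[of _ _ _ "{0<..}"]) (use 2 in auto)
    then show ?thesis using 2 by simp
  next
    case 3
    have "((\<lambda>h::real. (max 0 h)\<^sup>2 / h) \<longlongrightarrow> 0) (at 0)"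
    proof (rule Lim_null_comparison)
      show "((\<lambda>h::real. \<bar>h\<bar>) \<longlongrightarrow> 0) (at 0)" by (auto intro!: tendsto_eq_intros)
      show "\<forall>\<^sub>F h::real in at 0. norm ((max 0 h)\<^sup>2 / h) \<le> \<bar>h\<bar>"
        by (auto intro!: always_eventually simp: max_def power2_eq_square)
    qed
    then show ?thesis using 3 by (simp add: DERIV_def)
  qed
qed

lemma DERIV_ramp: "(ramp has_real_derivative hat u) (at u)"
proof -
  have "((\<lambda>u. (max 0 (u - c))\<^sup>2) has_real_derivative 2 * max 0 (u - c)) (at u)" for c :: real
  proof -
    have "((\<lambda>u. u - c) has_real_derivative 1) (at u)" by (auto intro!: derivative_eq_intros)
    from DERIV_chain2[OF DERIV_max0_power2 this] show ?thesis by simp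
  qed
  note [derivative_intros] = this
  show ?thesis unfolding ramp_def[abs_def] hat_def
    by (rule derivative_eq_intros refl | simp)+
qed

lemma DERIV_cut: "(cut has_real_derivative cut' u) (at u)"
proof -
  have "((\<lambda>u. ramp (u / 4)) has_real_derivative hat (u / 4) * (1 / 4)) (at u)"
    by (rule DERIV_chain2[OF DERIV_ramp]) (auto intro!: derivative_eq_intros)
  from DERIV_diff[OF DERIV_ramp this] show ?thesis by (simp add: cut_def[abs_def] cut'_def)
qed

lemma hat_nonneg: "hat u \<ge> 0" and hat_pos: "1 < u \<Longrightarrow> u < 3 \<Longrightarrow> hat u > 0"
  and hat_zero: "u \<le> 1 \<or> u \<ge> 3 \<Longrightarrow> hat u = 0"
  by (auto simp: hat_def max_def)

lemma cut_nonneg: "u \<ge> 0 \<Longrightarrow> cut u \<ge> 0"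
  unfolding cut_def using DERIV_nonneg_imp_nondecreasing[of "u/4" u ramp] DERIV_ramp hat_nonneg by fastforce

lemma cut_pos: assumes "1 < u" "u < 2" shows "cut u > 0"
  using assms by (simp add: cut_def ramp_def)

lemma cut_zero: assumes "u \<le> 1 \<or> u \<ge> 12" shows "cut u = 0" "cut' u = 0"
proof -
  have "ramp u = 1" if "u \<ge> 3" for u using that by (simp add: ramp_def max_def power2_eq_square algebra_simps)
  moreover have "ramp u = 0" if "u \<le> 1" for u using that by (simp add: ramp_def)
  ultimately show "cut u = 0" using assms by (auto simp: cut_def max_def)
  show "cut' u = 0" using assms by (auto simp: cut'_def hat_zero)
qed

lemma continuous_cut [continuous_intros]:
  "continuous_on S g \<Longrightarrow> continuous_on S (\<lambda>x. cut (g x))" "continuous_on S g \<Longrightarrow> continuous_on S (\<lambda>x. cut' (g x))"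
  unfolding cut_def ramp_def cut'_def hat_def by (intro continuous_intros; simp)+

lemma norm_power2_vec3: "complex_of_real ((norm (x::complex^3))\<^sup>2) = (\<Sum>i\<in>UNIV. x $ i * cnj (x $ i))"
  by (simp add: norm_vec_def L2_set_def sum_nonneg complex_norm_square[unfolded of_real_power])

lemma wirt_norm2: "wirt (\<lambda>x. complex_of_real ((norm x)\<^sup>2)) (\<chi> i. cnj (x $ i)) x x"
proof -
  have 1: "wirt (\<lambda>x. eval (var i) x * cnj (eval (var i) x)) (cnj (x $ i) *s axis i 1) (x $ i *s axis i 1) x" for i
  proof -
    have "gradient (var i) x = axis i 1" by (auto simp: vec_eq_iff gradient_var axis_def)
    then have "wirt (eval (var i)) (axis i 1) 0 x" using wirt_eval[of "var i" x] by simp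
    from wirt_mult[OF this wirt_cnj[OF this]] show ?thesis
      by (rule wirt_cong) (auto simp: vec_eq_iff axis_def)
  qed
  have "wirt (\<lambda>x. complex_of_real ((norm x)\<^sup>2))
       (cnj (x $ 1) *s axis 1 1 + cnj (x $ 2) *s axis 2 1 + cnj (x $ 3) *s axis 3 1)
       (x $ 1 *s axis 1 1 + x $ 2 *s axis 2 1 + x $ 3 *s axis 3 1) x"
    using wirt_add[OF wirt_add[OF 1[of 1] 1[of 2]] 1[of 3]]
    by (simp add: norm_power2_vec3[unfolded of_real_power] sum_3)
  then show ?thesis
    by (rule wirt_cong) (auto simp: vec_eq_iff axis_def forall_3)
qed

lemma continuous_on_vec3:
  fixes g :: "'a::topological_space \<Rightarrow> complex^3"
  assumes "\<And>i. continuous_on S (\<lambda>x. g x $ i)" shows "continuous_on S g"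
  using continuous_on_vec_lambda[of S "\<lambda>i x. g x $ i"] assms by simp

text \<open>\<open>I\<close> is the conjugate derivative in \<open>x $ j\<close> of the product of
  \<open>K\<close>, \<open>T\<close>, \<open>eval P\<close> and the conjugate of
  \<open>eval Q\<close>. The holomorphic factor \<open>P\<close> is not differentiated; the cut-off
  yields \<open>T' x * x $ j\<close> because |x|^2 has conjugate gradient \<open>x\<close>; the
  regularised power yields the term with \<open>K1\<close>.\<close>

lemma integration_by_parts:
  fixes P Q f :: poly3 and s \<epsilon> :: real and j :: 3
  assumes \<epsilon>: "\<epsilon> > 0"
  defines "K \<equiv> \<lambda>x. complex_of_real (((cmod (eval f x))\<^sup>2 + \<epsilon>) powr (- s))"
    and "K1 \<equiv> \<lambda>x. complex_of_real (((cmod (eval f x))\<^sup>2 + \<epsilon>) powr (- s - 1))"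
    and "T \<equiv> \<lambda>x. complex_of_real (cut ((norm (x::complex^3))\<^sup>2))"
    and "T' \<equiv> \<lambda>x. complex_of_real (cut' ((norm (x::complex^3))\<^sup>2))"
  defines "I \<equiv> \<lambda>x. K x * T x * eval P x * cnj (gradient Q x $ j) + eval P x * cnj (eval Q x) *
      (K x * T' x * x $ j - of_real s * K1 x * T x * eval f x * cnj (gradient f x $ j))"
  shows "integral\<^sup>L lborel I = 0" "integrable lborel I"
proof -
  have pos: "(cmod (eval f x))\<^sup>2 + \<epsilon> > 0" for x using \<epsilon> by (simp add: add_nonneg_pos)
  define Psi where "Psi x = K x * T x * (eval P x * cnj (eval Q x))" for x
  define A where "A x = (eval P x * cnj (eval Q x)) *s (T x *s (of_real (- s * ((cmod (eval f x))\<^sup>2 + \<epsilon>) powr (- s - 1)) *s (cnj (eval f x) *s gradient f x))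
      + K x *s (T' x *s (\<chi> i. cnj (x $ i)))) + (K x * T x) *s (cnj (eval Q x) *s gradient P x)" for x
  define B where "B x = (eval P x * cnj (eval Q x)) *s (T x *s (of_real (- s * ((cmod (eval f x))\<^sup>2 + \<epsilon>) powr (- s - 1)) *s (eval f x *s (\<chi> i. cnj (gradient f x $ i))))
      + K x *s (T' x *s x)) + (K x * T x) *s (eval P x *s (\<chi> i. cnj (gradient Q x $ i)))" for x
  have wT: "wirt T (T' x *s (\<chi> i. cnj (x $ i))) (T' x *s x) x" for x
    unfolding T_def T'_def by (rule wirt_compose_real[OF wirt_norm2 DERIV_cut])
  have wN: "wirt (\<lambda>x. complex_of_real ((cmod (eval f x))\<^sup>2)) (cnj (eval f x) *s gradient f x) (eval f x *s (\<chi> i. cnj (gradient f x $ i))) x" for f x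
  proof -
    have "wirt (\<lambda>x. eval f x * cnj (eval f x)) (cnj (eval f x) *s gradient f x) (eval f x *s (\<chi> i. cnj (gradient f x $ i))) x"
      by (rule wirt_cong[OF wirt_mult[OF wirt_eval wirt_cnj[OF wirt_eval]]]) (auto simp: vec_eq_iff)
    then show ?thesis by (simp only: complex_norm_square)
  qed
  have wK: "wirt K (of_real (- s * ((cmod (eval f x))\<^sup>2 + \<epsilon>) powr (- s - 1)) *s (cnj (eval f x) *s gradient f x))
     (of_real (- s * ((cmod (eval f x))\<^sup>2 + \<epsilon>) powr (- s - 1)) *s (eval f x *s (\<chi> i. cnj (gradient f x $ i)))) x" for x
    unfolding K_def
    by (rule wirt_compose_real[OF wN, where \<phi> = "\<lambda>u. (u + \<epsilon>) powr (- s)"])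
       (auto intro!: derivative_eq_intros simp: pos)
  have wPQ: "wirt (\<lambda>x. eval P x * cnj (eval Q x)) (cnj (eval Q x) *s gradient P x) (eval P x *s (\<chi> i. cnj (gradient Q x $ i))) x" for x
    by (rule wirt_cong[OF wirt_mult[OF wirt_eval wirt_cnj[OF wirt_eval]]]) (auto simp: vec_eq_iff)
  have W: "wirt Psi (A x) (B x) x" for x
    unfolding Psi_def A_def B_def by (rule wirt_mult[OF wirt_mult[OF wK wT] wPQ])
  have K_cont: "continuous_on UNIV K" unfolding K_def
    by (intro continuous_intros) (use pos in \<open>auto simp: less_imp_neq[symmetric]\<close>)
  have K1_cont: "continuous_on UNIV (\<lambda>x. ((cmod (eval f x))\<^sup>2 + \<epsilon>) powr (- s - 1))"
    by (intro continuous_intros) (use pos in \<open>auto simp: less_imp_neq[symmetric]\<close>)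
  have T_cont: "continuous_on UNIV T" "continuous_on UNIV T'" unfolding T_def T'_def
    by (intro continuous_intros)+
  have A_cont: "continuous_on UNIV A"
    by (rule continuous_on_vec3, simp add: A_def gradient_nth)
       (intro continuous_intros K_cont K1_cont T_cont)
  have B_cont: "continuous_on UNIV B"
    by (rule continuous_on_vec3, simp add: B_def gradient_nth)
       (intro continuous_intros K_cont K1_cont T_cont)
  have supp: "Psi x = 0" if "norm x > 4" for x
  proof -
    have "(norm x)\<^sup>2 \<ge> 4\<^sup>2" using that by (intro power_mono) auto
    then have "cut ((norm x)\<^sup>2) = 0" by (intro cut_zero) auto
    then show ?thesis by (simp add: Psi_def T_def)
  qed
  have eq: "B x $ j = I x" for x
    by (simp add: B_def I_def K1_def algebra_simps)
  show "integral\<^sup>L lborel I = 0" "integrable lborel I"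
    using wirt_integral_0[OF W A_cont B_cont supp, where j = j] by (simp_all add: eq[abs_def])
qed


section \<open>Vanishing of syzygies of small degree\<close>

text \<open>Integrability is assumed on a shell only, since the weight need not be integrable at the
  origin. The shell contains the support of the cut-off, and its exponent is the one that
  \<open>F\<close> will have.\<close>

locale jacobian_syzygy =
  fixes f :: poly3 and \<delta> :: "3 \<Rightarrow> poly3" and d m :: nat
  assumes hom_f: "homogeneous d f" and d_pos: "d > 0"
    and hom: "\<And>i. homogeneous m (\<delta> i)"
    and syz: "\<And>p. (\<Sum>i\<in>UNIV. eval (\<delta> i) p * gradient f p $ i) = 0"
    and int: "integrable lborel (\<lambda>x. indicator {x. 1 \<le> norm x \<and> norm x \<le> 4} x *
        cmod (eval f x) powr (- 2 * ((real m + 2) / real d)))"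
    and null: "AE x in lborel. eval f x \<noteq> 0"
begin

section \<open>The regularised weights and their limits\<close>

definition "s = (real m + 2) / real d"
definition "F x = complex_of_real (cmod (eval f x) powr (- 2 * s))"
definition "K n x = complex_of_real (((cmod (eval f x))\<^sup>2 + inverse (real (Suc n))) powr (- s))"
definition "K1 n x = complex_of_real (((cmod (eval f x))\<^sup>2 + inverse (real (Suc n))) powr (- s - 1))"
definition "D = (\<Sum>i\<in>UNIV. pd i (\<delta> i))"
definition "T x = complex_of_real (cut ((norm (x::complex^3))\<^sup>2))"
definition "T' x = complex_of_real (cut' ((norm (x::complex^3))\<^sup>2))"

lemma s_pos: "s > 0" using d_pos by (simp add: s_def)

lemma T_cont: "continuous_on UNIV T" "continuous_on UNIV T'"
  unfolding T_def T'_def by (intro continuous_intros)+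

lemma T_supp: assumes "\<not> (1 \<le> norm x \<and> norm x \<le> 4)" shows "T x = 0" "T' x = 0"
proof -
  have "(norm x)\<^sup>2 \<le> 1 \<or> (norm x)\<^sup>2 \<ge> 12"
  proof (cases "norm x < 1")
    case True
    then show ?thesis using power_mono[of "norm x" 1 2] by simp
  next
    case False
    then have "norm x \<ge> 4" using assms by simp
    then show ?thesis using power_mono[of 4 "norm x" 2] by simp
  qed
  then show "T x = 0" "T' x = 0" by (simp_all add: T_def T'_def cut_zero)
qed

lemma powr_double: "a \<ge> 0 \<Longrightarrow> (a\<^sup>2) powr (- t) = a powr (- 2 * t)" for a t :: real
  by (cases "a = 0") (auto simp: powr_def ln_realpow)

lemma K_le: assumes "eval f x \<noteq> 0" shows "norm (K n x) \<le> norm (F x)"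
proof -
  have "((cmod (eval f x))\<^sup>2 + inverse (real (Suc n))) powr (- s) \<le> ((cmod (eval f x))\<^sup>2) powr (- s)"
    using assms s_pos by (intro powr_mono2') auto
  then show ?thesis by (simp add: K_def F_def powr_double)
qed

lemma K_eq: "K n x = K1 n x * of_real ((cmod (eval f x))\<^sup>2 + inverse (real (Suc n)))"
proof -
  have "(cmod (eval f x))\<^sup>2 + inverse (real (Suc n)) > 0" by (intro add_nonneg_pos) auto
  then show ?thesis
    by (simp only: K_def K1_def of_real_mult[symmetric] powr_mult_base[of _ "-s - 1"] mult.commute[of "_ powr _"])
       (simp add: powr_mult_base)
qed

text \<open>\<open>K n\<close> is \<open>K1 n\<close> times |f|^2 + \<epsilon>, and \<epsilon> alone
  is at most this factor. Thus \<epsilon> \<open>K1\<close> is dominated by \<open>F\<close>,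
  although the limit of \<open>K1\<close>, of exponent \<open>s + 1\<close>, need not be
  integrable.\<close>

lemma eK1_le: "norm (inverse (real (Suc n)) * K1 n x) \<le> norm (K n x)"
proof -
  have "norm (inverse (real (Suc n)) * K1 n x) = norm (K1 n x) * inverse (real (Suc n))"
    by (simp add: norm_mult norm_inverse del: of_nat_Suc)
  also have "\<dots> \<le> norm (K1 n x) * ((cmod (eval f x))\<^sup>2 + inverse (real (Suc n)))"
    by (intro mult_left_mono) auto
  also have "\<dots> = norm (K n x)"
    unfolding K_eq norm_mult norm_of_real by simp
  finally show ?thesis .
qed

lemma K_lim: assumes "eval f x \<noteq> 0" shows "(\<lambda>n. K n x) \<longlonglongrightarrow> F x"
proof -
  have "(\<lambda>n. ((cmod (eval f x))\<^sup>2 + inverse (real (Suc n))) powr (- s)) \<longlonglongrightarrow> ((cmod (eval f x))\<^sup>2 + 0) powr (- s)"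
    by (intro tendsto_intros LIMSEQ_inverse_real_of_nat) (use assms in auto)
  then show ?thesis by (simp add: K_def F_def powr_double tendsto_of_real_iff)
qed

lemma eK1_lim: assumes "eval f x \<noteq> 0" shows "(\<lambda>n. of_real (inverse (real (Suc n))) * K1 n x) \<longlonglongrightarrow> 0"
proof -
  have "(\<lambda>n. inverse (real (Suc n)) * ((cmod (eval f x))\<^sup>2 + inverse (real (Suc n))) powr (- s - 1))
     \<longlonglongrightarrow> 0 * ((cmod (eval f x))\<^sup>2 + 0) powr (- s - 1)"
    by (intro tendsto_intros LIMSEQ_inverse_real_of_nat) (use assms in auto)
  then have "(\<lambda>n. complex_of_real (inverse (real (Suc n)) * ((cmod (eval f x))\<^sup>2 + inverse (real (Suc n))) powr (- s - 1))) \<longlonglongrightarrow> of_real 0"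
    by (intro tendsto_of_real) simp
  then show ?thesis by (simp add: K1_def)
qed

lemma meas [measurable]: "F \<in> borel_measurable borel" "K n \<in> borel_measurable borel" "K1 n \<in> borel_measurable borel"
  "T \<in> borel_measurable borel" "T' \<in> borel_measurable borel" "eval g \<in> borel_measurable borel"
proof -
  show [measurable]: "eval g \<in> borel_measurable borel" for g
    using continuous_on_eval[OF continuous_on_id] by (intro borel_measurable_continuous_onI) simp
  show "F \<in> borel_measurable borel" "K n \<in> borel_measurable borel" "K1 n \<in> borel_measurable borel"
    unfolding F_def K_def K1_def by measurable
  show "T \<in> borel_measurable borel" "T' \<in> borel_measurable borel"
    using T_cont by (auto intro: borel_measurable_continuous_onI)
qed

lemma dominating:
  assumes h: "continuous_on UNIV h" "\<And>x. \<not> (1 \<le> norm x \<and> norm x \<le> 4) \<Longrightarrow> h x = 0"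
  shows "integrable lborel (\<lambda>x. norm (F x * h x))"
proof -
  have [measurable]: "h \<in> borel_measurable borel" by (rule borel_measurable_continuous_onI[OF h(1)])
  have "bounded (h ` cball 0 4)"
    by (intro compact_imp_bounded compact_continuous_image continuous_on_subset[OF h(1)]) auto
  then obtain B where B: "\<forall>x\<in>cball 0 4. norm (h x) \<le> B" by (auto simp: bounded_iff)
  show ?thesis
  proof (rule Bochner_Integration.integrable_bound)
    show "integrable lborel (\<lambda>x. B * (indicator {x. 1 \<le> norm x \<and> norm x \<le> 4} x *
        cmod (eval f x) powr (- 2 * ((real m + 2) / real d))))"
      using int by (rule integrable_mult_right)
    show "AE x in lborel. norm (norm (F x * h x)) \<le> norm (B * (indicator {x. 1 \<le> norm x \<and> norm x \<le> 4} x *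
        cmod (eval f x) powr (- 2 * ((real m + 2) / real d))))"
    proof (rule AE_I2)
      fix x
      show "norm (norm (F x * h x)) \<le> norm (B * (indicator {x. 1 \<le> norm x \<and> norm x \<le> 4} x *
        cmod (eval f x) powr (- 2 * ((real m + 2) / real d))))"
      proof (cases "1 \<le> norm x \<and> norm x \<le> 4")
        case True
        then have "norm (h x) \<le> B" using B by simp
        then have "norm (h x) \<le> \<bar>B\<bar>" by simp
        then have "cmod (eval f x) powr (- 2 * s) * norm (h x) \<le> cmod (eval f x) powr (- 2 * s) * \<bar>B\<bar>"
          by (intro mult_left_mono) auto
        then show ?thesis
          unfolding s_def[symmetric] using True by (simp add: F_def norm_mult abs_mult mult.commute)
      qed (simp add: h(2))
    qed
  qed measurable
qed

text \<open>The form in which the regularisation is removed: against a continuous \<open>h\<close>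
  supported in the shell, \<open>K n\<close> may be replaced by \<open>F\<close> and \<epsilon>
  \<open>K1 n\<close> by 0. The common majorant is the norm of \<open>F x * h x\<close>.\<close>

lemma lim_K:
  assumes h: "continuous_on UNIV h" "\<And>x. \<not> (1 \<le> norm x \<and> norm x \<le> 4) \<Longrightarrow> h x = 0"
  shows "integrable lborel (\<lambda>x. F x * h x)" "integrable lborel (\<lambda>x. K n x * h x)"
    "(\<lambda>n. integral\<^sup>L lborel (\<lambda>x. K n x * h x)) \<longlonglongrightarrow> integral\<^sup>L lborel (\<lambda>x. F x * h x)"
    "integrable lborel (\<lambda>x. of_real (inverse (real (Suc n))) * K1 n x * h x)"
    "(\<lambda>n. integral\<^sup>L lborel (\<lambda>x. of_real (inverse (real (Suc n))) * K1 n x * h x)) \<longlonglongrightarrow> 0"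
proof -
  have [measurable]: "h \<in> borel_measurable borel" by (rule borel_measurable_continuous_onI[OF h(1)])
  have dom: "integrable lborel (\<lambda>x. norm (F x * h x))" by (rule dominating[OF h])
  have 1: "AE x in lborel. (\<lambda>n. K n x * h x) \<longlonglongrightarrow> F x * h x"
    using null by eventually_elim (intro tendsto_intros K_lim)
  have 2: "AE x in lborel. norm (K n x * h x) \<le> norm (F x * h x)" for n
    using null by eventually_elim (simp only: norm_mult, intro mult_right_mono K_le, auto)
  have 3: "AE x in lborel. (\<lambda>n. of_real (inverse (real (Suc n))) * K1 n x * h x) \<longlonglongrightarrow> 0"
    using null by eventually_elim (rule tendsto_mult_left_zero, rule eK1_lim)
  have 4: "AE x in lborel. norm (of_real (inverse (real (Suc n))) * K1 n x * h x) \<le> norm (F x * h x)" for n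
    using null
  proof eventually_elim
    case (elim x)
    show ?case unfolding norm_mult[of _ "h x"]
      by (intro mult_right_mono order_trans[OF eK1_le K_le[OF elim]]) auto
  qed
  note a = integral_dominated_convergence[of "\<lambda>x. F x * h x" lborel "\<lambda>n x. K n x * h x", OF _ _ dom 1 2]
  note b = integral_dominated_convergence[of "\<lambda>x. 0" lborel "\<lambda>n x. of_real (inverse (real (Suc n))) * K1 n x * h x", OF _ _ dom 3 4]
  show "(\<lambda>n. integral\<^sup>L lborel (\<lambda>x. K n x * h x)) \<longlonglongrightarrow> integral\<^sup>L lborel (\<lambda>x. F x * h x)"
    by (rule a) measurable
  show "(\<lambda>n. integral\<^sup>L lborel (\<lambda>x. of_real (inverse (real (Suc n))) * K1 n x * h x)) \<longlonglongrightarrow> 0"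
    using b by simp
  show "integrable lborel (\<lambda>x. F x * h x)" using dom by (subst (asm) integrable_norm_iff) auto
  show "integrable lborel (\<lambda>x. K n x * h x)"
    by (rule Bochner_Integration.integrable_bound[OF dom]) (use 2 in \<open>auto simp: norm_mult\<close>)
  show "integrable lborel (\<lambda>x. of_real (inverse (real (Suc n))) * K1 n x * h x)"
    by (rule Bochner_Integration.integrable_bound[OF dom]) (use 4 in \<open>auto simp: norm_mult\<close>)
qed

lemma integration_by_parts_K:
  "integral\<^sup>L lborel (\<lambda>x. K n x * T x * eval P x * cnj (gradient Q x $ j) + eval P x * cnj (eval Q x) *
      (K n x * T' x * x $ j - of_real s * K1 n x * T x * eval f x * cnj (gradient f x $ j))) = 0"
  "integrable lborel (\<lambda>x. K n x * T x * eval P x * cnj (gradient Q x $ j) + eval P x * cnj (eval Q x) *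
      (K n x * T' x * x $ j - of_real s * K1 n x * T x * eval f x * cnj (gradient f x $ j)))"
  using integration_by_parts[of "inverse (real (Suc n))" f s P Q j] by (simp_all add: K_def K1_def T_def T'_def)

lemma eval_D: "eval D x = (\<Sum>i\<in>UNIV. gradient (\<delta> i) x $ i)"
  by (simp add: D_def gradient_nth)

section \<open>The two integral identities and their consequences\<close>

definition "\<beta> x = (\<Sum>j\<in>UNIV. x $ j * cnj (eval (\<delta> j) x))"
text \<open>These are the components of the bivector of \<open>x\<close> and \<delta>.
  \<open>Q\<close> is the squared norm of their cross product; the division by 2 corrects for
  counting each pair of indices twice.\<close>

definition "q j k = var j * \<delta> k - \<delta> j * var k"
definition "Q x = (\<Sum>k\<in>UNIV. \<Sum>j\<in>UNIV. (cmod (eval (q j k) x))\<^sup>2) / 2"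

text \<open>Integrate by parts with \<open>D\<close> for the holomorphic factor and
  \<open>\<delta> j\<close> for the conjugated one, and sum over \<open>j\<close>. The derivatives
  of the conjugates add up to the conjugate of \<open>D\<close>, those of the cut-off to \<beta>,
  and the derivative of the weight drops out by the conjugate of \<open>syz\<close>.\<close>

lemma first_identity:
  "integral\<^sup>L lborel (\<lambda>x. F x * (T x * eval D x * cnj (eval D x) + T' x * eval D x * \<beta> x)) = 0"
proof -
  let ?h = "\<lambda>x. T x * eval D x * cnj (eval D x) + T' x * eval D x * \<beta> x"
  have "K n x * ?h x = (\<Sum>j\<in>UNIV. K n x * T x * eval D x * cnj (gradient (\<delta> j) x $ j) + eval D x * cnj (eval (\<delta> j) x) *
      (K n x * T' x * x $ j - of_real s * K1 n x * T x * eval f x * cnj (gradient f x $ j)))" for n x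
  proof -
    have "(\<Sum>i\<in>UNIV. cnj (eval (\<delta> i) x) * cnj (gradient f x $ i)) = cnj 0" 
      unfolding syz[of x, symmetric] by simp
    note z = this
    have *: "(\<Sum>i\<in>UNIV. eval D x * cnj (eval (\<delta> i) x) * (of_real s * K1 n x * T x * eval f x * cnj (gradient f x $ i))) = 0"
    proof -
      have "(\<Sum>i\<in>UNIV. eval D x * cnj (eval (\<delta> i) x) * (of_real s * K1 n x * T x * eval f x * cnj (gradient f x $ i)))
        = eval D x * (of_real s * K1 n x * T x * eval f x) * (\<Sum>i\<in>UNIV. cnj (eval (\<delta> i) x) * cnj (gradient f x $ i))"
        unfolding sum_distrib_left by (intro sum.cong refl) simp
      then show ?thesis using z by simp
    qed
    show ?thesis
      using * by (simp add: sum_3 \<beta>_def eval_D algebra_simps)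
  qed
  then have 0: "integral\<^sup>L lborel (\<lambda>x. K n x * ?h x) = 0" for n
    by (simp only:, subst Bochner_Integration.integral_sum) (simp_all only: integration_by_parts_K sum.neutral_const)
  have "continuous_on UNIV ?h"
    unfolding \<beta>_def by (intro continuous_intros T_cont)
  then have "(\<lambda>n. integral\<^sup>L lborel (\<lambda>x. K n x * ?h x)) \<longlonglongrightarrow> integral\<^sup>L lborel (\<lambda>x. F x * ?h x)"
    by (rule lim_K) (simp add: T_supp)
  then show ?thesis unfolding 0 by (simp add: LIMSEQ_const_iff)
qed

lemma F_scale: "F (2 *\<^sub>R x) = F x / 2 ^ (2 * m + 4)"
proof -
  have e: "eval f (2 *\<^sub>R x) = 2 ^ d * eval f x"
    using eval_scale[OF hom_f, of 2 x] by (simp add: scaleR_smult)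
  \<comment> \<open>The choice of \<open>s\<close> makes \<open>F\<close> homogeneous of the even
    integer degree -(2m + 4).\<close>
  have sd: "real d * s = real m + 2" using d_pos by (simp add: s_def)
  have "((2::real) ^ d) powr (- 2 * s) = (2 powr real d) powr (- 2 * s)"
    by (simp add: powr_realpow)
  also have "\<dots> = 2 powr (- (real (2 * m + 4)))"
  proof -
    have "real d * (- 2 * s) = - 2 * (real d * s)" by simp
    then have "real d * (- 2 * s) = - real (2 * m + 4)" unfolding sd by simp
    then show ?thesis by (simp only: powr_powr)
  qed
  also have "\<dots> = inverse (2 ^ (2 * m + 4))"
    by (simp only: powr_minus powr_realpow[of 2] zero_less_numeral)
  finally show ?thesis
    by (simp add: F_def e norm_mult norm_power powr_mult divide_inverse mult.commute)
qed

lemma delta_scale: "eval (\<delta> i) (2 *\<^sub>R x) = 2 ^ m * eval (\<delta> i) x"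
  using eval_scale[OF hom, of i 2 x] by (simp add: scaleR_smult)

text \<open>The factor 2 on the left replaces the exponent \<open>m - 1\<close>, which would be
  truncated for \<open>m = 0\<close>; in that case \<open>D\<close> vanishes.\<close>

lemma D_scale: "2 * eval D (2 *\<^sub>R x) = 2 ^ m * eval D x"
proof (cases "m = 0")
  case True
  then have "D = 0" using pd_eq_0 hom by (simp add: D_def)
  then show ?thesis by simp
next
  case False
  have "homogeneous (m - 1) D" unfolding D_def by (intro homogeneous_sum homogeneous_pd hom)
  from eval_scale[OF this, of 2 x] show ?thesis using False by (cases m) (simp_all add: scaleR_smult)
qed

text \<open>Substituting \<open>2 *\<^sub>R x\<close> in the summand \<open>hat (u / 4) / 4\<close>
  of \<open>T'\<close> turns it into \<open>hat u\<close> with the factor 2^6 \<kappa> / 4 = 16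
  \<kappa>, since the real dimension is 6.\<close>

lemma scaling_integral:
  assumes B: "\<And>x. B (2 *\<^sub>R x) = \<kappa> * B x" and h: "B = (\<lambda>x. F x * h x)" "continuous_on UNIV h"
  shows "integral\<^sup>L lborel (\<lambda>x. B x * T' x) = (1 - 16 * \<kappa>) * integral\<^sup>L lborel (\<lambda>x. B x * of_real (hat ((norm x)\<^sup>2)))"
    "integrable lborel (\<lambda>x. B x * of_real (hat ((norm x)\<^sup>2)))"
proof -
  have [measurable]: "h \<in> borel_measurable borel" by (rule borel_measurable_continuous_onI[OF h(2)])
  have hat_c: "continuous_on UNIV (\<lambda>x::complex^3. complex_of_real (hat ((norm x)\<^sup>2)))"
    "continuous_on UNIV (\<lambda>x::complex^3. complex_of_real (hat ((norm x)\<^sup>2 / 4)))"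
    unfolding hat_def by (intro continuous_intros; simp)+
  have z1: "hat ((norm x)\<^sup>2) = 0" if "\<not> (1 \<le> norm x \<and> norm x \<le> 4)" for x :: "complex^3"
  proof (cases "norm x < 1")
    case True
    then show ?thesis using power_mono[of "norm x" 1 2] by (simp add: hat_zero)
  next
    case False
    then show ?thesis using that power_mono[of 4 "norm x" 2] by (simp add: hat_zero)
  qed
  have z2: "hat ((norm x)\<^sup>2 / 4) = 0" if "\<not> (1 \<le> norm x \<and> norm x \<le> 4)" for x :: "complex^3"
  proof (cases "norm x < 1")
    case True
    then show ?thesis using power_mono[of "norm x" 1 2] by (simp add: hat_zero)
  next
    case False
    then show ?thesis using that power_mono[of 4 "norm x" 2] by (simp add: hat_zero)
  qed
  have i1: "integrable lborel (\<lambda>x. F x * (h x * of_real (hat ((norm x)\<^sup>2))))"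
    by (rule lim_K) (auto intro!: continuous_intros h hat_c simp: z1)
  have i2: "integrable lborel (\<lambda>x. F x * (h x * (of_real (hat ((norm x)\<^sup>2 / 4)) / 4)))"
    by (rule lim_K) (auto intro!: continuous_intros h hat_c simp: z2)
  have hm: "hat \<in> borel_measurable borel" unfolding hat_def[abs_def] by measurable
  note [measurable] = hm
  have "integral\<^sup>L lborel (\<lambda>x. B x * (of_real (hat ((norm x)\<^sup>2 / 4)) / 4))
     = 64 *\<^sub>R integral\<^sup>L lborel (\<lambda>x. B (2 *\<^sub>R x) * (of_real (hat ((norm (2 *\<^sub>R x))\<^sup>2 / 4)) / 4))"
    by (subst lborel_integral_affine[of _ 2 0]) (simp_all add: h)
  also have "\<dots> = 64 *\<^sub>R integral\<^sup>L lborel (\<lambda>x. (\<kappa> / 4) * (B x * of_real (hat ((norm x)\<^sup>2))))"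
    by (intro arg_cong[of _ _ "(*\<^sub>R) 64"] Bochner_Integration.integral_cong refl) (simp add: B power_mult_distrib)
  also have "\<dots> = 16 * \<kappa> * integral\<^sup>L lborel (\<lambda>x. B x * of_real (hat ((norm x)\<^sup>2)))"
    by (simp add: scaleR_conv_of_real)
  finally have e: "integral\<^sup>L lborel (\<lambda>x. B x * (of_real (hat ((norm x)\<^sup>2 / 4)) / 4)) = \<dots>" .
  have "integral\<^sup>L lborel (\<lambda>x. B x * T' x) = integral\<^sup>L lborel (\<lambda>x. B x * of_real (hat ((norm x)\<^sup>2)) - B x * (of_real (hat ((norm x)\<^sup>2 / 4)) / 4))"
    by (intro Bochner_Integration.integral_cong refl) (simp add: T'_def cut'_def right_diff_distrib)
  also have "\<dots> = integral\<^sup>L lborel (\<lambda>x. B x * of_real (hat ((norm x)\<^sup>2))) - integral\<^sup>L lborel (\<lambda>x. B x * (of_real (hat ((norm x)\<^sup>2 / 4)) / 4))"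
    using i1 i2 by (intro Bochner_Integration.integral_diff) (simp_all add: h mult.assoc)
  finally show "integral\<^sup>L lborel (\<lambda>x. B x * T' x) = (1 - 16 * \<kappa>) * integral\<^sup>L lborel (\<lambda>x. B x * of_real (hat ((norm x)\<^sup>2)))"
    unfolding e by (simp add: algebra_simps)
  show "integrable lborel (\<lambda>x. B x * of_real (hat ((norm x)\<^sup>2)))"
    using i1 by (simp add: h mult.assoc)
qed

lemma open_null_empty:
  fixes U :: "(complex^3) set"
  assumes "open U" "AE x in lborel. x \<notin> U" shows "U = {}"
proof -
  have "U \<in> null_sets lborel" using assms by (simp add: AE_iff_null_sets)
  then have "negligible U" by (simp add: negligible_iff_null_sets null_sets_completionI)
  then show ?thesis using open_not_negligible[OF assms(1)] by blast
qed

lemma f_nonzero: "f \<noteq> 0"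
proof
  assume "f = 0"
  then have "AE x in (lborel :: (complex^3) measure). x \<notin> UNIV" using null by simp
  then show False using open_null_empty[OF open_UNIV] by simp
qed

text \<open>Multiplying by \<open>f\<close> disposes of the zeros of \<open>f\<close>, and every
  other point can be scaled to squared norm 3/2. The interval (1, 2) is one on which both
  \<open>cut\<close> and \<open>hat\<close> are positive.\<close>

lemma vanishing_on_shell:
  assumes g: "homogeneous n g" and gs: "\<And>x. 1 < (norm x)\<^sup>2 \<Longrightarrow> (norm x)\<^sup>2 < 2 \<Longrightarrow> eval f x \<noteq> 0 \<Longrightarrow> eval g x = 0"
  shows "g = 0"
proof -
  have "eval (g * f) x = 0" for x
  proof (cases "x = 0 \<or> eval f x = 0")
    case True
    moreover have "eval f 0 = 0" using eval_scale[OF hom_f, of 0 0] d_pos by (simp add: power_0_left)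
    ultimately show ?thesis by auto
  next
    case False
    define c where "c = sqrt (3/2) / norm x"
    have c: "c > 0" using False by (simp add: c_def)
    have e: "(norm (c *\<^sub>R x))\<^sup>2 = 3/2" using False by (simp add: c_def power_mult_distrib power_divide)
    have "eval f (c *\<^sub>R x) \<noteq> 0" using False c by (simp add: scaleR_smult eval_scale[OF hom_f])
    then have "eval g (c *\<^sub>R x) = 0" using e by (intro gs) auto
    then show ?thesis using c by (simp add: scaleR_smult eval_scale[OF g])
  qed
  then have "g * f = 0" by (rule eval_eq_0_imp)
  then show ?thesis using f_nonzero by simp
qed

lemma D_eq_0: "D = 0"
proof -
  define h where "h x = eval D x * \<beta> x" for x
  have hc: "continuous_on UNIV h" unfolding h_def \<beta>_def by (intro continuous_intros)
  have \<beta>2: "\<beta> (2 *\<^sub>R x) = 2 * 2 ^ m * \<beta> x" for x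
    by (simp add: \<beta>_def delta_scale sum_distrib_left scaleR_conv_of_real[where 'a = complex] algebra_simps)
  \<comment> \<open>The degree is -(2m + 4) + (m - 1) + (m + 1) = -4, so the factor
    \<open>1 - 16 * \<kappa>\<close> of \<open>scaling_integral\<close> vanishes.\<close>
  have "F (2 *\<^sub>R x) * h (2 *\<^sub>R x) = (1/16) * (F x * h x)" for x
  proof -
    have D: "eval D (2 *\<^sub>R x) = 2 ^ m * eval D x / 2" using D_scale[of x] by (simp add: mult.commute)
    define a :: complex where "a = 2 ^ m"
    have "(2 :: complex) ^ (2 * m + 4) = 2 ^ m * 2 ^ m * 2 ^ 4" by (simp only: power_add[symmetric] mult_2)
    then have a: "a \<noteq> 0" "(2 :: complex) ^ (2 * m + 4) = a * a * 16" by (simp_all add: a_def)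
    show ?thesis
      unfolding h_def \<beta>2 D F_scale a(2) unfolding a_def[symmetric] using a(1) by (simp add: divide_simps)
  qed
  then have "integral\<^sup>L lborel (\<lambda>x. F x * h x * T' x) = 0"
    using scaling_integral(1)[of "\<lambda>x. F x * h x" "1/16" h] hc by simp
  moreover have i1: "integrable lborel (\<lambda>x. F x * (T x * eval D x * cnj (eval D x)))"
    by (rule lim_K) (auto intro!: continuous_intros T_cont simp: T_supp)
  moreover have "integrable lborel (\<lambda>x. F x * (T' x * eval D x * \<beta> x))"
    unfolding \<beta>_def by (rule lim_K) (auto intro!: continuous_intros T_cont simp: T_supp)
  ultimately have "integral\<^sup>L lborel (\<lambda>x. F x * (T x * eval D x * cnj (eval D x))) = 0"
    using first_identity by (simp add: h_def distrib_left algebra_simps)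
  moreover have eq: "F x * (T x * eval D x * cnj (eval D x)) = of_real (norm (F x) * cut ((norm x)\<^sup>2) * (cmod (eval D x))\<^sup>2)" for x
    by (simp add: F_def T_def complex_norm_square[unfolded of_real_power])
  ultimately have z: "integral\<^sup>L lborel (\<lambda>x. norm (F x) * cut ((norm x)\<^sup>2) * (cmod (eval D x))\<^sup>2) = 0"
    by (simp only: integral_complex_of_real of_real_eq_0_iff)
  have "integrable lborel (\<lambda>x. norm (F x) * cut ((norm x)\<^sup>2) * (cmod (eval D x))\<^sup>2)"
    using i1 unfolding eq by (simp only: complex_of_real_integrable_eq)
  from integral_nonneg_eq_0_iff_AE[OF this] z
  have "AE x in lborel. norm (F x) * cut ((norm x)\<^sup>2) * (cmod (eval D x))\<^sup>2 = 0"
    by (simp add: cut_nonneg)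
  \<comment> \<open>A nonnegative integrand with integral 0 vanishes almost everywhere. Where weight
    and cut-off are positive, this makes \<open>D\<close> vanish outside a set which is both open
    and null, hence empty.\<close>
  then have "AE x in lborel. x \<notin> {x. 1 < (norm x)\<^sup>2 \<and> (norm x)\<^sup>2 < 2 \<and> eval f x \<noteq> 0 \<and> eval D x \<noteq> 0}"
    using null
  proof eventually_elim
    case (elim x)
    then show ?case using cut_pos[of "(norm x)\<^sup>2"] by (auto simp: F_def)
  qed
  moreover have "open {x. 1 < (norm x)\<^sup>2 \<and> (norm x)\<^sup>2 < 2 \<and> eval f x \<noteq> 0 \<and> eval D x \<noteq> 0}"
    by (intro open_Collect_conj open_Collect_less open_Collect_neq continuous_intros)
  ultimately have "{x. 1 < (norm x)\<^sup>2 \<and> (norm x)\<^sup>2 < 2 \<and> eval f x \<noteq> 0 \<and> eval D x \<noteq> 0} = {}"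
    using open_null_empty by blast
  moreover have "homogeneous (m - 1) D" unfolding D_def by (intro homogeneous_sum homogeneous_pd hom)
  ultimately show ?thesis using vanishing_on_shell by blast
qed

text \<open>Integrate by parts with \<open>\<delta> k\<close> and \<open>q j k\<close> and sum over
  both indices. The divergence of \<open>q\<close> gives \<open>m + 2\<close>, the derivative of the
  weight gives \<open>s * d\<close>, and as these agree, what is left next to the term with
  \<open>Q\<close> is the difference \<open>K - |f|^2 K1\<close> = \<epsilon> \<open>K1\<close>,
  which tends to 0 under the integral.\<close>

lemma second_identity: "integral\<^sup>L lborel (\<lambda>x. F x * (of_real (Q x) * T' x)) = 0"
proof -
  let ?I = "\<lambda>n j k x. K n x * T x * eval (\<delta> k) x * cnj (gradient (q j k) x $ j) + eval (\<delta> k) x * cnj (eval (q j k) x) *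
      (K n x * T' x * x $ j - of_real s * K1 n x * T x * eval f x * cnj (gradient f x $ j))"
  let ?N = "\<lambda>x. \<Sum>k\<in>UNIV. eval (\<delta> k) x * cnj (eval (\<delta> k) x)"
  define h where "h x = (of_nat m + 2) * (T x * ?N x)" for x
  have pt: "(\<Sum>k\<in>UNIV. \<Sum>j\<in>UNIV. ?I n j k x) = K n x * (of_real (Q x) * T' x)
       + of_real (inverse (real (Suc n))) * K1 n x * h x" for n x
  proof -
    \<comment> \<open>The divergence of \<open>x\<close> gives 3, the derivative of
      \<open>x $ k\<close> gives -1, Euler's relation gives \<open>m\<close>, and the remaining term
      contains \<open>D\<close>, which is 0.\<close>
    have G: "(\<Sum>j\<in>UNIV. gradient (q j k) x $ j) = (of_nat m + 2) * eval (\<delta> k) x" for k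
    proof -
      have 1: "(\<Sum>i\<in>UNIV. x $ i * gradient (\<delta> k) x $ i) = of_nat m * eval (\<delta> k) x" by (rule euler_gradient[OF hom])
      have 2: "(\<Sum>i\<in>UNIV. gradient (\<delta> i) x $ i) = 0" using eval_D[of x] by (simp add: D_eq_0)
      have "(\<Sum>j\<in>UNIV. gradient (q j k) x $ j) = (\<Sum>i\<in>UNIV. x $ i * gradient (\<delta> k) x $ i) + 2 * eval (\<delta> k) x
          - x $ k * (\<Sum>i\<in>UNIV. gradient (\<delta> i) x $ i)"
        using exhaust_3[of k] by (auto simp: q_def gradient_diff gradient_mult gradient_var sum_3 algebra_simps)
      then show ?thesis using 1 2 by (simp add: algebra_simps)
    qed
    have Fq: "(\<Sum>j\<in>UNIV. eval (q j k) x * gradient f x $ j) = of_nat d * eval f x * eval (\<delta> k) x" for k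
    proof -
      have "(\<Sum>j\<in>UNIV. eval (q j k) x * gradient f x $ j) = (\<Sum>i\<in>UNIV. x $ i * gradient f x $ i) * eval (\<delta> k) x
         - (\<Sum>i\<in>UNIV. eval (\<delta> i) x * gradient f x $ i) * x $ k"
        by (simp add: q_def sum_3 algebra_simps)
      then show ?thesis using euler_gradient[OF hom_f] syz by simp
    qed
    \<comment> \<open>By antisymmetry of \<open>q\<close> in its indices, only one of the two terms
      of each \<open>q j k\<close> has to be paired with its conjugate.\<close>
    have Qx: "of_real (Q x) = (\<Sum>k\<in>UNIV. eval (\<delta> k) x * (\<Sum>j\<in>UNIV. x $ j * cnj (eval (q j k) x)))"
    proof -
      have "2 * complex_of_real (Q x) = (\<Sum>k\<in>UNIV. \<Sum>j\<in>UNIV. eval (q j k) x * cnj (eval (q j k) x))"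
        by (simp add: Q_def complex_norm_square[unfolded of_real_power])
      also have "\<dots> = 2 * (\<Sum>k\<in>UNIV. eval (\<delta> k) x * (\<Sum>j\<in>UNIV. x $ j * cnj (eval (q j k) x)))"
        by (simp add: q_def sum_3 algebra_simps)
      finally show ?thesis by simp
    qed
    have sd: "of_real s * (of_nat d :: complex) = of_nat m + 2"
      using d_pos by (simp add: s_def)
    have "(\<Sum>j\<in>UNIV. ?I n j k x) = K n x * T x * eval (\<delta> k) x * cnj (\<Sum>j\<in>UNIV. gradient (q j k) x $ j)
       + K n x * T' x * (eval (\<delta> k) x * (\<Sum>j\<in>UNIV. x $ j * cnj (eval (q j k) x)))
       - of_real s * K1 n x * T x * eval f x * eval (\<delta> k) x * cnj (\<Sum>j\<in>UNIV. eval (q j k) x * gradient f x $ j)" for k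
      by (simp add: sum_3 algebra_simps)
    also have "\<dots> k = K n x * T' x * (eval (\<delta> k) x * (\<Sum>j\<in>UNIV. x $ j * cnj (eval (q j k) x)))
       + (of_nat m + 2) * (T x * (eval (\<delta> k) x * cnj (eval (\<delta> k) x))) * (K n x - K1 n x * (eval f x * cnj (eval f x)))" for k
      unfolding G Fq sd[symmetric] by (simp add: algebra_simps)
    finally have "(\<Sum>k\<in>UNIV. \<Sum>j\<in>UNIV. ?I n j k x) = K n x * T' x * of_real (Q x)
       + h x * (K n x - K1 n x * (eval f x * cnj (eval f x)))"
      unfolding Qx h_def by (simp only: sum.distrib sum_distrib_left[symmetric] sum_distrib_right[symmetric])
    moreover have "K n x - K1 n x * (eval f x * cnj (eval f x)) = of_real (inverse (real (Suc n))) * K1 n x"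
      by (simp only: K_eq of_real_add complex_norm_square) (simp add: algebra_simps)
    ultimately show ?thesis by (simp add: algebra_simps)
  qed
  have hc: "continuous_on UNIV h" unfolding h_def by (intro continuous_intros T_cont)
  have Qc: "continuous_on UNIV (\<lambda>x. of_real (Q x) * T' x)" unfolding Q_def by (intro continuous_intros T_cont) auto
  have T0: "of_real (Q x) * T' x = 0" "h x = 0" if "\<not> (1 \<le> norm x \<and> norm x \<le> 4)" for x
    using T_supp[OF that] by (simp_all add: h_def)
  have 0: "integral\<^sup>L lborel (\<lambda>x. K n x * (of_real (Q x) * T' x)) +
      integral\<^sup>L lborel (\<lambda>x. of_real (inverse (real (Suc n))) * K1 n x * h x) = 0" for n
  proof -
    have "integral\<^sup>L lborel (\<lambda>x. \<Sum>k\<in>UNIV. \<Sum>j\<in>UNIV. ?I n j k x) = 0"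
      by (subst Bochner_Integration.integral_sum, intro Bochner_Integration.integrable_sum integration_by_parts_K,
          subst Bochner_Integration.integral_sum, rule integration_by_parts_K) (simp only: integration_by_parts_K sum.neutral_const)
    then show ?thesis
      unfolding pt using lim_K(2)[OF Qc T0(1)] lim_K(4)[OF hc T0(2)] by (subst (asm) Bochner_Integration.integral_add) auto
  qed
  have "(\<lambda>n. integral\<^sup>L lborel (\<lambda>x. K n x * (of_real (Q x) * T' x)) +
      integral\<^sup>L lborel (\<lambda>x. of_real (inverse (real (Suc n))) * K1 n x * h x)) \<longlonglongrightarrow>
      integral\<^sup>L lborel (\<lambda>x. F x * (of_real (Q x) * T' x)) + 0"
    by (intro tendsto_add lim_K(3)[OF Qc T0(1)] lim_K(5)[OF hc T0(2)])
  then show ?thesis unfolding 0 by (simp add: LIMSEQ_const_iff)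
qed

lemma syzygy_eq_0: "\<delta> i = 0"
proof -
  have Q_nonneg: "Q x \<ge> 0" for x by (simp add: Q_def sum_nonneg)
  have q2: "eval (q j k) (2 *\<^sub>R x) = 2 * 2 ^ m * eval (q j k) x" for j k x
    by (simp add: q_def delta_scale scaleR_conv_of_real[where 'a = complex] algebra_simps)
  have Q2: "Q (2 *\<^sub>R x) = (2 * 2 ^ m)\<^sup>2 * Q x" for x
    unfolding Q_def q2 norm_mult by (simp add: norm_power power_mult_distrib sum_distrib_left)
  have hc: "continuous_on UNIV (\<lambda>x. complex_of_real (Q x))" unfolding Q_def by (intro continuous_intros) auto
  \<comment> \<open>The degree is now -(2m + 4) + (2m + 2) = -2, so the factor
    \<open>1 - 16 * \<kappa>\<close> is -3 and the integral against \<open>hat\<close> itself must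
    vanish.\<close>
  have "F (2 *\<^sub>R x) * of_real (Q (2 *\<^sub>R x)) = (1/4) * (F x * of_real (Q x))" for x
  proof -
    define a :: complex where "a = 2 ^ m"
    have "(2 :: complex) ^ (2 * m + 4) = 2 ^ m * 2 ^ m * 2 ^ 4" by (simp only: power_add[symmetric] mult_2)
    then have a: "a \<noteq> 0" "(2 :: complex) ^ (2 * m + 4) = a * a * 16" by (simp_all add: a_def)
    have q: "complex_of_real (Q (2 *\<^sub>R x)) = 4 * (a * a) * of_real (Q x)"
      by (simp add: Q2 a_def power2_eq_square)
    show ?thesis
      unfolding q F_scale a(2) using a(1) by (simp add: divide_simps)
  qed
  note sc = scaling_integral[of "\<lambda>x. F x * of_real (Q x)" "1/4", OF this refl hc]
  have "integral\<^sup>L lborel (\<lambda>x. F x * of_real (Q x) * of_real (hat ((norm x)\<^sup>2))) = 0"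
    using sc(1) second_identity by (simp add: mult.assoc)
  moreover have eq: "F x * of_real (Q x) * of_real (hat ((norm x)\<^sup>2)) = of_real (norm (F x) * Q x * hat ((norm x)\<^sup>2))" for x
    by (simp add: F_def)
  ultimately have z: "integral\<^sup>L lborel (\<lambda>x. norm (F x) * Q x * hat ((norm x)\<^sup>2)) = 0"
    by (simp only: integral_complex_of_real of_real_eq_0_iff)
  have "integrable lborel (\<lambda>x. norm (F x) * Q x * hat ((norm x)\<^sup>2))"
    using sc(2) unfolding eq by (simp only: complex_of_real_integrable_eq)
  from integral_nonneg_eq_0_iff_AE[OF this] z
  have "AE x in lborel. norm (F x) * Q x * hat ((norm x)\<^sup>2) = 0"
    by (simp add: hat_nonneg Q_nonneg)
  then have "AE x in lborel. x \<notin> {x. 1 < (norm x)\<^sup>2 \<and> (norm x)\<^sup>2 < 2 \<and> eval f x \<noteq> 0 \<and> Q x \<noteq> 0}"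
    using null
  proof eventually_elim
    case (elim x)
    then show ?case using hat_pos[of "(norm x)\<^sup>2"] by (auto simp: F_def)
  qed
  moreover have "open {x. 1 < (norm x)\<^sup>2 \<and> (norm x)\<^sup>2 < 2 \<and> eval f x \<noteq> 0 \<and> Q x \<noteq> 0}"
    unfolding Q_def by (intro open_Collect_conj open_Collect_less open_Collect_neq continuous_intros) auto
  ultimately have "{x. 1 < (norm x)\<^sup>2 \<and> (norm x)\<^sup>2 < 2 \<and> eval f x \<noteq> 0 \<and> Q x \<noteq> 0} = {}"
    using open_null_empty by blast
  then have Q0: "Q x = 0" if "1 < (norm x)\<^sup>2" "(norm x)\<^sup>2 < 2" "eval f x \<noteq> 0" for x
    using that by blast
  have "eval (\<delta> i) x = 0" if "1 < (norm x)\<^sup>2" "(norm x)\<^sup>2 < 2" "eval f x \<noteq> 0" for x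
  proof -
    have "eval (q j k) x = 0" for j k
      using Q0[OF that] by (simp add: Q_def sum_nonneg_eq_0_iff sum_nonneg)
    then have e: "x $ j * eval (\<delta> i) x = eval (\<delta> j) x * x $ i" for j
      by (simp add: q_def)
    \<comment> \<open>Since \<delta> is parallel to \<open>x\<close>, the indices of
      \<open>x\<close> and \<delta> may be exchanged. This turns Euler's relation for
      \<open>f\<close>, times \<open>\<delta> i\<close>, into a multiple of
      \<open>syz\<close>.\<close>
    have "of_nat d * eval f x * eval (\<delta> i) x = (\<Sum>j\<in>UNIV. (x $ j * eval (\<delta> i) x) * gradient f x $ j)"
      unfolding euler_gradient[OF hom_f, symmetric] sum_distrib_right by (intro sum.cong refl) simp
    also have "\<dots> = x $ i * (\<Sum>j\<in>UNIV. eval (\<delta> j) x * gradient f x $ j)"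
      unfolding e sum_distrib_left by (intro sum.cong refl) simp
    finally show ?thesis using syz d_pos that by simp
  qed
  then show ?thesis using vanishing_on_shell[OF hom] by blast
qed

end


section \<open>The logarithmic sheaf of a free curve\<close>

text \<open>A common divisor of all \<open>c * x i\<close> divides \<open>c\<close> times the gcd of
  the \<open>x i\<close>, which is a unit. This is applied to polynomials in three variables and, on
  a line, in one.\<close>

lemma dvd_mult_primitive:
  fixes a c :: "'a::semiring_gcd" and x :: "3 \<Rightarrow> 'a"
  assumes "\<And>i. a dvd c * x i" and "\<And>h. (\<And>i. h dvd x i) \<Longrightarrow> is_unit h"
  shows "a dvd c"
proof -
  have "a dvd gcd (c * x 1) (gcd (c * x 2) (c * x 3))" using assms(1) by simp
  also have "\<dots> = normalize (c * gcd (x 1) (gcd (x 2) (x 3)))"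
    by (simp add: gcd_mult_left)
  finally have 1: "a dvd c * gcd (x 1) (gcd (x 2) (x 3))" by simp
  have "gcd (x 1) (gcd (x 2) (x 3)) dvd x i" for i
    using exhaust_3[of i] by (auto intro: dvd_trans gcd_dvd1 gcd_dvd2)
  then have "is_unit (gcd (x 1) (gcd (x 2) (x 3)))" by (rule assms(2))
  then show ?thesis using 1 by (simp add: dvd_mult_unit_iff)
qed

text \<open>The substitution multiplying all three variables by \<open>c\<close>, as an operation on
  nested polynomials. It respects products and has homogeneous polynomials as eigenvectors, so that
  homogeneity of a divisor can be derived from divisibility.\<close>

definition dilate :: "complex \<Rightarrow> poly3 \<Rightarrow> poly3" where
  "dilate c f = map_poly (\<lambda>g. map_poly (\<lambda>h. h \<circ>\<^sub>p [:0, c:]) (g \<circ>\<^sub>p [:0, [:c:]:])) (f \<circ>\<^sub>p [:0, [:[:c:]:]:])"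

lemma coeff_dilate:
  "coeff (coeff (coeff (dilate c f) k) j) i = c ^ (i + j + k) * coeff (coeff (coeff f k) j) i"
  by (simp add: dilate_def coeff_map_poly coeff_pcompose_linear const_poly_power power_add)

lemma coeff_const_mult: "coeff (coeff (coeff ([:[:[:c:]:]:] * f) k) j) i = c * coeff (coeff (coeff f k) j) i"
  by simp

lemma poly3_eqI: "(\<And>i j k. coeff (coeff (coeff f k) j) i = coeff (coeff (coeff g k) j) i) \<Longrightarrow> f = g"
  for f g :: poly3
  by (intro poly_eqI) auto

lemma dilate_mult: "dilate c (f * g) = dilate c f * dilate c g"
proof (rule poly3_eqI)
  fix i j k
  have "c ^ (i + j + k) * (\<Sum>k'\<le>k. \<Sum>j'\<le>j. \<Sum>i'\<le>i. coeff (coeff (coeff f k') j') i' * coeff (coeff (coeff g (k - k')) (j - j')) (i - i'))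
    = (\<Sum>k'\<le>k. \<Sum>j'\<le>j. \<Sum>i'\<le>i. c ^ (i' + j' + k') * coeff (coeff (coeff f k') j') i' * (c ^ ((i - i') + (j - j') + (k - k')) * coeff (coeff (coeff g (k - k')) (j - j')) (i - i')))"
    unfolding sum_distrib_left
  proof (intro sum.cong refl)
    fix k' j' i' assume "k' \<in> {..k}" "j' \<in> {..j}" "i' \<in> {..i}"
    then have "i + j + k = (i' + j' + k') + ((i - i') + (j - j') + (k - k'))" by auto
    then have "c ^ (i + j + k) = c ^ (i' + j' + k') * c ^ ((i - i') + (j - j') + (k - k'))"
      by (simp only: power_add)
    then show "c ^ (i + j + k) * (coeff (coeff (coeff f k') j') i' * coeff (coeff (coeff g (k - k')) (j - j')) (i - i')) =
       c ^ (i' + j' + k') * coeff (coeff (coeff f k') j') i' * (c ^ ((i - i') + (j - j') + (k - k')) * coeff (coeff (coeff g (k - k')) (j - j')) (i - i'))"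
      by (simp only: mult_ac)
  qed
  then show "coeff (coeff (coeff (dilate c (f * g)) k) j) i = coeff (coeff (coeff (dilate c f * dilate c g) k) j) i"
    unfolding coeff_dilate by (simp add: coeff_mult coeff_sum coeff_dilate)
qed

lemma dilate_dilate: "dilate a (dilate b f) = dilate (a * b) f"
  by (rule poly3_eqI) (simp add: coeff_dilate power_mult_distrib mult_ac)

lemma dilate_1: "dilate 1 f = f"
  by (rule poly3_eqI) (simp add: coeff_dilate)

lemma dilate_homogeneous: "homogeneous n f \<Longrightarrow> dilate c f = [:[:[:c ^ n:]:]:] * f"
  by (rule poly3_eqI) (auto simp: coeff_dilate coeff_const_mult homogeneous_def simp del: mult_pCons_left)

lemma dilate_dvd: "f dvd g \<Longrightarrow> dilate c f dvd dilate c g"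
  by (auto simp: dvd_def dilate_mult)

lemma two_power_inj: "(2::complex) ^ a = 2 ^ b \<Longrightarrow> a = b"
proof -
  assume "(2::complex) ^ a = 2 ^ b"
  then have "norm ((2::complex) ^ a) = norm ((2::complex) ^ b)" by simp
  then have "(2::real) ^ a = 2 ^ b" by (simp add: norm_power)
  then show "a = b" by simp
qed

text \<open>A monomial of degree \<open>n\<close> is multiplied by \<open>2 ^ n\<close>, and
  different degrees give different factors.\<close>

lemma homogeneous_if_dilate:
  assumes "dilate 2 f = [:[:[:u:]:]:] * f" "f \<noteq> 0"
  shows "\<exists>n. homogeneous n f \<and> u = 2 ^ n"
proof -
  have 1: "2 ^ (i + j + k) = u" if "coeff (coeff (coeff f k) j) i \<noteq> 0" for i j k
    using arg_cong[OF assms(1), of "\<lambda>f. coeff (coeff (coeff f k) j) i"] that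
    unfolding coeff_dilate coeff_const_mult by simp
  obtain i j k where 2: "coeff (coeff (coeff f k) j) i \<noteq> 0"
    using assms(2) poly3_eqI[of f 0] by auto
  then have "homogeneous (i + j + k) f"
    unfolding homogeneous_def using 1 two_power_inj by metis
  then show ?thesis using 1[OF 2] by blast
qed

lemma is_unit_poly3: "is_unit (u :: poly3) \<Longrightarrow> \<exists>c. c \<noteq> 0 \<and> u = [:[:[:c:]:]:]"
  by (auto simp: is_unit_poly_iff)

definition primitive3 :: "(3 \<Rightarrow> poly3) \<Rightarrow> bool" where
  "primitive3 \<delta> \<longleftrightarrow> (\<forall>h. (\<forall>i. h dvd \<delta> i) \<longrightarrow> is_unit h)"

lemma primitive3_nonzero: "primitive3 \<delta> \<Longrightarrow> \<exists>i. \<delta> i \<noteq> 0"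
  unfolding primitive3_def by (metis dvd_0_right not_is_unit_0)

text \<open>Divide by the gcd \<gamma> of the entries. The point is that \<gamma> and the quotients
  are again homogeneous: a dilation maps \<gamma> to a common divisor of the entries, hence to an
  associate of \<gamma>, so \<gamma> is an eigenvector of \<open>dilate 2\<close>, and then so are
  the quotients.\<close>

lemma primitive_part:
  assumes hom: "\<And>i. homogeneous n (G i)" and nz: "G l \<noteq> 0"
  shows "\<exists>\<gamma> \<delta> e. (\<forall>i. G i = \<gamma> * \<delta> i) \<and> \<gamma> \<noteq> 0 \<and> (\<forall>i. homogeneous e (\<delta> i)) \<and> primitive3 \<delta>"
proof -
  define \<gamma> where "\<gamma> = gcd (G 1) (gcd (G 2) (G 3))"
  have dvd: "\<gamma> dvd G i" for i
    using exhaust_3[of i] unfolding \<gamma>_def by (auto intro: dvd_trans gcd_dvd1 gcd_dvd2)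
  have great: "h dvd \<gamma>" if "\<And>i. h dvd G i" for h using that unfolding \<gamma>_def by simp
  have \<gamma>0: "\<gamma> \<noteq> 0" using dvd[of l] nz by auto
  obtain \<delta> where \<delta>: "\<And>i. G i = \<gamma> * \<delta> i" using dvd unfolding dvd_def by metis
  have prim: "primitive3 \<delta>"
    unfolding primitive3_def
  proof (intro allI impI)
    fix h assume "\<forall>i. h dvd \<delta> i"
    then have "\<gamma> * h dvd \<gamma> * 1" using great[of "\<gamma> * h"] \<delta> by (simp add: mult_dvd_mono)
    then show "is_unit h" using \<gamma>0 by (simp only: dvd_mult_cancel_left) simp
  qed
  have unit: "is_unit ([:[:[:c:]:]:] :: poly3)" if "c \<noteq> 0" for c :: complex
    using that by (intro dvdI[of _ _ "[:[:[:inverse c:]:]:]"]) (simp add: one_pCons)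
  \<comment> \<open>The dilate of \<gamma> divides the dilate of every \<open>G i\<close>, which by
    homogeneity is a unit times \<open>G i\<close>.\<close>
  have sub: "dilate c \<gamma> dvd \<gamma>" if "c \<noteq> 0" for c
  proof (rule great)
    fix i
    have "dilate c \<gamma> dvd [:[:[:c ^ n:]:]:] * G i"
      using dilate_dvd[OF dvd, of c] dilate_homogeneous[OF hom] by metis
    moreover have "is_unit ([:[:[:c ^ n:]:]:] :: poly3)" using that by (intro unit) simp
    ultimately show "dilate c \<gamma> dvd G i" by (metis dvd_mult_unit_iff')
  qed
  \<comment> \<open>Applying \<open>sub\<close> to the inverse dilation gives the opposite
    divisibility.\<close>
  have "dilate 2 (dilate (1/2) \<gamma>) dvd dilate 2 \<gamma>" by (rule dilate_dvd, rule sub) simp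
  then have "\<gamma> dvd dilate 2 \<gamma>" by (simp add: dilate_dilate dilate_1)
  then obtain a where a: "dilate 2 \<gamma> = \<gamma> * a" by (auto simp: dvd_def)
  moreover obtain b where "\<gamma> = dilate 2 \<gamma> * b" using sub[of 2] by (auto simp: dvd_def)
  ultimately have "\<gamma> * (a * b) = \<gamma> * 1" by (simp add: mult.assoc)
  then have "a * b = 1" using \<gamma>0 by (simp only: mult_cancel_left) simp
  then have "is_unit a" by (metis dvd_triv_left)
  then obtain u where u: "u \<noteq> 0" "a = [:[:[:u:]:]:]" using is_unit_poly3 by blast
  have du: "dilate 2 \<gamma> = [:[:[:u:]:]:] * \<gamma>" using a u by (simp only: mult.commute)
  obtain k where k: "u = 2 ^ k" using homogeneous_if_dilate[OF du \<gamma>0] by blast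
  have e: "\<exists>e. homogeneous e (\<delta> i) \<and> n = k + e" if "\<delta> i \<noteq> 0" for i
  proof -
    have "dilate 2 (\<gamma> * \<delta> i) = [:[:[:2 ^ n:]:]:] * (\<gamma> * \<delta> i)"
      using dilate_homogeneous[OF hom[of i]] \<delta> by metis
    then have "[:[:[:u:]:]:] * \<gamma> * dilate 2 (\<delta> i) = [:[:[:2 ^ n:]:]:] * (\<gamma> * \<delta> i)"
      by (simp only: dilate_mult du)
    also have "\<dots> = [:[:[:u:]:]:] * \<gamma> * ([:[:[:2 ^ n / u:]:]:] * \<delta> i)"
      using u(1) by (simp add: mult_ac)
    finally have "dilate 2 (\<delta> i) = [:[:[:2 ^ n / u:]:]:] * \<delta> i"
      using u(1) \<gamma>0 by (simp only: mult_cancel_left) simp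
    from homogeneous_if_dilate[OF this that] obtain e where e: "homogeneous e (\<delta> i)" "2 ^ n / u = 2 ^ e" by blast
    then have "(2::complex) ^ n = 2 ^ (k + e)" using k u(1) by (simp add: power_add field_simps)
    then show ?thesis using e two_power_inj by blast
  qed
  \<comment> \<open>Zero entries are homogeneous of every degree; for the others
    \<open>n = k + e\<close>, so nothing is truncated.\<close>
  have "homogeneous (n - k) (\<delta> i)" for i
    using e[of i] by (cases "\<delta> i = 0") auto
  then show ?thesis using \<delta> \<gamma>0 prim by blast
qed

text \<open>Parallelism shows that \<open>\<delta> j\<close> divides \<open>G j * \<delta> i\<close>
  for every \<open>i\<close>, hence divides \<open>G j\<close> by primitivity; the quotient is the
  required multiplier for all entries.\<close>

lemma parallel_primitive:
  assumes prim: "primitive3 \<delta>" and par: "\<And>i j. G i * \<delta> j = G j * \<delta> i"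
  shows "\<exists>\<gamma>. \<forall>i. G i = \<gamma> * \<delta> i"
proof -
  obtain j where j: "\<delta> j \<noteq> 0" using primitive3_nonzero[OF prim] by blast
  have "\<delta> j dvd G j"
  proof (rule dvd_mult_primitive)
    show "\<delta> j dvd G j * \<delta> i" for i using par[of i j] by (metis dvd_triv_right)
    show "is_unit h" if "\<And>i. h dvd \<delta> i" for h using that prim by (simp add: primitive3_def)
  qed
  then obtain \<gamma> where \<gamma>: "G j = \<delta> j * \<gamma>" by (auto simp: dvd_def)
  have "G i * \<delta> j = (\<gamma> * \<delta> i) * \<delta> j" for i using par[of i j] \<gamma> by (simp add: mult_ac)
  then show ?thesis using j by auto
qed

section \<open>Sections on basic open sets\<close>

definition basic_open :: "poly3 \<Rightarrow> (complex^3) set" where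
  "basic_open g = {p. p \<noteq> 0 \<and> eval g p \<noteq> 0}"

lemma zariski_open_basic: "homogeneous n g \<Longrightarrow> zariski_open (basic_open g)"
  unfolding zariski_open_def basic_open_def by (rule exI[of _ "{g}"]) auto

lemma zariski_open_basicE:
  assumes "zariski_open U" "p \<in> U"
  obtains g n where "homogeneous n g" "p \<in> basic_open g" "basic_open g \<subseteq> U"
  using assms unfolding zariski_open_def basic_open_def by blast

lemma basic_open_mult: "basic_open (g * h) = basic_open g \<inter> basic_open h"
  by (auto simp: basic_open_def)

lemma basic_open_nonzero: "p \<in> basic_open g \<Longrightarrow> g \<noteq> 0"
  by (auto simp: basic_open_def)

lemma poly3_zero_on_basic_open:
  assumes "\<And>p. p \<in> basic_open w \<Longrightarrow> eval g p = 0" "w \<noteq> 0"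
  shows "g = 0"
proof -
  \<comment> \<open>The factor \<open>w\<close> takes care of its own zeros, and
    \<open>var 1\<close> of the origin, which no basic open set contains.\<close>
  have "eval (g * w * var 1) p = 0" for p
    using assms(1)[of p] by (cases "p \<in> basic_open w") (auto simp: basic_open_def)
  then have "g * w * var 1 = 0" by (rule eval_eq_0_imp)
  moreover have "var 1 \<noteq> 0" by (simp add: var_def)
  ultimately show ?thesis using assms(2) by simp
qed

lemma twist_sections_local:
  assumes "s \<in> twist_sections 1 U" "p \<in> U"
  obtains w G H n N where "homogeneous N w" "p \<in> basic_open w" "basic_open w \<subseteq> U" "homogeneous n H" "homogeneous (Suc n) G"
    "\<And>q. q \<in> basic_open w \<Longrightarrow> eval H q \<noteq> 0 \<and> s q = eval G q / eval H q"
proof -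
  obtain V g h m n where V: "zariski_open V" "p \<in> V" "V \<subseteq> U" "homogeneous m g" "homogeneous n h" "int m = int n + 1"
     "\<forall>q\<in>V. eval h q \<noteq> 0 \<and> s q = eval g q / eval h q"
    using assms unfolding twist_sections_def by blast
  obtain w N where w: "homogeneous N w" "p \<in> basic_open w" "basic_open w \<subseteq> V"
    using zariski_open_basicE[OF V(1,2)] by blast
  have "m = Suc n" using V(6) by linarith
  then show ?thesis using that[of N w n h g] V w by blast
qed

text \<open>The three components come with their own neighbourhoods and denominators. Intersecting
  the former and multiplying the latter gives one vector of numerators, all of the same degree, over
  one denominator.\<close>

lemma log_vector_fields_local:
  assumes "\<sigma> \<in> log_vector_fields f U" "p \<in> U"
  obtains w G H n N where "homogeneous N w" "p \<in> basic_open w" "basic_open w \<subseteq> U" "\<And>i. homogeneous n (G i)"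
    "\<And>q. q \<in> basic_open w \<Longrightarrow> eval H q \<noteq> 0"
    "\<And>q i. q \<in> basic_open w \<Longrightarrow> \<sigma> q $ i = eval (G i) q / eval H q"
proof -
  have "\<exists>w G H n N. homogeneous N w \<and> p \<in> basic_open w \<and> basic_open w \<subseteq> U \<and> homogeneous n H \<and> homogeneous (Suc n) G \<and>
    (\<forall>q\<in>basic_open w. eval H q \<noteq> 0 \<and> \<sigma> q $ i = eval G q / eval H q)" for i
  proof -
    have "(\<lambda>p. \<sigma> p $ i) \<in> twist_sections 1 U" using assms(1) by (simp add: log_vector_fields_def)
    from twist_sections_local[OF this assms(2)] show ?thesis by metis
  qed
  then obtain w G H n N where *: "\<And>i. homogeneous (N i) (w i)" "\<And>i. p \<in> basic_open (w i)" "\<And>i. basic_open (w i) \<subseteq> U"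
    "\<And>i. homogeneous (n i) (H i)" "\<And>i. homogeneous (Suc (n i)) (G i)"
    "\<And>i q. q \<in> basic_open (w i) \<Longrightarrow> eval (H i) q \<noteq> 0"
    "\<And>i q. q \<in> basic_open (w i) \<Longrightarrow> \<sigma> q $ i = eval (G i) q / eval (H i) q"
    by metis
  define G' where "G' i = (if i = 1 then G 1 * H 2 * H 3 else if i = 2 then G 2 * H 3 * H 1 else G 3 * H 1 * H 2)" for i :: 3
  have i3: "i = 1 \<or> i = 2 \<or> i = 3" for i :: 3 by (rule exhaust_3)
  have h: "homogeneous (Suc (n 1) + n 2 + n 3) (G' i)" for i
  proof -
    have "homogeneous (Suc (n 1) + n 2 + n 3) (G 1 * H 2 * H 3)" by (intro homogeneous_mult *)
    moreover have "homogeneous (Suc (n 2) + n 3 + n 1) (G 2 * H 3 * H 1)" by (intro homogeneous_mult *)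
    moreover have "homogeneous (Suc (n 3) + n 1 + n 2) (G 3 * H 1 * H 2)" by (intro homogeneous_mult *)
    ultimately show ?thesis by (simp add: G'_def add_ac)
  qed
  have eqs: "\<sigma> q $ i = eval (G' i) q / eval (H 1 * H 2 * H 3) q" "eval (H 1 * H 2 * H 3) q \<noteq> 0"
    if "q \<in> basic_open (w 1 * w 2 * w 3)" for q i
  proof -
    have q: "q \<in> basic_open (w i)" for i using that i3[of i] by (auto simp: basic_open_mult)
    show "eval (H 1 * H 2 * H 3) q \<noteq> 0" using *(6)[OF q] by simp
    show "\<sigma> q $ i = eval (G' i) q / eval (H 1 * H 2 * H 3) q"
      using i3[of i] *(6)[OF q] *(7)[OF q] by (auto simp: G'_def)
  qed
  show ?thesis
    by (rule that[of "N 1 + N 2 + N 3" "w 1 * w 2 * w 3" _ G' "H 1 * H 2 * H 3"])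
       (use * h eqs in \<open>auto simp: basic_open_mult intro!: homogeneous_mult\<close>)
qed

lemma twist_sections_0: "(\<lambda>_. 0) \<in> twist_sections 0 U" if "zariski_open U"
  unfolding twist_sections_def
  by (intro CollectI conjI ballI, simp, rule exI[of _ U], rule exI[of _ 0], rule exI[of _ 1], rule exI[of _ 0], rule exI[of _ 0])
     (use that in \<open>auto intro: homogeneous_1\<close>)

lemma twist_sections_1: "restr U (\<lambda>_. 1) \<in> twist_sections 0 U" if "zariski_open U"
  unfolding twist_sections_def restr_def
  by (intro CollectI conjI ballI, simp, rule exI[of _ U], rule exI[of _ 1], rule exI[of _ 1], rule exI[of _ 0], rule exI[of _ 0])
     (use that in \<open>auto intro: homogeneous_1\<close>)

text \<open>The numerators of a generator near one point, made primitive, define \<delta>.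
  Generators near other points are proportional to it on a nonempty open overlap, hence parallel as
  polynomial vectors. By primitivity they are polynomial multiples of \<delta>, so the direction is
  that of \<delta> even where the first generator is undefined.\<close>

lemma line_subbundle_direction:
  assumes L: "line_bundle L" and sub: "\<And>U. zariski_open U \<Longrightarrow> L U \<subseteq> log_vector_fields f U"
  shows "\<exists>\<delta> e. (\<forall>i. homogeneous e (\<delta> i)) \<and> (\<forall>p. (\<Sum>i\<in>UNIV. eval (\<delta> i) p * gradient f p $ i) = 0) \<and>
     (\<exists>i. \<delta> i \<noteq> 0) \<and>
     (\<forall>U \<sigma> p. zariski_open U \<longrightarrow> \<sigma> \<in> L U \<longrightarrow> p \<in> U \<longrightarrow> (\<exists>c. \<forall>i. \<sigma> p $ i = c * eval (\<delta> i) p))"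
proof -
  have gen: "\<exists>U e. zariski_open U \<and> p \<in> U \<and> e \<in> L U \<and> (\<forall>V. zariski_open V \<longrightarrow> V \<subseteq> U \<longrightarrow>
        bij_betw (\<lambda>a q. a q *s e q) (twist_sections 0 V) (L V))" if "p \<noteq> 0" for p
    using L that unfolding line_bundle_def by blast
  have res: "restr V \<sigma> \<in> L V" if "zariski_open U" "zariski_open V" "V \<subseteq> U" "\<sigma> \<in> L U" for U V \<sigma>
    using L that unfolding line_bundle_def module_sheaf_def by blast
  define p0 :: "complex^3" where "p0 = axis 1 1"
  have "p0 \<noteq> 0" by (simp add: p0_def axis_eq_0_iff)
  from gen[OF this] obtain U0 e0 where U0: "zariski_open U0" "p0 \<in> U0" "e0 \<in> L U0"
     "\<And>V. zariski_open V \<Longrightarrow> V \<subseteq> U0 \<Longrightarrow> bij_betw (\<lambda>a q. a q *s e0 q) (twist_sections 0 V) (L V)" by blast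
  have "e0 \<in> log_vector_fields f U0" using sub U0 by blast
  from log_vector_fields_local[OF this U0(2)] obtain w0 G0 H0 n0 N0 where
    w0: "homogeneous N0 w0" "p0 \<in> basic_open w0" "basic_open w0 \<subseteq> U0" "\<And>i. homogeneous n0 (G0 i)"
    "\<And>q. q \<in> basic_open w0 \<Longrightarrow> eval H0 q \<noteq> 0"
    "\<And>q i. q \<in> basic_open w0 \<Longrightarrow> e0 q $ i = eval (G0 i) q / eval H0 q" by metis
  have zw0: "zariski_open (basic_open w0)" using w0(1) by (rule zariski_open_basic)
  \<comment> \<open>Multiplication by a generator is injective, so a vanishing generator would
    identify the sections 1 and 0.\<close>
  have "\<exists>l. G0 l \<noteq> 0"
  proof (rule ccontr)
    assume "\<not> (\<exists>l. G0 l \<noteq> 0)"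
    then have e0: "e0 q = 0" if "q \<in> basic_open w0" for q using w0(6)[OF that] by (simp add: vec_eq_iff)
    have inj: "inj_on (\<lambda>a q. a q *s e0 q) (twist_sections 0 (basic_open w0))"
      using U0(4)[OF zw0 w0(3)] by (simp add: bij_betw_def)
    have "(\<lambda>q. restr (basic_open w0) (\<lambda>_. 1) q *s e0 q) = (\<lambda>q. 0 *s e0 q)"
      by (rule ext) (auto simp: restr_def e0)
    from inj_onD[OF inj this twist_sections_1[OF zw0] twist_sections_0[OF zw0]]
    have "restr (basic_open w0) (\<lambda>_. 1) p0 = (0::complex)" by metis
    then show False using w0(2) by (simp add: restr_def)
  qed
  then obtain l where "G0 l \<noteq> 0" by blast
  from primitive_part[of n0 G0, OF w0(4) this] obtain \<gamma> \<delta> e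
    where \<delta>: "\<And>i. G0 i = \<gamma> * \<delta> i" "\<gamma> \<noteq> 0" "\<And>i. homogeneous e (\<delta> i)" "primitive3 \<delta>"
    by blast
  have orth: "(\<Sum>i\<in>UNIV. eval (\<delta> i) p * gradient f p $ i) = 0" for p
  proof -
    have "eval (\<gamma> * (\<Sum>i\<in>UNIV. \<delta> i * pd i f)) q = 0" if "q \<in> basic_open w0" for q
    proof -
      have "q \<in> U0" using that w0(3) by blast
      then have "(\<Sum>i\<in>UNIV. e0 q $ i * gradient f q $ i) = 0"
        using \<open>e0 \<in> log_vector_fields f U0\<close> by (simp add: log_vector_fields_def)
      then show ?thesis
        using w0(5)[OF that] by (simp add: w0(6)[OF that] \<delta>(1) gradient_nth sum_3 field_simps)
    qed
    then have "\<gamma> * (\<Sum>i\<in>UNIV. \<delta> i * pd i f) = 0"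
      by (rule poly3_zero_on_basic_open) (use basic_open_nonzero[OF w0(2)] in auto)
    then have "eval (\<Sum>i\<in>UNIV. \<delta> i * pd i f) p = 0" using \<delta>(2) by simp
    then show ?thesis by (simp add: gradient_nth)
  qed
  have "\<exists>c. \<forall>i. \<sigma> p $ i = c * eval (\<delta> i) p" if U: "zariski_open U" "\<sigma> \<in> L U" "p \<in> U" for U \<sigma> p
  proof -
    have "p \<noteq> 0" using U unfolding zariski_open_def by blast
    from gen[OF this] obtain U1 e1 where U1: "zariski_open U1" "p \<in> U1" "e1 \<in> L U1"
     "\<And>V. zariski_open V \<Longrightarrow> V \<subseteq> U1 \<Longrightarrow> bij_betw (\<lambda>a q. a q *s e1 q) (twist_sections 0 V) (L V)" by blast
    have "e1 \<in> log_vector_fields f U1" using sub U1 by blast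
    from log_vector_fields_local[OF this U1(2)] obtain w1 G1 H1 n1 N1 where
      w1: "homogeneous N1 w1" "p \<in> basic_open w1" "basic_open w1 \<subseteq> U1" "\<And>i. homogeneous n1 (G1 i)"
      "\<And>q. q \<in> basic_open w1 \<Longrightarrow> eval H1 q \<noteq> 0"
      "\<And>q i. q \<in> basic_open w1 \<Longrightarrow> e1 q $ i = eval (G1 i) q / eval H1 q" by metis
    obtain g n where g: "homogeneous n g" "p \<in> basic_open g" "basic_open g \<subseteq> U"
      using zariski_open_basicE[OF U(1,3)] by blast
    define V where "V = basic_open (g * w1)"
    have "V \<subseteq> U" "V \<subseteq> U1" "p \<in> V"
      unfolding V_def basic_open_mult using g(2,3) w1(2,3) by blast+
    note V = zariski_open_basic[OF homogeneous_mult[OF g(1) w1(1)], folded V_def] this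
    have "restr V \<sigma> \<in> L V" by (rule res[OF U(1) V(1,2) U(2)])
    then obtain a where "restr V \<sigma> = (\<lambda>q. a q *s e1 q)"
      using U1(4)[OF V(1,3)] unfolding bij_betw_def by blast
    from fun_cong[OF this, of p] have \<sigma>p: "\<sigma> p = a p *s e1 p" using V(4) by (simp add: restr_def)
    \<comment> \<open>On the overlap \<open>e1\<close> is a multiple of \<open>e0\<close>. As the
      product of two nonzero polynomials is nonzero, the overlap is large enough to test polynomial
      identities.\<close>
    define V' where "V' = basic_open (w0 * w1)"
    have "V' \<subseteq> U0" "V' \<subseteq> U1"
      unfolding V'_def basic_open_mult using w0(3) w1(3) by blast+
    note V' = zariski_open_basic[OF homogeneous_mult[OF w0(1) w1(1)], folded V'_def] this
    have "restr V' e1 \<in> L V'" by (rule res[OF U1(1) V'(1,3) U1(3)])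
    then obtain b where b: "restr V' e1 = (\<lambda>q. b q *s e0 q)"
      using U0(4)[OF V'(1,2)] unfolding bij_betw_def by blast
    have "G1 i * \<delta> j = G1 j * \<delta> i" for i j
    proof -
      have "eval (G1 i * \<delta> j - G1 j * \<delta> i) q = 0" if q: "q \<in> basic_open (w0 * w1)" for q
      proof -
        have q0: "q \<in> basic_open w0" and q1: "q \<in> basic_open w1" using q by (auto simp: basic_open_mult)
        have "e1 q = b q *s e0 q" using fun_cong[OF b, of q] q by (simp add: restr_def V'_def)
        then have "eval (G1 i) q = eval H1 q * (b q * (eval \<gamma> q * eval (\<delta> i) q / eval H0 q))" for i
          using w1(6)[OF q1, of i] w0(6)[OF q0, of i] w1(5)[OF q1] by (simp add: \<delta>(1) field_simps)
        then show ?thesis by simp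
      qed
      then have "G1 i * \<delta> j - G1 j * \<delta> i = 0"
        by (rule poly3_zero_on_basic_open[where w = "w0 * w1"])
           (use basic_open_nonzero[OF w0(2)] basic_open_nonzero[OF w1(2)] in auto)
      then show ?thesis by simp
    qed
    \<comment> \<open>This writes \<open>G1\<close> as a polynomial multiple of \<delta> with no
      denominator, so the relation may be evaluated at \<open>p\<close> itself, which need not lie
      in the overlap.\<close>
    from parallel_primitive[OF \<delta>(4) this] obtain \<gamma>1 where "\<And>i. G1 i = \<gamma>1 * \<delta> i" by blast
    then have "\<sigma> p $ i = (a p * eval \<gamma>1 p / eval H1 p) * eval (\<delta> i) p" for i
      using w1(6)[OF w1(2), of i] by (simp add: \<sigma>p)
    then show ?thesis by blast
  qed
  then show ?thesis using \<delta>(3) orth primitive3_nonzero[OF \<delta>(4)] by blast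
qed

text \<open>The Koszul relations between the partial derivatives have degree \<open>d - 1\<close>;
  the factor \<open>q $ l / (q $ l) ^ (d - 1)\<close> brings them to degree 1 on the chart. Keeping
  \<open>q $ l\<close> in the numerator avoids the exponent \<open>d - 2\<close>.\<close>

lemma koszul_log_vector_field:
  fixes l a b :: 3
  assumes f: "homogeneous d f" "d > 0" and ab: "a \<noteq> b"
  defines "U \<equiv> basic_open (var l)"
  defines "\<sigma> \<equiv> restr U (\<lambda>q. \<chi> i. (if i = a then gradient f q $ b else if i = b then - gradient f q $ a else 0) * q $ l / (q $ l) ^ (d - 1))"
  shows "\<sigma> \<in> log_vector_fields f U"
  unfolding log_vector_fields_def
proof (intro CollectI conjI allI ballI)
  fix i
  define g where "g = (if i = a then pd b f else if i = b then - pd a f else 0) * var l"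
  have g: "homogeneous d g"
  proof -
    have "homogeneous (d - 1 + 1) g"
      unfolding g_def by (intro homogeneous_mult homogeneous_var) (auto intro!: homogeneous_uminus homogeneous_pd f(1) simp del: One_nat_def)
    then show ?thesis using f(2) by simp
  qed
  have h: "homogeneous ((d - 1) * 1) (var l ^ (d - 1))" by (intro homogeneous_power homogeneous_var)
  have U: "zariski_open U" unfolding U_def by (rule zariski_open_basic[OF homogeneous_var])
  show "(\<lambda>p. \<sigma> p $ i) \<in> twist_sections 1 U"
    unfolding twist_sections_def
  proof (intro CollectI conjI allI impI ballI)
    show "\<sigma> p $ i = 0" if "p \<notin> U" for p using that by (simp add: \<sigma>_def restr_def)
    fix p assume "p \<in> U"
    moreover have "eval (var l ^ (d - 1)) q \<noteq> 0 \<and> \<sigma> q $ i = eval g q / eval (var l ^ (d - 1)) q" if "q \<in> U" for q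
      using that by (simp add: \<sigma>_def restr_def g_def gradient_nth U_def basic_open_def)
    moreover have "int d = int ((d - 1) * 1) + 1" using f(2) by simp
    ultimately show "\<exists>V g h m n. zariski_open V \<and> p \<in> V \<and> V \<subseteq> U \<and> homogeneous m g \<and> homogeneous n h \<and> int m = int n + 1 \<and>
        (\<forall>q\<in>V. eval h q \<noteq> 0 \<and> \<sigma> q $ i = eval g q / eval h q)"
      using U g h by blast
  qed
next
  fix p assume "p \<in> U"
  then show "(\<Sum>i\<in>UNIV. \<sigma> p $ i * gradient f p $ i) = 0"
    using ab exhaust_3[of a] exhaust_3[of b] by (auto simp: \<sigma>_def restr_def sum_3)
qed

lemma module_sheaf_zero: "module_sheaf L \<Longrightarrow> zariski_open U \<Longrightarrow> (\<lambda>_. 0) \<in> L U"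
  by (simp add: module_sheaf_def)

text \<open>At a point with nonzero gradient the Koszul fields span a space of dimension 2. Every
  section takes values in the span of the two directions, so these must be independent
  there.\<close>

lemma free_curve_directions:
  assumes f: "homogeneous d f" "d > 0" and free: "free_curve f"
  obtains \<delta>1 \<delta>2 e1 e2 where "\<And>i. homogeneous e1 (\<delta>1 i)" "\<And>i. homogeneous e2 (\<delta>2 i)"
    "\<And>p. (\<Sum>i\<in>UNIV. eval (\<delta>1 i) p * gradient f p $ i) = 0"
    "\<And>p. (\<Sum>i\<in>UNIV. eval (\<delta>2 i) p * gradient f p $ i) = 0"
    "\<exists>i. \<delta>1 i \<noteq> 0" "\<exists>i. \<delta>2 i \<noteq> 0"
    "\<And>p. p \<noteq> 0 \<Longrightarrow> gradient f p \<noteq> 0 \<Longrightarrow> \<exists>i j. eval (\<delta>1 i) p * eval (\<delta>2 j) p \<noteq> eval (\<delta>1 j) p * eval (\<delta>2 i) p"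
proof -
  obtain L M where LM: "line_bundle L" "line_bundle M"
     "\<And>U. zariski_open U \<Longrightarrow> bij_betw (\<lambda>(\<sigma>, \<tau>) p. \<sigma> p + \<tau> p) (L U \<times> M U) (log_vector_fields f U)"
    using free unfolding free_curve_def by blast
  have zero: "(\<lambda>_. 0) \<in> L U" "(\<lambda>_. 0) \<in> M U" if "zariski_open U" for U
    using LM(1,2) that module_sheaf_zero by (simp_all add: line_bundle_def)
  have subL: "L U \<subseteq> log_vector_fields f U" if U: "zariski_open U" for U
  proof
    fix \<sigma> assume "\<sigma> \<in> L U"
    then have "(\<lambda>(\<sigma>, \<tau>) p. \<sigma> p + \<tau> p) (\<sigma>, \<lambda>_. 0) \<in> log_vector_fields f U"
      by (intro bij_betwE[OF LM(3)[OF U], rule_format]) (simp add: zero[OF U])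
    then show "\<sigma> \<in> log_vector_fields f U" by simp
  qed
  have subM: "M U \<subseteq> log_vector_fields f U" if U: "zariski_open U" for U
  proof
    fix \<sigma> assume "\<sigma> \<in> M U"
    then have "(\<lambda>(\<sigma>, \<tau>) p. \<sigma> p + \<tau> p) (\<lambda>_. 0, \<sigma>) \<in> log_vector_fields f U"
      by (intro bij_betwE[OF LM(3)[OF U], rule_format]) (simp add: zero[OF U])
    then show "\<sigma> \<in> log_vector_fields f U" by simp
  qed
  obtain \<delta>1 e1 where d1: "\<forall>i. homogeneous e1 (\<delta>1 i)" "\<forall>p. (\<Sum>i\<in>UNIV. eval (\<delta>1 i) p * gradient f p $ i) = 0"
     "\<exists>i. \<delta>1 i \<noteq> 0" "\<And>U \<sigma> p. zariski_open U \<Longrightarrow> \<sigma> \<in> L U \<Longrightarrow> p \<in> U \<Longrightarrow> \<exists>c. \<forall>i. \<sigma> p $ i = c * eval (\<delta>1 i) p"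
    using line_subbundle_direction[OF LM(1) subL] by blast
  obtain \<delta>2 e2 where d2: "\<forall>i. homogeneous e2 (\<delta>2 i)" "\<forall>p. (\<Sum>i\<in>UNIV. eval (\<delta>2 i) p * gradient f p $ i) = 0"
     "\<exists>i. \<delta>2 i \<noteq> 0" "\<And>U \<sigma> p. zariski_open U \<Longrightarrow> \<sigma> \<in> M U \<Longrightarrow> p \<in> U \<Longrightarrow> \<exists>c. \<forall>i. \<sigma> p $ i = c * eval (\<delta>2 i) p"
    using line_subbundle_direction[OF LM(2) subM] by blast
  have span: "\<exists>x y. \<forall>i. \<sigma> p $ i = x * eval (\<delta>1 i) p + y * eval (\<delta>2 i) p"
    if U: "zariski_open U" "\<sigma> \<in> log_vector_fields f U" "p \<in> U" for U \<sigma> p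
  proof -
    have "\<sigma> \<in> (\<lambda>(\<sigma>, \<tau>) p. \<sigma> p + \<tau> p) ` (L U \<times> M U)"
      using LM(3)[OF U(1)] U(2) by (simp add: bij_betw_def)
    then obtain \<sigma>1 \<sigma>2 where s: "\<sigma>1 \<in> L U" "\<sigma>2 \<in> M U" "\<sigma> = (\<lambda>p. \<sigma>1 p + \<sigma>2 p)" by auto
    obtain x where "\<forall>i. \<sigma>1 p $ i = x * eval (\<delta>1 i) p" using d1(4)[OF U(1) s(1) U(3)] by blast
    moreover obtain y where "\<forall>i. \<sigma>2 p $ i = y * eval (\<delta>2 i) p" using d2(4)[OF U(1) s(2) U(3)] by blast
    ultimately show ?thesis unfolding s(3) by (intro exI[of _ x] exI[of _ y]) simp
  qed
  have indep: "\<exists>i j. eval (\<delta>1 i) p * eval (\<delta>2 j) p \<noteq> eval (\<delta>1 j) p * eval (\<delta>2 i) p"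
    if p: "p \<noteq> 0" "gradient f p \<noteq> 0" for p
  proof (rule ccontr)
    assume "\<not> ?thesis"
    then have dep: "eval (\<delta>1 i) p * eval (\<delta>2 j) p = eval (\<delta>1 j) p * eval (\<delta>2 i) p" for i j by blast
    obtain c where c: "gradient f p $ c \<noteq> 0" using p(2) by (auto simp: vec_eq_iff)
    obtain l where l: "p $ l \<noteq> 0" using p(1) by (auto simp: vec_eq_iff)
    have "\<exists>a b. a \<noteq> b \<and> a \<noteq> c \<and> b \<noteq> c"
      using exhaust_3[of c] by (elim disjE) (rule exI[of _ 2], rule exI[of _ 3], simp,
        rule exI[of _ 1], rule exI[of _ 3], simp, rule exI[of _ 1], rule exI[of _ 2], simp)
    then obtain a b where ab: "a \<noteq> b" "a \<noteq> c" "b \<noteq> c" by blast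
    define r where "r = p $ l / (p $ l) ^ (d - 1)"
    have r: "r \<noteq> 0" using l by (simp add: r_def)
    have pU: "p \<in> basic_open (var l)" using p l by (simp add: basic_open_def)
    have "\<exists>x y. \<forall>i. (if i = a then gradient f p $ c else if i = c then - gradient f p $ a else 0) * r = x * eval (\<delta>1 i) p + y * eval (\<delta>2 i) p"
      if "a \<noteq> c" for a
      using span[OF zariski_open_basic[OF homogeneous_var] koszul_log_vector_field[OF f that, of l] pU] pU
      by (simp add: restr_def r_def)
    note K = this
    obtain x y where xy: "\<And>i. (if i = a then gradient f p $ c else if i = c then - gradient f p $ a else 0) * r = x * eval (\<delta>1 i) p + y * eval (\<delta>2 i) p"
      using K[OF ab(2)] by blast
    obtain z w where zw: "\<And>i. (if i = b then gradient f p $ c else if i = c then - gradient f p $ b else 0) * r = z * eval (\<delta>1 i) p + w * eval (\<delta>2 i) p"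
      using K[OF ab(3)] by blast
    have 1: "gradient f p $ c * r = x * eval (\<delta>1 a) p + y * eval (\<delta>2 a) p" "0 = x * eval (\<delta>1 b) p + y * eval (\<delta>2 b) p"
      using xy[of a] xy[of b] ab by auto
    have 2: "gradient f p $ c * r = z * eval (\<delta>1 b) p + w * eval (\<delta>2 b) p" "0 = z * eval (\<delta>1 a) p + w * eval (\<delta>2 a) p"
      using zw[of a] zw[of b] ab by auto
    \<comment> \<open>The minor of the two Koszul values in rows \<open>a\<close> and
      \<open>b\<close> is a nonzero square. As both values are combinations of the two directions,
      it is also a multiple of their minor, which is 0 by assumption.\<close>
    have "(gradient f p $ c * r) * (gradient f p $ c * r) = (x * eval (\<delta>1 a) p + y * eval (\<delta>2 a) p) * (z * eval (\<delta>1 b) p + w * eval (\<delta>2 b) p)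
       - (x * eval (\<delta>1 b) p + y * eval (\<delta>2 b) p) * (z * eval (\<delta>1 a) p + w * eval (\<delta>2 a) p)"
      using 1 2 by simp
    also have "\<dots> = (x * w - y * z) * (eval (\<delta>1 a) p * eval (\<delta>2 b) p - eval (\<delta>1 b) p * eval (\<delta>2 a) p)"
      by (simp add: algebra_simps)
    also have "\<dots> = 0" using dep[of a b] by simp
    finally show False using c r by simp
  qed
  show thesis
    by (rule that[OF d1(1)[rule_format] d2(1)[rule_format] d1(2)[rule_format] d2(2)[rule_format] d1(3) d2(3) indep])
qed

text \<open>The coefficient of \<open>t ^ n\<close> is \<open>eval g p1\<close>. It is seen by
  looking at the line from infinity: with \<open>R\<close> parametrising from \<open>p1\<close>,
  homogeneity gives \<open>poly P t = t ^ n * poly R (inverse t)\<close>, so \<open>P\<close> is up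
  to a shift the reflection of \<open>R\<close>, and \<open>R\<close> does not vanish at 0.\<close>

lemma degree_homogeneous_line:
  assumes g: "homogeneous n g" and nz: "eval g p1 \<noteq> 0" and P: "\<And>t. poly P t = eval g (p0 + t *s p1)"
  shows "degree P = n"
proof -
  obtain R where R: "\<And>t. eval g (p1 + t *s p0) = poly R t" using eval_line by blast
  have R0: "poly R 0 \<noteq> 0" using R[of 0] nz by simp
  then have "coeff R 0 \<noteq> 0" "R \<noteq> 0" by (auto simp: poly_0_coeff_0)
  define S where "S = monom 1 (degree R) * P - monom 1 n * reflect_poly R"
  have "poly S t = 0" if "t \<noteq> 0" for t
  proof -
    have "p0 + t *s p1 = t *s (p1 + inverse t *s p0)" using that by (simp add: vec_eq_iff field_simps)
    then have "poly P t = t ^ n * poly R (inverse t)" using P R eval_scale[OF g] by metis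
    then show ?thesis using that by (simp add: S_def poly_monom poly_reflect_poly_nz)
  qed
  then have "- {0} \<subseteq> {t. poly S t = 0}" by auto
  then have "infinite {t. poly S t = 0}"
    using finite_subset infinite_UNIV_char_0[where 'a = complex] by (metis finite_compl finite.emptyI finite_insert)
  then have "S = 0" using poly_roots_finite by blast
  then have eq: "monom 1 (degree R) * P = monom 1 n * reflect_poly R" by (simp add: S_def)
  have "reflect_poly R \<noteq> 0" using \<open>R \<noteq> 0\<close> by simp
  moreover from this have "P \<noteq> 0" using eq by auto
  ultimately have "degree R + degree P = n + degree (reflect_poly R)"
    using arg_cong[OF eq, of degree] by (simp add: degree_mult_eq degree_monom_eq monom_eq_0_iff)
  then show ?thesis using \<open>coeff R 0 \<noteq> 0\<close> by simp
qed

text \<open>Over the complex numbers a vector of polynomials without common zero is primitive, by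
  the fundamental theorem of algebra. Hence \<open>P\<close> and \<open>F\<close> divide each
  other.\<close>

lemma degree_eq_if_proportional:
  fixes P F :: "complex poly" and N W :: "3 \<Rightarrow> complex poly"
  assumes eq: "\<And>i. P * N i = F * W i" and N: "\<And>t. \<exists>i. poly (N i) t \<noteq> 0" and W: "\<And>t. \<exists>i. poly (W i) t \<noteq> 0"
    and nz: "P \<noteq> 0" "F \<noteq> 0"
  shows "degree P = degree F"
proof -
  have unit: "is_unit h" if h: "\<And>i. h dvd N i" and N: "\<And>t. \<exists>i. poly (N i) t \<noteq> 0" for h :: "complex poly" and N :: "3 \<Rightarrow> complex poly"
  proof (rule ccontr)
    assume "\<not> is_unit h"
    moreover have "h \<noteq> 0" using h N[of 0] by force
    ultimately have "degree h \<noteq> 0" by (simp add: is_unit_iff_degree)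
    then have "\<not> constant (poly h)" by (simp add: constant_degree)
    from Fundamental_Theorem_Algebra.fundamental_theorem_of_algebra[OF this] obtain t where t: "poly h t = 0" ..
    have "poly (N i) t = 0" for i
    proof -
      obtain k where "N i = h * k" using h[of i] by (auto simp only: dvd_def)
      then show ?thesis using t by simp
    qed
    then show False using N by blast
  qed
  have "F dvd P"
    by (rule dvd_mult_primitive[where x = N]) (use eq unit[OF _ N] in auto)
  moreover have "P dvd F"
    by (rule dvd_mult_primitive[where x = W]) (use eq[symmetric] unit[OF _ W] in auto)
  ultimately show ?thesis using nz dvd_imp_degree_le by (metis antisym)
qed

text \<open>A form of Saito's criterion. Let \<open>W\<close> be the cross product of the two
  directions and \<Delta> its scalar product with \<open>x\<close>, that is, the determinant of the
  Euler field and the two directions. Then \<Delta> grad f = d f W. On a line avoiding the singular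
  points neither gradient nor \<open>W\<close> has zeros, so \<Delta> and \<open>f\<close> have the
  same degree there: \<open>1 + (e1 + e2) = d\<close>. The direction of smaller degree is the one
  wanted.\<close>

lemma free_curve_syzygy:
  assumes f: "homogeneous d f" "d > 0" "f \<noteq> 0" and free: "free_curve f"
    and fin: "finite S" "\<And>p. p \<in> singular_points f \<Longrightarrow> \<exists>v\<in>S. \<exists>c. p = c *s v" "S \<subseteq> singular_points f" "S \<noteq> {}"
  shows "\<exists>\<delta> m. 2 * m + 1 \<le> d \<and> (\<forall>i. homogeneous m (\<delta> i)) \<and>
    (\<forall>p. (\<Sum>i\<in>UNIV. eval (\<delta> i) p * gradient f p $ i) = 0) \<and> (\<exists>i. \<delta> i \<noteq> 0)"
proof (rule free_curve_directions[OF f(1,2) free])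
  fix a b e1 e2
  assume ab: "\<And>i. homogeneous e1 (a i)" "\<And>i. homogeneous e2 (b i)"
      "\<And>p. (\<Sum>i\<in>UNIV. eval (a i) p * gradient f p $ i) = 0" "\<And>p. (\<Sum>i\<in>UNIV. eval (b i) p * gradient f p $ i) = 0"
      "\<exists>i. a i \<noteq> 0" "\<exists>i. b i \<noteq> 0"
      "\<And>p. p \<noteq> 0 \<Longrightarrow> gradient f p \<noteq> 0 \<Longrightarrow> \<exists>i j. eval (a i) p * eval (b j) p \<noteq> eval (a j) p * eval (b i) p"
  define W where "W i = (if i = 1 then a 2 * b 3 - a 3 * b 2 else if i = 2 then a 3 * b 1 - a 1 * b 3 else a 1 * b 2 - a 2 * b 1)" for i :: 3
  define \<Delta> where "\<Delta> = (\<Sum>i\<in>UNIV. var i * W i)"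
  have W_hom: "homogeneous (e1 + e2) (W i)" for i
    unfolding W_def by (auto intro!: homogeneous_diff homogeneous_mult ab)
  have \<Delta>_hom: "homogeneous (1 + (e1 + e2)) \<Delta>"
    unfolding \<Delta>_def by (intro homogeneous_sum homogeneous_mult homogeneous_var W_hom)
  have W_nz: "\<exists>i. eval (W i) p \<noteq> 0" if p: "p \<noteq> 0" "gradient f p \<noteq> 0" for p
  proof (rule ccontr)
    assume "\<not> ?thesis"
    then have "eval (W 1) p = 0" "eval (W 2) p = 0" "eval (W 3) p = 0" by auto
    then have z: "eval (a 2) p * eval (b 3) p = eval (a 3) p * eval (b 2) p" "eval (a 3) p * eval (b 1) p = eval (a 1) p * eval (b 3) p"
      "eval (a 1) p * eval (b 2) p = eval (a 2) p * eval (b 1) p" by (simp_all add: W_def)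
    have "eval (a i) p * eval (b j) p = eval (a j) p * eval (b i) p" for i j
      using z exhaust_3[of i] exhaust_3[of j] by auto
    then show False using ab(7)[OF p] by blast
  qed
  \<comment> \<open>Both directions are orthogonal to the gradient, so the gradient is parallel to
    \<open>W\<close>; pairing with \<open>p\<close> fixes the factor, by Euler's relation.\<close>
  have key: "eval \<Delta> p * gradient f p $ i = of_nat d * eval f p * eval (W i) p" for p i
  proof -
    have s: "eval (a 1) p * gradient f p $ 1 + eval (a 2) p * gradient f p $ 2 + eval (a 3) p * gradient f p $ 3 = 0"
      "eval (b 1) p * gradient f p $ 1 + eval (b 2) p * gradient f p $ 2 + eval (b 3) p * gradient f p $ 3 = 0"
      using ab(3,4)[of p] by (simp_all add: sum_3)
    have e: "of_nat d * eval f p = p $ 1 * gradient f p $ 1 + p $ 2 * gradient f p $ 2 + p $ 3 * gradient f p $ 3"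
      using euler_gradient[OF f(1), of p] by (simp add: sum_3)
    have c: "gradient f p $ 1 * eval (W 2) p = gradient f p $ 2 * eval (W 1) p"
      "gradient f p $ 1 * eval (W 3) p = gradient f p $ 3 * eval (W 1) p"
      "gradient f p $ 2 * eval (W 3) p = gradient f p $ 3 * eval (W 2) p"
      using s unfolding W_def by (simp_all, algebra+)
    have alg: "(x * u + y * v + z * w) * k = (x * k + y * l + z * n) * u"
      if "k * v = l * u" "k * w = n * u" for x y z u v w k l n :: complex
      using that by algebra
    have D: "eval \<Delta> p = p $ 1 * eval (W 1) p + p $ 2 * eval (W 2) p + p $ 3 * eval (W 3) p"
      by (simp add: \<Delta>_def sum_3)
    consider "i = 1" | "i = 2" | "i = 3" using exhaust_3[of i] by blast
    then show ?thesis
    proof cases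
      case 1
      show ?thesis unfolding 1 D e using alg[OF c(1,2)] .
    next
      case 2
      show ?thesis unfolding 2 D e
        using alg[OF c(1)[symmetric] c(3), of "p $ 2" "p $ 1" "p $ 3"] by (simp only: add_ac)
    next
      case 3
      show ?thesis unfolding 3 D e
        using alg[OF c(2)[symmetric] c(3)[symmetric], of "p $ 3" "p $ 1" "p $ 2"] by (simp only: add_ac)
    qed
  qed
  obtain p1 where p1: "eval f p1 \<noteq> 0" using eval_eq_0_imp f(3) by blast
  \<comment> \<open>\<open>poly (cr v) t\<close> is the determinant of \<open>v\<close>,
    \<open>p1\<close> and the point \<open>vector [1, t, t\<^sup>2]\<close> of the moment curve. It
    is a nonzero polynomial in \<open>t\<close>, because a vanishing cross product would make
    \<open>p1\<close> a multiple of \<open>v\<close> and thus a zero of \<open>f\<close>. Hence some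
    \<open>t\<close> avoids the roots for all \<open>v\<close> in \<open>S\<close>.\<close>
  define cr where "cr v = [: v $ 2 * p1 $ 3 - v $ 3 * p1 $ 2, v $ 3 * p1 $ 1 - v $ 1 * p1 $ 3, v $ 1 * p1 $ 2 - v $ 2 * p1 $ 1 :]" for v :: "complex^3"
  have f0: "eval f 0 = 0" using eval_scale[OF f(1), of 0 0] f(2) by (simp add: power_0_left)
  have cr_nz: "cr v \<noteq> 0" if "v \<in> S" for v
  proof
    assume "cr v = 0"
    then have z: "v $ 2 * p1 $ 3 = v $ 3 * p1 $ 2" "v $ 3 * p1 $ 1 = v $ 1 * p1 $ 3" "v $ 1 * p1 $ 2 = v $ 2 * p1 $ 1"
      by (simp_all add: cr_def)
    have vs: "v \<noteq> 0" "eval f v = 0" using that fin(3) by (auto simp: singular_points_def)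
    obtain l where l: "v $ l \<noteq> 0" using vs by (auto simp: vec_eq_iff)
    have "v $ l * p1 $ i = v $ i * p1 $ l" for i using z exhaust_3[of i] exhaust_3[of l] by auto
    then have "p1 = (p1 $ l / v $ l) *s v" using l by (simp add: vec_eq_iff field_simps)
    then have "eval f p1 = (p1 $ l / v $ l) ^ d * eval f v" using eval_scale[OF f(1)] by metis
    then show False using vs p1 by simp
  qed
  have "finite (\<Union>v\<in>S. {t. poly (cr v) t = 0})" using fin(1) cr_nz poly_roots_finite by blast
  then obtain t where t: "\<And>v. v \<in> S \<Longrightarrow> poly (cr v) t \<noteq> 0"
    using ex_new_if_finite[OF infinite_UNIV_char_0[where 'a = complex]] by blast
  define p0 :: "complex^3" where "p0 = vector [1, t, t\<^sup>2]"
  have nonsing: "p0 + \<tau> *s p1 \<noteq> 0 \<and> gradient f (p0 + \<tau> *s p1) \<noteq> 0" for \<tau>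
  proof -
    have det: "c = 0" if "p0 + \<tau> *s p1 = c *s v" "v \<in> S" for c v
    proof -
      have 1: "1 + \<tau> * p1 $ 1 = c * v $ 1" "t + \<tau> * p1 $ 2 = c * v $ 2" "t\<^sup>2 + \<tau> * p1 $ 3 = c * v $ 3"
        using that(1) by (simp_all add: vec_eq_iff p0_def forall_3)
      have "c * poly (cr v) t = 0"
        using 1 by (simp add: cr_def) algebra
      then show ?thesis using t[OF that(2)] by simp
    qed
    show ?thesis
    proof (cases "p0 + \<tau> *s p1 = 0")
      case True
      then have "p0 = (- \<tau>) *s p1" by (simp add: vec_eq_iff add_eq_0_iff)
      then have "p0 $ i = - \<tau> * p1 $ i" for i by simp
      from this[of 1] this[of 2] this[of 3]
      have 1: "1 = - \<tau> * p1 $ 1" "t = - \<tau> * p1 $ 2" "t\<^sup>2 = - \<tau> * p1 $ 3"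
        unfolding p0_def by simp_all
      show ?thesis
      proof -
        \<comment> \<open>If \<open>p0\<close> were a multiple of \<open>p1\<close>, the determinant
          with any \<open>v\<close> would vanish; nonemptiness of \<open>S\<close> supplies one for
          the contradiction.\<close>
        obtain v where v: "v \<in> S" using fin(4) by blast
        have "poly (cr v) t = 0" using 1 by (simp add: cr_def) algebra
        then show ?thesis using t v by blast
      qed
    next
      case False
      moreover have "gradient f (p0 + \<tau> *s p1) \<noteq> 0"
      proof
        assume g: "gradient f (p0 + \<tau> *s p1) = 0"
        then have "eval f (p0 + \<tau> *s p1) = 0" using euler_gradient[OF f(1), of "p0 + \<tau> *s p1"] f(2) by simp
        then have "p0 + \<tau> *s p1 \<in> singular_points f" using False g by (simp add: singular_points_def)
        from fin(2)[OF this] det False show False by force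
      qed
      ultimately show ?thesis by simp
    qed
  qed
  obtain P where P: "\<And>\<tau>. eval \<Delta> (p0 + \<tau> *s p1) = poly P \<tau>" using eval_line by blast
  obtain F where F: "\<And>\<tau>. eval f (p0 + \<tau> *s p1) = poly F \<tau>" using eval_line by blast
  have "\<exists>N. \<forall>\<tau>. gradient f (p0 + \<tau> *s p1) $ i = poly N \<tau>" for i unfolding gradient_nth by (rule eval_line)
  then obtain N where N: "\<And>i \<tau>. gradient f (p0 + \<tau> *s p1) $ i = poly (N i) \<tau>" by metis
  have "\<exists>N. \<forall>\<tau>. eval (W i) (p0 + \<tau> *s p1) = poly N \<tau>" for i by (rule eval_line)
  then obtain V where V: "\<And>i \<tau>. eval (W i) (p0 + \<tau> *s p1) = poly (V i) \<tau>" by metis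
  have p1': "p1 \<noteq> 0" "gradient f p1 \<noteq> 0"
    using p1 f0 euler_gradient[OF f(1), of p1] f(2) by auto
  have \<Delta>1: "eval \<Delta> p1 \<noteq> 0"
  proof -
    obtain i where "eval (W i) p1 \<noteq> 0" using W_nz[OF p1'] by blast
    then show ?thesis using key[of p1 i] p1 f(2) by auto
  qed
  have degP: "degree P = 1 + (e1 + e2)" by (rule degree_homogeneous_line[OF \<Delta>_hom \<Delta>1 P[symmetric]])
  have degF: "degree F = d" by (rule degree_homogeneous_line[OF f(1) p1 F[symmetric]])
  have "degree P = degree (smult (of_nat d) F)"
  proof (rule degree_eq_if_proportional)
    show "P * N i = smult (of_nat d) F * V i" for i
      by (rule poly_ext) (simp add: P[symmetric] N[symmetric] F[symmetric] V[symmetric] key)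
    show "\<exists>i. poly (N i) \<tau> \<noteq> 0" for \<tau> using nonsing[of \<tau>] by (auto simp: N[symmetric] vec_eq_iff)
    show "\<exists>i. poly (V i) \<tau> \<noteq> 0" for \<tau> using nonsing[of \<tau>] W_nz by (auto simp: V[symmetric])
    show "P \<noteq> 0" using degP by auto
    show "smult (of_nat d) F \<noteq> 0" using degF f(2) by auto
  qed
  then have "1 + (e1 + e2) = d" using degP degF f(2) by simp
  then have "2 * e1 + 1 \<le> d \<or> 2 * e2 + 1 \<le> d" by linarith
  then show ?thesis using ab(1-6) by blast
qed


section \<open>Integrals of powers\<close>

text \<open>The bound for the measure of a differentiable image is available for \<open>real^'n\<close> only.\<close>

definition iso4 :: "real^4 \<Rightarrow> complex \<times> complex" where
  "iso4 x = (Complex (x $ 1) (x $ 2), Complex (x $ 3) (x $ 4))"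

definition iso4' :: "complex \<times> complex \<Rightarrow> real^4" where
  "iso4' z = (\<chi> i. if i = 1 then Re (fst z) else if i = 2 then Im (fst z) else if i = 3 then Re (snd z) else Im (snd z))"

lemma iso4_inverse [simp]: "iso4' (iso4 x) = x" "iso4 (iso4' z) = z"
  by (simp_all add: iso4_def iso4'_def vec_eq_iff forall_4)

lemma bounded_linear_iso4: "bounded_linear iso4"
  by (simp add: linear_conv_bounded_linear[symmetric])
     (auto intro!: linearI simp: iso4_def complex_eq_iff)

lemma bounded_linear_iso4': "bounded_linear iso4'"
  by (simp add: linear_conv_bounded_linear[symmetric])
     (auto intro!: linearI simp: iso4'_def vec_eq_iff forall_4)

lemma continuous_iso4: "continuous_on S iso4" "continuous_on S' iso4'"
  using linear_continuous_on bounded_linear_iso4 bounded_linear_iso4' by blast+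

lemma measurable_iso4 [measurable]: "iso4 \<in> borel_measurable borel" "iso4' \<in> borel_measurable borel"
  using continuous_iso4 by (auto intro: borel_measurable_continuous_onI)

text \<open>Both measures assign to a box the product of its four side lengths.\<close>

lemma lborel_iso4: "lborel = distr lborel borel iso4"
proof (rule lborel_eqI)
  fix l u :: "complex \<times> complex"
  assume lu: "\<And>b. b \<in> Basis \<Longrightarrow> l \<bullet> b \<le> u \<bullet> b"
  have "l \<bullet> (1, 0) \<le> u \<bullet> (1, 0)" "l \<bullet> (\<i>, 0) \<le> u \<bullet> (\<i>, 0)" "l \<bullet> (0, 1) \<le> u \<bullet> (0, 1)" "l \<bullet> (0, \<i>) \<le> u \<bullet> (0, \<i>)"
    by (intro lu; simp add: Basis_prod_def Basis_complex_def)+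
  then have le: "Re (fst l) \<le> Re (fst u)" "Im (fst l) \<le> Im (fst u)" "Re (snd l) \<le> Re (snd u)" "Im (snd l) \<le> Im (snd u)"
    by (simp_all add: inner_prod_def inner_complex_def)
  have Basis4: "(Basis :: (real^4) set) = range (\<lambda>i. axis i 1)" by (auto simp: Basis_vec_def)
  have Basis2: "(Basis :: (complex \<times> complex) set) = {(1, 0), (\<i>, 0), (0, 1), (0, \<i>)}"
    by (auto simp: Basis_prod_def Basis_complex_def)
  have pre: "iso4 -` box l u = box (iso4' l) (iso4' u)"
    by (auto simp: mem_box_cart iso4'_def forall_4) (auto simp: iso4_def box_def Basis2 inner_prod_def inner_complex_def)
  have prod4: "(\<Prod>b\<in>Basis. (x :: real^4) \<bullet> b) = x $ 1 * x $ 2 * x $ 3 * x $ 4" for x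
  proof -
    have "inj (\<lambda>i::4. axis i (1::real))" by (simp add: inj_on_def axis_eq_axis)
    then have "(\<Prod>b\<in>Basis. x \<bullet> b) = (\<Prod>i\<in>UNIV. x $ i)"
      unfolding Basis4 by (subst prod.reindex) (simp_all add: inner_axis)
    then show ?thesis unfolding UNIV_4 by (simp add: mult.assoc)
  qed
  have "emeasure (distr lborel borel iso4) (box l u) = emeasure lborel (box (iso4' l) (iso4' u))"
    by (subst emeasure_distr) (simp_all add: pre)
  also have "\<dots> = (\<Prod>b\<in>Basis. (iso4' u - iso4' l) \<bullet> b)"
    by (rule emeasure_lborel_box) (use le in \<open>auto simp: Basis4 inner_axis iso4'_def\<close>)
  also have "(\<Prod>b\<in>Basis. (iso4' u - iso4' l) \<bullet> b) = (\<Prod>b\<in>Basis. (u - l) \<bullet> b)"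
    unfolding prod4 Basis2 by (simp add: iso4'_def inner_prod_def inner_complex_def mult_ac)
  finally show "emeasure (distr lborel borel iso4) (box l u) = (\<Prod>b\<in>Basis. (u - l) \<bullet> b)" .
qed simp

lemma det_bound:
  fixes A :: "real^'n^'n"
  assumes "\<And>i j. \<bar>A $ i $ j\<bar> \<le> B"
  shows "\<bar>det A\<bar> \<le> fact CARD('n) * B ^ CARD('n)"
proof -
  have "\<bar>det A\<bar> \<le> (\<Sum>p\<in>{p. p permutes (UNIV :: 'n set)}. \<bar>of_int (sign p) * (\<Prod>i\<in>UNIV. A $ i $ p i)\<bar>)"
    unfolding det_def by (rule sum_abs)
  also have "\<dots> \<le> (\<Sum>p\<in>{p. p permutes (UNIV :: 'n set)}. B ^ CARD('n))"
  proof (rule sum_mono)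
    fix p :: "'n \<Rightarrow> 'n"
    have "\<bar>of_int (sign p) * (\<Prod>i\<in>UNIV. A $ i $ p i)\<bar> = (\<Prod>i\<in>UNIV. \<bar>A $ i $ p i\<bar>)"
      by (simp add: abs_mult sign_def abs_prod)
    also have "\<dots> \<le> (\<Prod>i\<in>(UNIV :: 'n set). B)" by (rule prod_mono) (simp add: assms)
    finally show "\<bar>of_int (sign p) * (\<Prod>i\<in>UNIV. A $ i $ p i)\<bar> \<le> B ^ CARD('n)" by simp
  qed
  also have "\<dots> = fact CARD('n) * B ^ CARD('n)"
    by (simp add: card_permutations[OF refl finite])
  finally show ?thesis .
qed

text \<open>A crude bound for the Jacobian determinant of a map whose derivative has norm at most
  \<open>B\<close>, read in real coordinates: the Leibniz formula has 4! products of four entries.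
  The maximum keeps it nonnegative.\<close>

definition jac_const :: "real \<Rightarrow> real" where
  "jac_const B = fact CARD(4) * (max B 0 * onorm iso4 * onorm iso4') ^ CARD(4)"

lemma emeasure_image_bounded_derivative:
  fixes \<phi> :: "complex \<times> complex \<Rightarrow> complex \<times> complex"
  assumes W: "W \<in> sets borel" "emeasure lborel W \<noteq> \<infinity>" and der: "\<And>x. x \<in> W \<Longrightarrow> (\<phi> has_derivative \<phi>' x) (at x)"
    and B: "\<And>x. x \<in> W \<Longrightarrow> onorm (\<phi>' x) \<le> B"
    and E: "E \<in> sets borel" "E \<subseteq> W" "\<phi> ` E \<in> sets borel"
  shows "emeasure lborel (\<phi> ` E) \<le> ennreal (jac_const B) * emeasure lborel E"
proof -
  define K where "K = onorm iso4"
  define K' where "K' = onorm iso4'"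
  have K: "K \<ge> 0" "\<And>x. norm (iso4 x) \<le> norm x * K"
    using onorm_pos_le[OF bounded_linear_iso4] onorm[OF bounded_linear_iso4] by (simp_all add: K_def mult.commute)
  have K': "K' \<ge> 0" "\<And>x. norm (iso4' x) \<le> norm x * K'"
    using onorm_pos_le[OF bounded_linear_iso4'] onorm[OF bounded_linear_iso4'] by (simp_all add: K'_def mult.commute)
  define B' where "B' = max B 0 * K * K'"
  define C where "C = jac_const B"
  have C_def': "C = fact CARD(4) * B' ^ CARD(4)" by (simp add: C_def jac_const_def B'_def K_def K'_def)
  define g where "g = iso4' \<circ> \<phi> \<circ> iso4"
  define g' where "g' x = iso4' \<circ> \<phi>' (iso4 x) \<circ> iso4" for x
  have dg: "(g has_derivative g' x) (at x)" if "iso4 x \<in> W" for x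
  proof -
    have 1: "(iso4 has_derivative iso4) (at x)" by (rule bounded_linear_imp_has_derivative[OF bounded_linear_iso4])
    have 2: "(iso4' has_derivative iso4') (at (\<phi> (iso4 x)))" by (rule bounded_linear_imp_has_derivative[OF bounded_linear_iso4'])
    show ?thesis
      using has_derivative_compose[OF has_derivative_compose[OF 1 der[OF that]] 2] by (simp add: g_def g'_def o_def)
  qed
  have entry: "\<bar>matrix (g' x) $ i $ j\<bar> \<le> B'" if "iso4 x \<in> W" for x i j
  proof -
    have bl: "bounded_linear (\<phi>' (iso4 x))" by (rule has_derivative_bounded_linear[OF der[OF that]])
    have "\<bar>matrix (g' x) $ i $ j\<bar> \<le> norm (g' x (axis j 1))"
      by (simp add: matrix_def component_le_norm_cart)
    also have "\<dots> \<le> norm (\<phi>' (iso4 x) (iso4 (axis j 1))) * K'" by (simp add: g'_def K')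
    also have "\<dots> \<le> (onorm (\<phi>' (iso4 x)) * norm (iso4 (axis j 1))) * K'"
      using K' by (intro mult_right_mono onorm bl) auto
    also have "\<dots> \<le> (max B 0 * (norm (axis j 1 :: real^4) * K)) * K'"
      using K'(1) K(1) K(2)[of "axis j 1"] B[OF that] by (intro mult_right_mono mult_mono) auto
    finally show ?thesis by (simp add: B'_def norm_axis_1)
  qed
  have C0: "C \<ge> 0" unfolding C_def' B'_def using K K' by (intro mult_nonneg_nonneg zero_le_power) auto
  have "emeasure lborel (\<phi> ` E) \<le> ennreal C * emeasure lborel E"
  proof -
    define E4 where "E4 = iso4 -` E"
    have E4: "E4 \<in> sets borel" using measurable_sets[OF measurable_iso4(1) E(1)] by (simp add: E4_def)
    have eq: "emeasure lborel X = emeasure lborel (iso4 -` X)" if "X \<in> sets borel" for X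
      using that by (subst lborel_iso4) (simp add: emeasure_distr)
    have img: "iso4 -` (\<phi> ` E) = g ` E4"
    proof (intro equalityI subsetI)
      fix x assume "x \<in> iso4 -` (\<phi> ` E)"
      then obtain e where e: "e \<in> E" "iso4 x = \<phi> e" by auto
      then have "x = g (iso4' e)" unfolding g_def o_def iso4_inverse by (metis iso4_inverse(1))
      moreover have "iso4' e \<in> E4" using e by (simp add: E4_def)
      ultimately show "x \<in> g ` E4" by blast
    next
      fix x assume "x \<in> g ` E4"
      then show "x \<in> iso4 -` (\<phi> ` E)" by (auto simp: g_def E4_def)
    qed
    have gE4: "g ` E4 \<in> sets borel" using measurable_sets[OF measurable_iso4(1) E(3)] by (simp add: img)
    show ?thesis
    proof -
      have "emeasure lborel E \<noteq> \<infinity>" using emeasure_mono[OF E(2), of lborel] W by (auto simp: top_unique)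
      then have fin: "E4 \<in> lmeasurable"
        using eq[OF E(1)] E4 by (auto simp: fmeasurable_def E4_def[symmetric] less_top[symmetric] )
      have dg': "(g has_derivative g' x) (at x within E4)" if "x \<in> E4" for x
        using dg[of x] that E(2) by (auto simp: E4_def intro: has_derivative_at_withinI)
      have db: "\<bar>det (matrix (g' x))\<bar> \<le> C" if "x \<in> E4" for x
        unfolding C_def' using entry[of x] that E(2) by (intro det_bound) (auto simp: E4_def)
      have int: "(\<lambda>x. \<bar>det (matrix (g' x))\<bar>) integrable_on E4"
      proof (rule measurable_bounded_by_integrable_imp_integrable)
        show "(\<lambda>x. \<bar>det (matrix (g' x))\<bar>) \<in> borel_measurable (lebesgue_on E4)"
          using borel_measurable_det_Jacobian[OF fmeasurableD[OF fin] dg'] by (intro borel_measurable_abs)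
        show "(\<lambda>x. C) integrable_on E4" using fin by (simp add: integrable_on_const)
        show "norm \<bar>det (matrix (g' x))\<bar> \<le> C" if "x \<in> E4" for x using db[OF that] by simp
        show "E4 \<in> sets lebesgue" by (rule fmeasurableD[OF fin])
      qed
      have m: "measure lebesgue (g ` E4) \<le> C * measure lebesgue E4" "g ` E4 \<in> lmeasurable"
        using measure_bounded_differentiable_image[OF fin dg' int db] measurable_bounded_differentiable_image[OF fin dg' int db] by auto
      have "emeasure lborel (\<phi> ` E) = emeasure lebesgue (g ` E4)" using eq[OF E(3)] gE4 by (simp add: img)
      also have "\<dots> = ennreal (measure lebesgue (g ` E4))" by (rule emeasure_eq_ennreal_measure[OF fmeasurableD2[OF m(2)]])
      also have "\<dots> \<le> ennreal (C * measure lebesgue E4)" by (intro ennreal_leI m)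
      also have "\<dots> = ennreal C * emeasure lebesgue E4" unfolding emeasure_eq_ennreal_measure[OF fmeasurableD2[OF fin]] by (rule ennreal_mult[OF C0 measure_nonneg])
      also have "emeasure lebesgue E4 = emeasure lborel E" using eq[OF E(1)] E4 by (simp add: E4_def)
      finally show ?thesis .
    qed
  qed
  then show ?thesis by (simp add: C_def)
qed

text \<open>The inequality half of the change of variables formula. Pulling Lebesgue measure on the
  image back along \<psi> gives a measure bounded on every Borel set by \<open>jac_const B\<close>
  times Lebesgue measure on \<open>W\<close>; comparison of measures passes to integrals.\<close>

lemma nn_integral_image_le:
  fixes \<phi> :: "complex \<times> complex \<Rightarrow> complex \<times> complex"
  assumes W: "open W" "bounded W"
    and der: "\<And>x. x \<in> W \<Longrightarrow> (\<phi> has_derivative \<phi>' x) (at x)"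
    and B: "\<And>x. x \<in> W \<Longrightarrow> onorm (\<phi>' x) \<le> B"
    and inv: "\<And>x. x \<in> W \<Longrightarrow> \<psi> (\<phi> x) = x" "open (\<phi> ` W)" "continuous_on (\<phi> ` W) \<psi>"
    and k [measurable]: "k \<in> borel_measurable borel"
  shows "(\<integral>\<^sup>+y. k y * indicator (\<phi> ` W) y \<partial>lborel) \<le> ennreal (jac_const B) * (\<integral>\<^sup>+x. k (\<phi> x) * indicator W x \<partial>lborel)"
proof -
  have Wb: "W \<in> sets borel" "emeasure lborel W \<noteq> \<infinity>"
    using W emeasure_bounded_finite[OF W(2)] by auto
  have Vb: "\<phi> ` W \<in> sets borel" using inv(2) by simp
  define C where "C = jac_const B"
  have C: "emeasure lborel (\<phi> ` E) \<le> ennreal C * emeasure lborel E"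
    if "E \<in> sets borel" "E \<subseteq> W" "\<phi> ` E \<in> sets borel" for E
    unfolding C_def by (rule emeasure_image_bounded_derivative[OF Wb der B that])
  define \<psi>' where "\<psi>' y = (if y \<in> \<phi> ` W then \<psi> y else 0)" for y
  define \<phi>0 where "\<phi>0 x = (if x \<in> W then \<phi> x else 0)" for x
  have m\<psi> [measurable]: "\<psi>' \<in> borel_measurable borel"
    unfolding \<psi>'_def by (rule borel_measurable_continuous_on_if[OF Vb inv(3)]) auto
  have "continuous_on W \<phi>"
    by (intro continuous_at_imp_continuous_on ballI has_derivative_continuous[OF der])
  then have m\<phi> [measurable]: "\<phi>0 \<in> borel_measurable borel"
    unfolding \<phi>0_def by (intro borel_measurable_continuous_on_if[OF Wb(1)]) auto
  note [measurable] = Wb(1) Vb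
  define M where "M = distr (density lborel (indicator (\<phi> ` W))) borel \<psi>'"
  define N where "N = scale_measure (ennreal C) (density lborel (indicator W))"
  have "M \<le> N"
  proof (rule iffD2[OF le_measure])
    show "sets M = sets N" by (simp add: M_def N_def)
    show "\<forall>E\<in>sets M. emeasure M E \<le> emeasure N E"
    proof
      fix E assume "E \<in> sets M"
      then have E [measurable]: "E \<in> sets borel" by (simp add: M_def)
      have p: "\<psi>' -` E \<inter> \<phi> ` W = \<phi> ` (E \<inter> W)" using inv(1) by (auto simp: \<psi>'_def)
      have pm: "\<phi> ` (E \<inter> W) \<in> sets borel"
        using measurable_sets[OF m\<psi> E] Vb unfolding p[symmetric] by auto
      have "emeasure M E = (\<integral>\<^sup>+y. indicator (\<phi> ` W) y * indicator (\<psi>' -` E) y \<partial>lborel)"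
        using measurable_sets[OF m\<psi> E] by (simp add: M_def emeasure_distr emeasure_density)
      also have "\<dots> = (\<integral>\<^sup>+y. indicator (\<phi> ` (E \<inter> W)) y \<partial>lborel)"
        unfolding p[symmetric] by (intro nn_integral_cong) (auto simp: indicator_def)
      also have "\<dots> = emeasure lborel (\<phi> ` (E \<inter> W))" using pm by simp
      also have "\<dots> \<le> ennreal C * emeasure lborel (E \<inter> W)" by (rule C) (use pm in auto)
      also have "emeasure lborel (E \<inter> W) = (\<integral>\<^sup>+x. indicator W x * indicator E x \<partial>lborel)"
      proof -
        have "(\<integral>\<^sup>+x. indicator W x * indicator E x \<partial>lborel) = (\<integral>\<^sup>+x. indicator (E \<inter> W) x \<partial>lborel)"
          by (intro nn_integral_cong) (auto simp: indicator_def)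
        then show ?thesis by simp
      qed
      also have "ennreal C * \<dots> = emeasure N E" by (simp add: N_def emeasure_density)
      finally show "emeasure M E \<le> emeasure N E" .
    qed
  qed
  show ?thesis
  proof -
    have "(\<integral>\<^sup>+y. k y * indicator (\<phi> ` W) y \<partial>lborel) = (\<integral>\<^sup>+y. indicator (\<phi> ` W) y * k (\<phi>0 (\<psi>' y)) \<partial>lborel)"
      by (intro nn_integral_cong) (auto simp: indicator_def \<psi>'_def \<phi>0_def inv(1))
    also have "\<dots> = (\<integral>\<^sup>+x. k (\<phi>0 x) \<partial>M)"
      by (simp add: M_def nn_integral_distr nn_integral_density)
    also have "\<dots> \<le> (\<integral>\<^sup>+x. k (\<phi>0 x) \<partial>N)"
      by (rule nn_integral_mono_measure[OF _ \<open>M \<le> N\<close>]) (simp add: M_def N_def)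
    also have "\<dots> = ennreal C * (\<integral>\<^sup>+x. indicator W x * k (\<phi>0 x) \<partial>lborel)"
      by (simp add: N_def nn_integral_scale_measure nn_integral_density)
    also have "(\<integral>\<^sup>+x. indicator W x * k (\<phi>0 x) \<partial>lborel) = (\<integral>\<^sup>+x. k (\<phi> x) * indicator W x \<partial>lborel)"
      by (intro nn_integral_cong) (auto simp: indicator_def \<phi>0_def)
    finally show ?thesis unfolding C_def .
  qed
qed

section \<open>Radial powers and averaging\<close>

lemma borel_measurable_powr_indicator:
  assumes [measurable]: "f \<in> borel_measurable borel" "S \<in> sets borel"
  shows "(\<lambda>x. ennreal (norm (f x) powr a) * indicator S x) \<in> borel_measurable borel"
  by measurable

text \<open>Compare with balls of radius R / 2^k: at a point of the k-th dyadic annulus the k-th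
  term alone dominates, and the integrals of the terms form a geometric series whose ratio is 2 to
  the power \<open>a\<close> minus the dimension.\<close>

lemma nn_integral_norm_powr_ball:
  assumes a: "0 \<le> a" "a < real DIM('a)"
  shows "(\<integral>\<^sup>+x. ennreal (norm (x::'a::euclidean_space) powr (- a)) * indicator (ball 0 R) x \<partial>lborel) < \<infinity>"
proof (cases "R > 0")
  case False
  then have "indicator (ball 0 R) x = (0 :: ennreal)" for x :: 'a
    using norm_ge_zero[of x] by (auto simp: indicator_def simp del: norm_ge_zero)
  then show ?thesis by simp
next
  case True
  \<comment> \<open>The value of the power at distance R / 2^(k+1), its maximum on the k-th
    annulus.\<close>
  define b where "b k = (2 ^ Suc k / R) powr a" for k :: nat
  have pt: "ennreal (norm x powr (- a)) * indicator (ball 0 R) x \<le> (\<Sum>k. ennreal (b k) * indicator (ball 0 (R / 2 ^ k)) x)" for x :: 'a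
  proof (cases "x = 0 \<or> x \<notin> ball 0 R")
    case True
    then show ?thesis by auto
  next
    case False
    then have x: "norm x > 0" "norm x < R" by auto
    obtain n where "(1/2::real) ^ n < norm x / R" using real_arch_pow_inv[of "norm x / R" "1/2"] x True by auto
    then have "R / 2 ^ n < norm x" using True by (simp add: field_simps power_one_over)
    moreover have "R / 2 ^ Suc n \<le> R / 2 ^ n" using True by (simp add: field_simps)
    ultimately have ex: "R / 2 ^ Suc n \<le> norm x" by linarith
    define k where "k = (LEAST k. R / 2 ^ Suc k \<le> norm x)"
    have k1: "R / 2 ^ Suc k \<le> norm x" unfolding k_def by (rule LeastI[of "\<lambda>k. R / 2 ^ Suc k \<le> norm x" n, OF ex])
    have k2: "norm x < R / 2 ^ k"
    proof (cases k)
      case 0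
      then show ?thesis using x by simp
    next
      case (Suc j)
      then have "\<not> (R / 2 ^ Suc j \<le> norm x)" using not_less_Least[of j "\<lambda>k. R / 2 ^ Suc k \<le> norm x"] by (simp add: k_def)
      then show ?thesis using Suc by simp
    qed
    have "norm x powr (- a) \<le> (R / 2 ^ Suc k) powr (- a)"
      using k1 a True by (intro powr_mono2') auto
    also have "\<dots> = b k" using True by (simp add: b_def powr_minus powr_divide)
    finally have "ennreal (norm x powr (- a)) * indicator (ball 0 R) x \<le> ennreal (b k) * indicator (ball 0 (R / 2 ^ k)) x"
      using x k2 by (simp add: ennreal_leI)
    also have "\<dots> \<le> (\<Sum>k. ennreal (b k) * indicator (ball 0 (R / 2 ^ k)) x)"
    proof -
      have "F k \<le> suminf F" for F :: "nat \<Rightarrow> ennreal"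
        using sum_le_suminf[of F "{k}"] by simp
      then show ?thesis .
    qed
    finally show ?thesis .
  qed
  define V where "V = unit_ball_vol (real DIM('a)) * R ^ DIM('a)"
  have V0: "V \<ge> 0" using True by (simp add: V_def)
  define q where "q = 2 powr (a - real DIM('a))"
  have q: "0 \<le> q" "q < 1" using a powr_less_mono[of "a - real DIM('a)" 0 2] by (auto simp: q_def)
  have tm: "(\<integral>\<^sup>+x. ennreal (b k) * indicator (ball 0 (R / 2 ^ k)) (x::'a) \<partial>lborel) = ennreal ((2 / R) powr a * V * q ^ k)" for k
  proof -
    have "b k * (unit_ball_vol (real DIM('a)) * (R / 2 ^ k) ^ DIM('a)) = (2 / R) powr a * V * q ^ k"
    proof -
      have 1: "b k = (2 / R) powr a * (2 powr a) ^ k"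
      proof -
        have "b k = (2 / R * 2 ^ k) powr a" by (simp add: b_def)
        also have "\<dots> = (2 / R) powr a * (2 ^ k) powr a" by (rule powr_mult)
        also have "((2::real) ^ k) powr a = 2 powr (real k * a)" by (simp add: powr_realpow[symmetric] powr_powr)
        also have "\<dots> = (2 powr a) powr (real k)" by (simp add: powr_powr mult.commute)
        also have "\<dots> = (2 powr a) ^ k" by (rule powr_realpow) simp
        finally show ?thesis .
      qed
      have 2: "q ^ k = (2 powr a) ^ k / (2 ^ k) ^ DIM('a)"
        by (simp add: q_def powr_diff powr_realpow power_divide power_mult[symmetric] mult.commute)
      show ?thesis unfolding 1 2 V_def by (simp add: power_divide)
    qed
    moreover have "b k \<ge> 0" by (simp add: b_def)
    ultimately show ?thesis
      using True by (simp add: nn_integral_cmult_indicator emeasure_ball ennreal_mult[symmetric])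
  qed
  have "(\<integral>\<^sup>+x. ennreal (norm (x::'a) powr (- a)) * indicator (ball 0 R) x \<partial>lborel)
     \<le> (\<integral>\<^sup>+x. (\<Sum>k. ennreal (b k) * indicator (ball 0 (R / 2 ^ k)) (x::'a)) \<partial>lborel)"
    by (intro nn_integral_mono pt)
  also have "\<dots> = (\<Sum>k. ennreal ((2 / R) powr a * V * q ^ k))"
  proof -
    have "(\<integral>\<^sup>+x. (\<Sum>k. ennreal (b k) * indicator (ball 0 (R / 2 ^ k)) (x::'a)) \<partial>lborel)
       = (\<Sum>k. \<integral>\<^sup>+x. ennreal (b k) * indicator (ball 0 (R / 2 ^ k)) (x::'a) \<partial>lborel)"
    proof (rule nn_integral_suminf)
      fix k
      have [measurable]: "ball (0::'a) (R / 2 ^ k) \<in> sets borel" by simp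
      show "(\<lambda>x. ennreal (b k) * indicator (ball 0 (R / 2 ^ k)) (x::'a)) \<in> borel_measurable lborel"
        by measurable
    qed
    then show ?thesis unfolding tm .
  qed
  also have "\<dots> < \<infinity>"
  proof -
    have "summable (\<lambda>k. (2 / R) powr a * V * q ^ k)" using q by (intro summable_mult summable_geometric) auto
    then have "(\<Sum>k. ennreal ((2 / R) powr a * V * q ^ k)) \<noteq> top"
      by (rule ennreal_suminf_neq_top) (use q V0 in simp)
    then show ?thesis by (simp add: less_top)
  qed
  finally show ?thesis .
qed

text \<open>Halving the variable shows that the integral over the ball of radius
  \<open>2 * R\<close> is at most that over the ball of radius \<open>R\<close>. Were it finite, the
  annulus between them would contribute 0, but the integrand is positive there.\<close>

lemma nn_integral_norm_powr_ball_infinite: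
  assumes R: "R > 0" and a: "a \<ge> real DIM('a)"
  shows "(\<integral>\<^sup>+x. ennreal (norm (x::'a::euclidean_space) powr (- a)) * indicator (ball 0 R) x \<partial>lborel) = \<infinity>"
proof (rule ccontr)
  let ?D = "DIM('a)"
  let ?J = "\<lambda>S. \<integral>\<^sup>+x. ennreal (norm (x::'a) powr (- a)) * indicator S x \<partial>lborel"
  let ?S = "ball (0::'a) (2 * R) - ball 0 R"
  assume fin: "?J (ball 0 R) \<noteq> \<infinity>"
  have a0: "a \<ge> 0" using a by linarith
  have [measurable]: "(\<lambda>x. indicator (ball 0 R) ((0::'a) + (1/2) *\<^sub>R x) :: ennreal) \<in> borel_measurable borel"
    by (rule measurable_compose[OF _ borel_measurable_indicator[of "ball 0 R" borel]]) auto
  have "?J (ball 0 R) = ennreal (\<bar>1/2\<bar> ^ ?D) * (\<integral>\<^sup>+x. ennreal (norm (0 + (1/2) *\<^sub>R x :: 'a) powr (- a)) * indicator (ball 0 R) (0 + (1/2) *\<^sub>R x) \<partial>lborel)"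
    by (rule lborel_nn_integral_affine) (measurable, auto)
  also have "\<dots> = (\<integral>\<^sup>+x. ennreal (\<bar>1/2\<bar> ^ ?D) * (ennreal (norm (0 + (1/2) *\<^sub>R x :: 'a) powr (- a)) * indicator (ball 0 R) (0 + (1/2) *\<^sub>R x)) \<partial>lborel)"
    by (rule nn_integral_cmult[symmetric]) measurable
  also have "\<dots> \<ge> ?J (ball 0 (2 * R))"
  proof (rule nn_integral_mono)
    fix x :: 'a
    have "(1 / 2) ^ ?D * ((1 / 2 :: real) powr (- a)) = 2 powr (a - ?D)"
      by (simp add: powr_diff powr_realpow powr_minus powr_divide power_one_over field_simps)
    also have "\<dots> \<ge> 1" using a by (simp add: ge_one_powr_ge_zero)
    finally have "1 * norm x powr (- a) \<le> ((1 / 2) ^ ?D * ((1 / 2) powr (- a))) * norm x powr (- a)"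
      by (intro mult_right_mono) auto
    also have "\<dots> = (1/2) ^ ?D * norm (0 + (1/2) *\<^sub>R x :: 'a) powr (- a)"
      by (simp only: add_0 norm_scaleR powr_mult[of "\<bar>1/2\<bar>" "norm x" "-a"] abs_ge_zero norm_ge_zero)
    finally show "ennreal (norm x powr (- a)) * indicator (ball 0 (2 * R)) x \<le>
      ennreal (\<bar>1/2\<bar> ^ ?D) * (ennreal (norm (0 + (1/2) *\<^sub>R x :: 'a) powr (- a)) * indicator (ball 0 R) (0 + (1/2) *\<^sub>R x))"
      by (auto simp: indicator_def ennreal_mult[symmetric] intro!: ennreal_leI)
  qed
  finally have 1: "?J (ball 0 (2 * R)) \<le> ?J (ball 0 R)" .
  have "?J (ball 0 R) + ?J ?S = (\<integral>\<^sup>+x. ennreal (norm (x::'a) powr (- a)) * indicator (ball 0 R) x + ennreal (norm x powr (- a)) * indicator ?S x \<partial>lborel)"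
    by (rule nn_integral_add[symmetric]) (auto intro!: borel_measurable_powr_indicator)
  also have "\<dots> = ?J (ball 0 (2 * R))"
    using R by (intro nn_integral_cong) (auto simp: indicator_def)
  finally have "?J (ball 0 R) + ?J ?S \<le> ?J (ball 0 R) + 0" using 1 by simp
  then have "?J ?S = 0" using fin by (subst (asm) ennreal_add_left_cancel_le) auto
  moreover have "?J ?S \<ge> (\<integral>\<^sup>+x. ennreal ((2 * R) powr (- a)) * indicator ?S x \<partial>lborel)"
  proof (rule nn_integral_mono)
    fix x :: 'a
    have "(2 * R) powr (- a) \<le> norm x powr (- a)" if "x \<in> ?S"
      using that R a0 by (intro powr_mono2') auto
    then show "ennreal ((2 * R) powr (- a)) * indicator ?S x \<le> ennreal (norm x powr (- a)) * indicator ?S x"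
      by (auto simp: indicator_def intro!: ennreal_leI)
  qed
  moreover have "(\<integral>\<^sup>+x. ennreal ((2 * R) powr (- a)) * indicator ?S x \<partial>lborel) = ennreal ((2 * R) powr (- a)) * emeasure lborel ?S"
    by (rule nn_integral_cmult_indicator) simp
  moreover have "emeasure lborel ?S > 0"
  proof -
    have "emeasure lborel ?S = emeasure lborel (ball (0::'a) (2 * R)) - emeasure lborel (ball (0::'a) R)"
      using R emeasure_bounded_finite[OF bounded_ball, of "0::'a" R] by (intro emeasure_Diff) auto
    also have "\<dots> = ennreal (unit_ball_vol ?D * (2 * R) ^ ?D - unit_ball_vol ?D * R ^ ?D)"
      using R by (simp add: emeasure_ball ennreal_minus)
    also have "\<dots> > 0"
    proof -
      have "R ^ ?D < (2 * R) ^ ?D" using R by (intro power_strict_mono) auto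
      then show ?thesis by (simp add: mult_strict_left_mono)
    qed
    finally show ?thesis .
  qed
  moreover have "ennreal ((2 * R) powr (- a)) > 0" using R by simp
  ultimately show False by (simp add: ennreal_zero_less_mult_iff)
qed

text \<open>The integral over \<open>B\<close> equals its average over all translations \<iota> t
  with \<open>t\<close> in \<open>A\<close>. Tonelli moves the integral over \<open>t\<close>
  inside, where it is bounded by \<open>K\<close>. In this way uniform bounds along parallel slices
  bound the full integral without a change of coordinates.\<close>

lemma nn_integral_averaging:
  fixes G :: "'a::euclidean_space \<Rightarrow> ennreal" and \<iota> :: "'b::euclidean_space \<Rightarrow> 'a"
  assumes [measurable]: "G \<in> borel_measurable borel" "\<iota> \<in> borel_measurable borel" "A \<in> sets borel" "B \<in> sets borel" "B' \<in> sets borel"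
    and A: "emeasure lborel A \<noteq> 0" "emeasure lborel A \<noteq> \<infinity>"
    and B': "emeasure lborel B' < \<infinity>" "\<And>x t. t \<in> A \<Longrightarrow> x + \<iota> t \<in> B \<Longrightarrow> x \<in> B'"
    and K: "K < \<infinity>" "\<And>x. x \<in> B' \<Longrightarrow> (\<integral>\<^sup>+t. G (x + \<iota> t) * indicator A t \<partial>lborel) \<le> K"
  shows "(\<integral>\<^sup>+x. G x * indicator B x \<partial>lborel) < \<infinity>"
proof -
  let ?I = "\<integral>\<^sup>+x. G x * indicator B x \<partial>lborel"
  have tr: "(\<integral>\<^sup>+x. G (x + \<iota> t) * indicator B (x + \<iota> t) \<partial>lborel) = ?I" for t
    using lborel_nn_integral_affine[of "\<lambda>x. G x * indicator B x" 1 "\<iota> t"] by (simp add: add.commute)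
  have "emeasure lborel A * ?I = (\<integral>\<^sup>+t. (\<integral>\<^sup>+x. G (x + \<iota> t) * indicator B (x + \<iota> t) * indicator A t \<partial>lborel) \<partial>lborel)"
    by (simp add: nn_integral_multc tr nn_integral_cmult mult.commute)
  also have "\<dots> = (\<integral>\<^sup>+x. (\<integral>\<^sup>+t. G (x + \<iota> t) * indicator B (x + \<iota> t) * indicator A t \<partial>lborel) \<partial>lborel)"
    by (rule lborel_pair.Fubini') measurable
  also have "\<dots> \<le> (\<integral>\<^sup>+x. K * indicator B' x \<partial>lborel)"
  proof (rule nn_integral_mono)
    fix x :: 'a
    show "(\<integral>\<^sup>+t. G (x + \<iota> t) * indicator B (x + \<iota> t) * indicator A t \<partial>lborel) \<le> K * indicator B' x"
    proof (cases "x \<in> B'")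
      case True
      have "(\<integral>\<^sup>+t. G (x + \<iota> t) * indicator B (x + \<iota> t) * indicator A t \<partial>lborel) \<le> (\<integral>\<^sup>+t. G (x + \<iota> t) * indicator A t \<partial>lborel)"
        by (intro nn_integral_mono) (auto simp: indicator_def)
      then show ?thesis using K(2)[OF True] True by simp
    next
      case False
      then have "G (x + \<iota> t) * indicator B (x + \<iota> t) * indicator A t = 0" for t
        using B'(2)[of t x] by (auto simp: indicator_def)
      note z = this
      have "(\<integral>\<^sup>+t. G (x + \<iota> t) * indicator B (x + \<iota> t) * indicator A t \<partial>lborel) = (\<integral>\<^sup>+(t::'b). 0 \<partial>lborel)"
        by (intro nn_integral_cong z)
      then show ?thesis by simp
    qed
  qed
  also have "\<dots> < \<infinity>" using K(1) B'(1) by (simp add: nn_integral_cmult_indicator ennreal_mult_less_top)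
  finally have "emeasure lborel A * ?I < \<infinity>" .
  then show ?thesis using A by (auto simp: ennreal_mult_less_top less_top)
qed

text \<open>Average over the dilations about \<open>y\<close>.\<close>

lemma AE_nonzero_if_polynomial_on_rays:
  fixes g :: "'a::euclidean_space \<Rightarrow> complex"
  assumes [measurable]: "g \<in> borel_measurable borel"
    and nz: "g y \<noteq> 0" and P: "\<And>x. \<exists>P. \<forall>t. g (y + t *\<^sub>R x) = poly P (of_real t)"
  shows "AE x in lborel. g x \<noteq> 0"
proof -
  let ?N = "\<integral>\<^sup>+x. indicator {x. g x = 0} x \<partial>lborel"
  have sc: "?N = ennreal (\<bar>t\<bar> ^ DIM('a)) * (\<integral>\<^sup>+x. indicator {x. g x = 0} (y + t *\<^sub>R x) \<partial>lborel)" if "t > 0" for t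
    using that by (intro lborel_nn_integral_affine) auto
  have "(\<integral>\<^sup>+t. (\<integral>\<^sup>+x. indicator {x. g x = 0} (y + t *\<^sub>R x) * indicator {1..2} t \<partial>lborel) \<partial>lborel)
    = (\<integral>\<^sup>+x. (\<integral>\<^sup>+t. indicator {x. g x = 0} (y + t *\<^sub>R x) * indicator {1..2} t \<partial>lborel) \<partial>(lborel :: 'a measure))"
    (is "?L = _")
    by (rule lborel_pair.Fubini') measurable
  also have "\<dots> = (\<integral>\<^sup>+x. 0 \<partial>(lborel :: 'a measure))"
  proof (rule nn_integral_cong)
    fix x :: 'a
    obtain P where P: "\<And>t. g (y + t *\<^sub>R x) = poly P (of_real t)" using assms(3) by blast
    have "P \<noteq> 0" using P[of 0] nz by auto
    then have "finite {z. poly P z = 0}" by (rule poly_roots_finite)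
    moreover have "of_real ` {t. g (y + t *\<^sub>R x) = 0} \<subseteq> {z. poly P z = 0}" using P by auto
    ultimately have "finite (complex_of_real ` {t. g (y + t *\<^sub>R x) = 0})" using finite_subset by blast
    then have fin: "finite {t. g (y + t *\<^sub>R x) = 0}" by (rule finite_imageD) (simp add: inj_on_def)
    have "AE t in lborel. t \<notin> {t. g (y + t *\<^sub>R x) = 0}"
      using finite_imp_null_set_lborel[OF fin] by (rule AE_not_in)
    then have "AE t in lborel. indicator {x. g x = 0} (y + t *\<^sub>R x) * indicator {1..2} t = (0 :: ennreal)"
      by eventually_elim simp
    then show "(\<integral>\<^sup>+t. indicator {x. g x = 0} (y + t *\<^sub>R x) * indicator {1..2} t \<partial>lborel) = 0"
      by (subst nn_integral_0_iff_AE) auto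
  qed
  finally have L0: "?L = 0" by simp
  have "?N * indicator {1..2} t \<le> ennreal (2 ^ DIM('a)) * (\<integral>\<^sup>+x. indicator {x. g x = 0} (y + t *\<^sub>R x) * indicator {1..2} t \<partial>lborel)" for t :: real
  proof (cases "t \<in> {1..2}")
    case True
    then have "?N \<le> ennreal (2 ^ DIM('a)) * (\<integral>\<^sup>+x. indicator {x. g x = 0} (y + t *\<^sub>R x) \<partial>lborel)"
      by (subst sc[of t]) (auto intro!: mult_right_mono ennreal_leI power_mono)
    then show ?thesis using True by simp
  qed simp
  then have "(\<integral>\<^sup>+t. ?N * indicator {1..2::real} t \<partial>lborel) \<le> (\<integral>\<^sup>+t. ennreal (2 ^ DIM('a)) * (\<integral>\<^sup>+x. indicator {x. g x = 0} (y + t *\<^sub>R x) * indicator {1..2} t \<partial>lborel) \<partial>lborel)"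
    by (intro nn_integral_mono)
  also have "\<dots> = ennreal (2 ^ DIM('a)) * ?L" by (rule nn_integral_cmult) measurable
  finally have "?N = 0"
    unfolding L0 by (simp add: nn_integral_cmult_indicator)
  then have "emeasure lborel {x. g x = 0} = 0" by simp
  then have "{x. g x = 0} \<in> null_sets lborel" by (simp add: null_sets_def)
  from AE_not_in[OF this] show ?thesis by simp
qed


section \<open>Integrability at simple singularities\<close>

definition int_near :: "real \<Rightarrow> (complex \<times> complex \<Rightarrow> complex) \<Rightarrow> bool" where
  "int_near c g \<longleftrightarrow> (\<exists>r>0. set_integrable lborel (ball 0 r) (\<lambda>x. norm (g x) powr (- 2 * c)))"

lemma set_integrable_iff_nn_integral:
  fixes g :: "'a::euclidean_space \<Rightarrow> complex"
  assumes [measurable]: "g \<in> borel_measurable borel" "S \<in> sets borel"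
  shows "set_integrable lborel S (\<lambda>x. norm (g x) powr a) \<longleftrightarrow>
    (\<integral>\<^sup>+x. ennreal (norm (g x) powr a) * indicator S x \<partial>lborel) < \<infinity>"
proof -
  have "(\<integral>\<^sup>+x. ennreal (norm (indicat_real S x *\<^sub>R (norm (g x) powr a))) \<partial>lborel) =
    (\<integral>\<^sup>+x. ennreal (norm (g x) powr a) * indicator S x \<partial>lborel)"
    by (intro nn_integral_cong) (auto simp: indicator_def)
  then show ?thesis
    by (simp add: set_integrable_def integrable_iff_bounded)
qed

lemma holomorphic2_continuous_on: "holomorphic2_on g U \<Longrightarrow> continuous_on U g"
  unfolding holomorphic2_on_def
  by (intro continuous_at_imp_continuous_on ballI) (blast intro: has_derivative_continuous)

text \<open>\<open>holomorphic2_on\<close> asks for complex differentiability at each point only.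
  That the partial derivatives are locally bounded comes from Cauchy's inequality on coordinate
  discs of a fixed radius.\<close>

lemma holomorphic2_derivative_bounded:
  assumes g: "holomorphic2_on g U" and U: "open U" "0 \<in> U"
  shows "\<exists>r>0. \<exists>B. ball 0 r \<subseteq> U \<and> (\<forall>x\<in>ball 0 r. \<forall>a b. (g has_derivative (\<lambda>(h, k). a * h + b * k)) (at x) \<longrightarrow> norm a \<le> B \<and> norm b \<le> B)"
proof -
  obtain e where e: "e > 0" "cball 0 e \<subseteq> U" using U open_contains_cball by blast
  define r where "r = e / 2"
  have r: "r > 0" "e = 2 * r" using e by (auto simp: r_def)
  have gc: "continuous_on U g" by (rule holomorphic2_continuous_on[OF g])
  have "bounded (g ` cball 0 e)"
    by (intro compact_imp_bounded compact_continuous_image continuous_on_subset[OF gc e(2)]) simp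
  then obtain M where "\<forall>y\<in>g ` cball 0 e. norm y \<le> M" unfolding bounded_iff by blast
  then have M: "norm (g x) \<le> M" if "x \<in> cball 0 e" for x using that by blast
  \<comment> \<open>\<iota> stands for either inclusion of a coordinate axis, so that one
    application of Cauchy's inequality serves both partial derivatives.\<close>
  have key: "norm a \<le> M / r"
    if x: "x \<in> ball 0 r" and \<iota>: "bounded_linear \<iota>" "\<And>z. norm (\<iota> z) = norm z"
      and L: "(g has_derivative L) (at x)" "\<And>z. L (\<iota> z) = a * z"
      and all: "\<And>y. y \<in> U \<Longrightarrow> \<exists>c L. (g has_derivative L) (at y) \<and> (\<forall>z. L (\<iota> z) = c * z)"
    for x a L and \<iota> :: "complex \<Rightarrow> complex \<times> complex"
  proof -
    define \<phi> where "\<phi> z = g (x + \<iota> z)" for z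
    have inU: "x + \<iota> z \<in> cball 0 e" if "norm z \<le> r" for z
      using x that norm_triangle_ineq[of x "\<iota> z"] \<iota>(2)[of z] r by simp
    have der: "(\<phi> has_field_derivative c) (at z)"
      if "(g has_derivative L) (at (x + \<iota> z))" "\<And>z. L (\<iota> z) = c * z" for z c L
    proof -
      have "((\<lambda>z. x + \<iota> z) has_derivative \<iota>) (at z)"
        using has_derivative_add[OF has_derivative_const bounded_linear_imp_has_derivative[OF \<iota>(1)]] by simp
      from has_derivative_compose[OF this that(1)] have "(\<phi> has_derivative (\<lambda>h. c * h)) (at z)"
        by (simp add: \<phi>_def[abs_def] that(2))
      then show ?thesis by (simp add: has_field_derivative_def)
    qed
    have fd: "\<exists>c. (\<phi> has_field_derivative c) (at z)" if "norm z \<le> r" for z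
      using all[of "x + \<iota> z"] inU[OF that] e(2) der by blast
    have hol: "\<phi> holomorphic_on ball 0 r"
      unfolding holomorphic_on_def field_differentiable_def
      using fd by (metis dist_0_norm has_field_derivative_at_within less_imp_le mem_ball)
    have cont: "continuous_on (cball 0 r) \<phi>"
      by (intro continuous_at_imp_continuous_on ballI) (use fd DERIV_isCont in \<open>auto simp: dist_norm\<close>)
    have \<iota>0: "\<iota> 0 = 0" using \<iota>(2)[of 0] by simp
    have "norm ((deriv ^^ 1) \<phi> 0) \<le> fact 1 * M / r ^ 1"
      by (rule Cauchy_inequality[OF hol cont r(1)]) (use M inU in \<open>auto simp: \<phi>_def\<close>)
    moreover have "deriv \<phi> 0 = a" by (rule DERIV_imp_deriv[OF der[of L 0]]) (simp_all add: \<iota>0 L)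
    ultimately show ?thesis by simp
  qed
  have all: "\<exists>a b. (g has_derivative (\<lambda>(h, k). a * h + b * k)) (at y)" if "y \<in> U" for y
    using g that unfolding holomorphic2_on_def by blast
  have "norm a \<le> M / r \<and> norm b \<le> M / r"
    if x: "x \<in> ball 0 r" and d: "(g has_derivative (\<lambda>(h, k). a * h + b * k)) (at x)" for x a b
  proof
    show "norm a \<le> M / r"
      by (rule key[OF x, where \<iota> = "\<lambda>z. (z, 0)", OF _ _ d])
         (use all in \<open>force intro!: bounded_linear_Pair bounded_linear_ident bounded_linear_zero simp: norm_Pair\<close>)+
    show "norm b \<le> M / r"
      by (rule key[OF x, where \<iota> = "\<lambda>z. (0, z)", OF _ _ d])
         (use all in \<open>force intro!: bounded_linear_Pair bounded_linear_ident bounded_linear_zero simp: norm_Pair\<close>)+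
  qed
  moreover have "ball 0 r \<subseteq> U" using e r by (auto simp: subset_iff)
  ultimately show ?thesis using r(1) by blast
qed

text \<open>On a small ball the derivative of \<phi> is bounded, so
  \<open>nn_integral_image_le\<close> applies, and |u| is at least half of its value at 0, so the
  negative power of the unit is bounded by a constant. The image of the ball is an open
  neighbourhood of 0.\<close>

lemma int_near_transfer:
  assumes c: "c \<ge> 0" and meas [measurable]: "g \<in> borel_measurable borel" "h \<in> borel_measurable borel"
    and \<phi>: "open U" "0 \<in> U" "\<phi> 0 = 0" "open V" "\<phi> ` U = V" "inj_on \<phi> U"
      "holomorphic2_on (fst \<circ> \<phi>) U" "holomorphic2_on (snd \<circ> \<phi>) U" "continuous_on V (the_inv_into U \<phi>)"
    and u: "continuous_on U u" "\<And>x. x \<in> U \<Longrightarrow> u x \<noteq> 0 \<and> g (\<phi> x) = u x * h x"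
    and int: "int_near c h"
  shows "int_near c g"
proof -
  obtain r0 where r0: "r0 > 0" "set_integrable lborel (ball 0 r0) (\<lambda>x. norm (h x) powr (- 2 * c))"
    using int unfolding int_near_def by blast
  obtain r1 B1 where r1: "r1 > 0" "ball 0 r1 \<subseteq> U"
    "\<And>x a b. x\<in>ball 0 r1 \<Longrightarrow> ((fst \<circ> \<phi>) has_derivative (\<lambda>(h, k). a * h + b * k)) (at x) \<Longrightarrow> norm a \<le> B1 \<and> norm b \<le> B1"
    using holomorphic2_derivative_bounded[OF \<phi>(7,1,2)] by blast
  obtain r2 B2 where r2: "r2 > 0" "ball 0 r2 \<subseteq> U"
    "\<And>x a b. x\<in>ball 0 r2 \<Longrightarrow> ((snd \<circ> \<phi>) has_derivative (\<lambda>(h, k). a * h + b * k)) (at x) \<Longrightarrow> norm a \<le> B2 \<and> norm b \<le> B2"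
    using holomorphic2_derivative_bounded[OF \<phi>(8,1,2)] by blast
  have "continuous (at 0) u" using u(1) \<phi>(1,2) continuous_on_eq_continuous_at by blast
  then obtain r3 where r3: "r3 > 0" "\<And>x. norm x < r3 \<Longrightarrow> norm (u x - u 0) < norm (u 0) / 2"
    using u(2)[OF \<phi>(2)] unfolding continuous_at_eps_delta by (auto simp: dist_norm dest!: spec[of _ "norm (u 0) / 2"])
  define r where "r = min (min r0 r1) (min r2 r3)"
  have r: "r > 0" "r \<le> r0" "r \<le> r1" "r \<le> r2" "r \<le> r3" using r0 r1 r2 r3 by (auto simp: r_def)
  define W where "W = ball (0 :: complex \<times> complex) r"
  have WU: "W \<subseteq> U" using r r1(2) by (force simp: W_def)
  have "\<exists>a1 b1 a2 b2. ((fst \<circ> \<phi>) has_derivative (\<lambda>(h, k). a1 * h + b1 * k)) (at x) \<and> ((snd \<circ> \<phi>) has_derivative (\<lambda>(h, k). a2 * h + b2 * k)) (at x)"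
    if "x \<in> W" for x
    using \<phi>(7,8) WU that unfolding holomorphic2_on_def by blast
  then obtain a1 b1 a2 b2 where ab: "\<And>x. x \<in> W \<Longrightarrow> ((fst \<circ> \<phi>) has_derivative (\<lambda>(h, k). a1 x * h + b1 x * k)) (at x)"
    "\<And>x. x \<in> W \<Longrightarrow> ((snd \<circ> \<phi>) has_derivative (\<lambda>(h, k). a2 x * h + b2 x * k)) (at x)" by metis
  define \<phi>' where "\<phi>' x v = ((\<lambda>(h, k). a1 x * h + b1 x * k) v, (\<lambda>(h, k). a2 x * h + b2 x * k) v)" for x v
  have der: "(\<phi> has_derivative \<phi>' x) (at x)" if "x \<in> W" for x
    using has_derivative_Pair[OF ab(1)[OF that] ab(2)[OF that]] by (simp add: \<phi>'_def[abs_def])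
  have on: "onorm (\<phi>' x) \<le> 2 * \<bar>B1\<bar> + 2 * \<bar>B2\<bar>" if x: "x \<in> W" for x
  proof (rule onorm_le)
    fix v :: "complex \<times> complex"
    obtain h k where v: "v = (h, k)" by force
    have n: "norm h \<le> norm v" "norm k \<le> norm v" by (simp_all add: v norm_Pair real_le_rsqrt)
    have 1: "norm (a1 x) \<le> \<bar>B1\<bar>" "norm (b1 x) \<le> \<bar>B1\<bar>" "norm (a2 x) \<le> \<bar>B2\<bar>" "norm (b2 x) \<le> \<bar>B2\<bar>"
      using r1(3)[OF _ ab(1)[OF x]] r2(3)[OF _ ab(2)[OF x]] x r unfolding W_def by force+
    have "norm (\<phi>' x v) \<le> norm (a1 x * h + b1 x * k) + norm (a2 x * h + b2 x * k)"
      by (simp add: \<phi>'_def v norm_Pair sqrt_sum_squares_le_sum)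
    also have "\<dots> \<le> (norm (a1 x) * norm h + norm (b1 x) * norm k) + (norm (a2 x) * norm h + norm (b2 x) * norm k)"
      by (intro add_mono order_trans[OF norm_triangle_ineq]) (simp_all add: norm_mult)
    also have "\<dots> \<le> (\<bar>B1\<bar> * norm v + \<bar>B1\<bar> * norm v) + (\<bar>B2\<bar> * norm v + \<bar>B2\<bar> * norm v)"
      using 1 n by (intro add_mono mult_mono) auto
    finally show "norm (\<phi>' x v) \<le> (2 * \<bar>B1\<bar> + 2 * \<bar>B2\<bar>) * norm v" by (simp add: algebra_simps)
  qed
  have inv: "the_inv_into U \<phi> (\<phi> x) = x" if "x \<in> W" for x
    using the_inv_into_f_f[OF \<phi>(6)] WU that by blast
  have img: "\<phi> ` W = the_inv_into U \<phi> -` W \<inter> V"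
  proof (intro equalityI subsetI)
    fix y assume "y \<in> \<phi> ` W" then show "y \<in> the_inv_into U \<phi> -` W \<inter> V" using inv \<phi>(5) WU by auto
  next
    fix y assume y: "y \<in> the_inv_into U \<phi> -` W \<inter> V"
    then have "\<phi> (the_inv_into U \<phi> y) = y" using f_the_inv_into_f[OF \<phi>(6)] \<phi>(5) by blast
    then show "y \<in> \<phi> ` W" using y by (metis IntE imageI vimageE)
  qed
  have opn: "open (\<phi> ` W)"
    unfolding img using continuous_open_preimage[OF \<phi>(9,4)] by (simp add: W_def Int_commute)
  define C where "C = jac_const (2 * \<bar>B1\<bar> + 2 * \<bar>B2\<bar>)"
  have C: "(\<integral>\<^sup>+y. k y * indicator (\<phi> ` W) y \<partial>lborel) \<le> ennreal C * (\<integral>\<^sup>+x. k (\<phi> x) * indicator W x \<partial>lborel)"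
    if "k \<in> borel_measurable borel" for k
    unfolding C_def
    by (rule nn_integral_image_le[OF _ _ der on inv opn _ that])
       (use \<phi>(5) WU in \<open>auto simp: W_def intro!: continuous_on_subset[OF \<phi>(9)]\<close>)
  define D where "D = (norm (u 0) / 2) powr (- 2 * c)"
  have pt: "ennreal (norm (g (\<phi> x)) powr (- 2 * c)) * indicator W x \<le> ennreal D * (ennreal (norm (h x) powr (- 2 * c)) * indicator (ball 0 r0) x)" for x
  proof (cases "x \<in> W")
    case True
    then have x: "norm x < r" by (simp add: W_def)
    have "norm (u 0) / 2 \<le> norm (u x)" using r3(2)[of x] x r norm_triangle_ineq2[of "u 0" "u 0 - u x"] by (simp add: norm_minus_commute)
    then have "norm (u x) powr (- 2 * c) \<le> D"
      unfolding D_def using u(2)[OF \<phi>(2)] c by (intro powr_mono2') auto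
    then have "norm (u x) powr (- 2 * c) * norm (h x) powr (- 2 * c) \<le> D * norm (h x) powr (- 2 * c)"
      by (rule mult_right_mono) simp
    moreover have "g (\<phi> x) = u x * h x" using u(2)[of x] True WU by blast
    ultimately have "norm (g (\<phi> x)) powr (- 2 * c) \<le> D * norm (h x) powr (- 2 * c)"
      by (simp only: norm_mult powr_mult)
    moreover have "D \<ge> 0" by (simp add: D_def)
    ultimately show ?thesis using True x r by (simp add: ennreal_mult[symmetric] ennreal_leI)
  qed simp
  have fin: "(\<integral>\<^sup>+x. ennreal (norm (h x) powr (- 2 * c)) * indicator (ball 0 r0) x \<partial>lborel) < \<infinity>"
    using r0(2) by (subst (asm) set_integrable_iff_nn_integral) auto
  have "(\<integral>\<^sup>+y. ennreal (norm (g y) powr (- 2 * c)) * indicator (\<phi> ` W) y \<partial>lborel)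
    \<le> ennreal C * (\<integral>\<^sup>+x. ennreal (norm (g (\<phi> x)) powr (- 2 * c)) * indicator W x \<partial>lborel)"
    by (rule C) measurable
  also have "\<dots> \<le> ennreal C * (\<integral>\<^sup>+x. ennreal D * (ennreal (norm (h x) powr (- 2 * c)) * indicator (ball 0 r0) x) \<partial>lborel)"
    by (intro mult_left_mono nn_integral_mono pt) auto
  also have "(\<integral>\<^sup>+x. ennreal D * (ennreal (norm (h x) powr (- 2 * c)) * indicator (ball 0 r0) x) \<partial>lborel)
     = ennreal D * (\<integral>\<^sup>+x. ennreal (norm (h x) powr (- 2 * c)) * indicator (ball 0 r0) x \<partial>lborel)"
    by (rule nn_integral_cmult) (simp add: borel_measurable_powr_indicator)
  also have "ennreal C * \<dots> < \<infinity>" using fin by (simp add: ennreal_mult_less_top)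
  finally have F: "(\<integral>\<^sup>+y. ennreal (norm (g y) powr (- 2 * c)) * indicator (\<phi> ` W) y \<partial>lborel) < \<infinity>" .
  have "0 \<in> \<phi> ` W" using \<phi>(3) r(1) by (force simp: W_def)
  then obtain \<rho> where \<rho>: "\<rho> > 0" "ball 0 \<rho> \<subseteq> \<phi> ` W" using opn open_contains_ball by blast
  have "(\<integral>\<^sup>+y. ennreal (norm (g y) powr (- 2 * c)) * indicator (ball 0 \<rho>) y \<partial>lborel) \<le> (\<integral>\<^sup>+y. ennreal (norm (g y) powr (- 2 * c)) * indicator (\<phi> ` W) y \<partial>lborel)"
    using \<rho>(2) by (intro nn_integral_mono) (auto simp: indicator_def)
  then have "(\<integral>\<^sup>+y. ennreal (norm (g y) powr (- 2 * c)) * indicator (ball 0 \<rho>) y \<partial>lborel) < \<infinity>" using F by (rule le_less_trans)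
  then show ?thesis unfolding int_near_def using \<rho>(1) by (auto simp: set_integrable_iff_nn_integral)
qed

lemma int_near_germ_equivalent:
  assumes "c \<ge> 0" "g \<in> borel_measurable borel" "h \<in> borel_measurable borel" "germ_equivalent g h" "int_near c h"
  shows "int_near c g"
proof -
  obtain U V \<phi> u where *: "0 \<in> U" "biholomorphic2 \<phi> U V" "\<phi> 0 = 0" "holomorphic2_on u U" "\<forall>x\<in>U. u x \<noteq> 0 \<and> g (\<phi> x) = u x * h x"
    using assms(4) unfolding germ_equivalent_def by blast
  have "continuous_on V (the_inv_into U \<phi>)"
  proof -
    have "continuous_on V (fst \<circ> the_inv_into U \<phi>)" "continuous_on V (snd \<circ> the_inv_into U \<phi>)"
      using *(2) unfolding biholomorphic2_def by (blast intro: holomorphic2_continuous_on)+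
    from continuous_on_Pair[OF this] show ?thesis by simp
  qed
  then show ?thesis
    by (intro int_near_transfer[OF assms(1-3), where U = U and V = V and \<phi> = \<phi> and u = u])
       (use * assms(5) holomorphic2_continuous_on in \<open>auto simp: biholomorphic2_def bij_betw_def\<close>)
qed

text \<open>If \<open>r\<close> is the distance from \<open>x\<close> to the nearest root, then all other factors are bounded below by
  both \<open>r\<close> and half the distance between two roots; \<open>\<theta>\<close> distributes the exponent among these bounds.\<close>

lemma product_powr_bound:
  fixes a :: "nat \<Rightarrow> complex" and x :: complex
  assumes N: "N > 0" and sep: "\<And>i j. i < N \<Longrightarrow> j < N \<Longrightarrow> i \<noteq> j \<Longrightarrow> norm (a i - a j) \<ge> 2 * \<mu>" and \<mu>: "\<mu> > 0"
    and e: "c \<ge> 0" "\<theta> \<ge> 0" "2 * c * (real N - 1) \<ge> \<theta>" and nz: "\<And>i. i < N \<Longrightarrow> x \<noteq> a i"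
  shows "(\<Prod>i<N. norm (x - a i)) powr (- 2 * c) \<le> \<mu> powr (- (2 * c * (real N - 1) - \<theta>)) * (\<Sum>i<N. norm (x - a i) powr (- (2 * c + \<theta>)))"
proof -
  obtain i where i: "i < N" "\<And>j. j < N \<Longrightarrow> norm (x - a i) \<le> norm (x - a j)"
  proof -
    let ?S = "(\<lambda>i. norm (x - a i)) ` {..<N}"
    have S: "finite ?S" "?S \<noteq> {}" using N by auto
    obtain i where i: "i < N" "Min ?S = norm (x - a i)" using Min_in[OF S] by auto
    have "norm (x - a i) \<le> norm (x - a j)" if "j < N" for j
      using Min_le[OF S(1), of "norm (x - a j)"] that i by auto
    then show ?thesis using that i by blast
  qed
  define r where "r = norm (x - a i)"
  define M where "M = max r \<mu>"
  have r0: "r > 0" using nz[OF i(1)] by (simp add: r_def)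
  have M0: "M > 0" using r0 by (simp add: M_def)
  have far: "norm (x - a j) \<ge> M" if "j < N" "j \<noteq> i" for j
  proof -
    have "2 * \<mu> \<le> norm (a i - a j)" using sep[OF i(1) that(1)] that(2) by auto
    also have "\<dots> \<le> norm (x - a i) + norm (x - a j)" using norm_triangle_ineq4[of "x - a j" "x - a i"] by simp
    also have "\<dots> \<le> 2 * norm (x - a j)" using i(2)[OF that(1)] by simp
    finally show ?thesis using i(2)[OF that(1)] by (simp add: M_def r_def)
  qed
  have "r * M ^ (N - 1) \<le> r * (\<Prod>j\<in>{..<N} - {i}. norm (x - a j))"
  proof -
    have "(\<Prod>j\<in>{..<N} - {i}. M) \<le> (\<Prod>j\<in>{..<N} - {i}. norm (x - a j))"
      by (intro prod_mono) (use far M0 in auto)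
    then show ?thesis using i(1) r0 by simp
  qed
  also have "\<dots> = (\<Prod>i<N. norm (x - a i))"
    using i(1) by (subst prod.remove[of _ i]) (auto simp: r_def)
  finally have "(\<Prod>i<N. norm (x - a i)) powr (- 2 * c) \<le> (r * M ^ (N - 1)) powr (- 2 * c)"
    using e(1) r0 M0 by (intro powr_mono2') auto
  also have "\<dots> = r powr (- 2 * c) * M powr (- 2 * c * (real N - 1))"
  proof -
    have "M ^ (N - 1) = M powr (real N - 1)" using M0 N by (simp add: powr_realpow[symmetric] of_nat_diff)
    then show ?thesis using r0 M0 by (simp add: powr_mult powr_powr mult.commute)
  qed
  also have "M powr (- 2 * c * (real N - 1)) = M powr (- \<theta>) * M powr (- (2 * c * (real N - 1) - \<theta>))"
    by (simp add: powr_add[symmetric])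
  also have "\<dots> \<le> r powr (- \<theta>) * \<mu> powr (- (2 * c * (real N - 1) - \<theta>))"
    using e r0 \<mu> by (intro mult_mono powr_mono2') (auto simp: M_def)
  finally have "(\<Prod>i<N. norm (x - a i)) powr (- 2 * c) \<le> r powr (- 2 * c) * (r powr (- \<theta>) * \<mu> powr (- (2 * c * (real N - 1) - \<theta>)))"
    by (simp add: mult_left_mono)
  also have "\<dots> = \<mu> powr (- (2 * c * (real N - 1) - \<theta>)) * norm (x - a i) powr (- (2 * c + \<theta>))"
  proof -
    have "r powr (- 2 * c) * r powr (- \<theta>) = r powr (- 2 * c + - \<theta>)" by (rule powr_add[symmetric])
    also have "- 2 * c + - \<theta> = - (2 * c + \<theta>)" by simp
    finally show ?thesis unfolding r_def[symmetric] by (metis mult.assoc mult.commute)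
  qed
  also have "\<dots> \<le> \<mu> powr (- (2 * c * (real N - 1) - \<theta>)) * (\<Sum>i<N. norm (x - a i) powr (- (2 * c + \<theta>)))"
    using i(1) by (intro mult_left_mono member_le_sum) auto
  finally show ?thesis .
qed

text \<open>Integrate in \<open>x\<close> first. By \<open>product_powr_bound\<close> the inner
  integral is at most a constant times a power of |y|: it converges because
  \<open>2 * c + \<theta> < 2\<close>, and the separation of the roots by |y|^q determines the
  exponent \<rho>. The outer integral converges because \<rho> < 2.\<close>

lemma int_near_roots:
  fixes h :: "complex \<times> complex \<Rightarrow> complex" and a :: "nat \<Rightarrow> complex \<Rightarrow> complex"
  assumes hm [measurable]: "h \<in> borel_measurable borel"
    and h: "\<And>x y. h (x, y) = y ^ e * (\<Prod>i<N. x - a i y)" and N: "N > 0"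
    and sep: "\<And>y i j. i < N \<Longrightarrow> j < N \<Longrightarrow> i \<noteq> j \<Longrightarrow> norm (a i y - a j y) \<ge> norm y powr q"
    and c: "c \<ge> 0" "\<theta> \<ge> 0" "2 * c * (real N - 1) \<ge> \<theta>" "2 * c + \<theta> < 2"
    and \<rho>: "2 * c * real e + q * (2 * c * (real N - 1) - \<theta>) < 2" "q \<ge> 0"
  shows "int_near c h"
proof -
  define b where "b = 2 * c + \<theta>"
  define E where "E = 2 * c * (real N - 1) - \<theta>"
  define \<rho> where "\<rho> = 2 * c * real e + q * E"
  have b: "0 \<le> b" "b < 2" using c by (auto simp: b_def)
  have E: "E \<ge> 0" using c by (simp add: E_def)
  have \<rho>': "0 \<le> \<rho>" "\<rho> < 2" using \<rho> E c by (auto simp: \<rho>_def E_def[symmetric])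
  define K where "K = (1/2) powr (- E)"
  have K: "K \<ge> 0" by (simp add: K_def)
  define I where "I = (\<integral>\<^sup>+w. ennreal (norm (w::complex) powr (- b)) * indicator (ball 0 1) w \<partial>lborel)"
  define C where "C = I + emeasure lborel (ball (0::complex) 1)"
  have I: "I < \<infinity>" unfolding I_def using b by (intro nn_integral_norm_powr_ball) auto
  have C: "C < \<infinity>" using I emeasure_bounded_finite[OF bounded_ball, of "0::complex" 1] by (simp add: C_def)
  \<comment> \<open>A bound uniform in the position of the root: within distance 1 of
    \<open>z\<close> the integral is a translate of \<open>I\<close>, elsewhere the integrand is at
    most 1.\<close>
  have one: "(\<integral>\<^sup>+x. ennreal (norm (x - z) powr (- b)) * indicator (ball 0 1) x \<partial>lborel) \<le> C" for z :: complex
  proof -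
    have "ennreal (norm (x - z) powr (- b)) * indicator (ball 0 1) x \<le>
       ennreal (norm (x - z) powr (- b)) * indicator (ball 0 1) (x - z) + indicator (ball 0 1) x" for x
    proof (cases "norm (x - z) < 1")
      case False
      then have "norm (x - z) powr (- b) \<le> 1 powr (- b)" using b by (intro powr_mono2') auto
      then show ?thesis using False by (auto simp: indicator_def)
    qed (auto simp: indicator_def)
    then have "(\<integral>\<^sup>+x. ennreal (norm (x - z) powr (- b)) * indicator (ball 0 1) x \<partial>lborel) \<le>
      (\<integral>\<^sup>+x. ennreal (norm (x - z) powr (- b)) * indicator (ball 0 1) (x - z) + indicator (ball 0 1) x \<partial>lborel)"
      by (intro nn_integral_mono)
    also have "\<dots> = (\<integral>\<^sup>+x. ennreal (norm (x - z) powr (- b)) * indicator (ball 0 1) (x - z) \<partial>lborel) + emeasure lborel (ball (0::complex) 1)"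
    proof -
      have [measurable]: "(\<lambda>x. indicator (ball 0 1) (x - z) :: ennreal) \<in> borel_measurable borel"
        by (rule measurable_compose[OF _ borel_measurable_indicator[of "ball 0 1" borel]]) auto
      have "(\<lambda>x. ennreal (norm (x - z) powr (- b)) * indicator (ball 0 1) (x - z)) \<in> borel_measurable borel"
        by measurable
      moreover have "(indicator (ball 0 1) :: complex \<Rightarrow> ennreal) \<in> borel_measurable borel"
        by (rule borel_measurable_indicator) simp
      ultimately show ?thesis by (subst nn_integral_add) auto
    qed
    also have "(\<integral>\<^sup>+x. ennreal (norm (x - z) powr (- b)) * indicator (ball 0 1) (x - z) \<partial>lborel) = I"
    proof -
      have "(\<lambda>w::complex. ennreal (norm w powr (- b)) * indicator (ball 0 1) w) \<in> borel_measurable borel"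
        by (rule borel_measurable_powr_indicator) auto
      from lborel_nn_integral_affine[OF this, of 1 "-z"] show ?thesis by (simp add: I_def)
    qed
    finally show ?thesis by (simp add: C_def)
  qed
  have pt: "ennreal (norm (h (x, y)) powr (- 2 * c)) \<le> ennreal (K * norm y powr (- \<rho>)) * (\<Sum>i<N. ennreal (norm (x - a i y) powr (- b)))"
    if y: "y \<noteq> 0" for x y
  \<comment> \<open>At a zero of \<open>h\<close> the left-hand side is 0 since
    \<open>0 powr a = 0\<close>; elsewhere \<open>x\<close> is none of the roots.\<close>
  proof (cases "h (x, y) = 0")
    case False
    then have nz: "x \<noteq> a i y" if "i < N" for i using that by (auto simp: h)
    define \<mu> where "\<mu> = norm y powr q / 2"
    have \<mu>: "\<mu> > 0" using y by (simp add: \<mu>_def)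
    have "norm (h (x, y)) powr (- 2 * c) = norm y powr (- (2 * c * real e)) * (\<Prod>i<N. norm (x - a i y)) powr (- 2 * c)"
      using y by (simp add: h norm_mult norm_power prod_norm[symmetric] powr_mult powr_realpow[symmetric] powr_powr mult.commute)
    also have "\<dots> \<le> norm y powr (- (2 * c * real e)) * (\<mu> powr (- E) * (\<Sum>i<N. norm (x - a i y) powr (- b)))"
      unfolding E_def b_def
      by (intro mult_left_mono product_powr_bound N \<mu> c nz) (use sep in \<open>auto simp: \<mu>_def\<close>)
    also have "norm y powr (- (2 * c * real e)) * (\<mu> powr (- E) * (\<Sum>i<N. norm (x - a i y) powr (- b)))
      = K * norm y powr (- \<rho>) * (\<Sum>i<N. norm (x - a i y) powr (- b))"
    proof -
      have "\<mu> powr (- E) = norm y powr (- (q * E)) * K"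
      proof -
        have "\<mu> = norm y powr q * (1/2)" by (simp add: \<mu>_def)
        then show ?thesis by (simp only: powr_mult K_def powr_powr) simp
      qed
      moreover have "norm y powr (- \<rho>) = norm y powr (- (2 * c * real e)) * norm y powr (- (q * E))"
        by (simp add: \<rho>_def powr_add[symmetric])
      ultimately show ?thesis by (simp only: mult_ac)
    qed
    finally have "ennreal (norm (h (x, y)) powr (- 2 * c)) \<le> ennreal (K * norm y powr (- \<rho>) * (\<Sum>i<N. norm (x - a i y) powr (- b)))"
      by (rule ennreal_leI)
    also have "\<dots> = ennreal (K * norm y powr (- \<rho>)) * (\<Sum>i<N. ennreal (norm (x - a i y) powr (- b)))"
      using K by (simp add: ennreal_mult sum_nonneg sum_ennreal)
    finally show ?thesis .
  qed simp
  have inner: "(\<integral>\<^sup>+x. ennreal (norm (h (x, y)) powr (- 2 * c)) * indicator (ball 0 1) x \<partial>lborel) \<le> ennreal (K * norm y powr (- \<rho>)) * (of_nat N * C)"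
    if y: "y \<noteq> 0" for y
  proof -
    have m: "(\<lambda>x. ennreal (norm (x - z) powr (- b)) * indicator (ball 0 1) x) \<in> borel_measurable lborel" for z :: complex
      using borel_measurable_powr_indicator[of "\<lambda>x. x - z" "ball 0 1" "- b"] by simp
    have "(\<integral>\<^sup>+x. ennreal (norm (h (x, y)) powr (- 2 * c)) * indicator (ball 0 1) x \<partial>lborel) \<le>
      (\<integral>\<^sup>+x. ennreal (K * norm y powr (- \<rho>)) * (\<Sum>i<N. ennreal (norm (x - a i y) powr (- b)) * indicator (ball 0 1) x) \<partial>lborel)"
      using pt[OF y] by (intro nn_integral_mono) (auto simp: indicator_def)
    also have "\<dots> = ennreal (K * norm y powr (- \<rho>)) * (\<Sum>i<N. \<integral>\<^sup>+x. ennreal (norm (x - a i y) powr (- b)) * indicator (ball 0 1) x \<partial>lborel)"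
      by (subst nn_integral_cmult, intro borel_measurable_sum m, subst nn_integral_sum, rule m, rule refl)
    also have "\<dots> \<le> ennreal (K * norm y powr (- \<rho>)) * (\<Sum>i<N. C)"
      by (intro mult_left_mono sum_mono one) auto
    finally show ?thesis by simp
  qed
  have mh: "(\<lambda>z. ennreal (norm (h z) powr (- 2 * c)) * (indicator (ball 0 1) (fst z) * indicator (ball 0 1) (snd z))) \<in> borel_measurable (lborel \<Otimes>\<^sub>M lborel)"
  proof -
    have "(\<lambda>z. indicator (ball 0 1) (fst z) :: ennreal) \<in> borel_measurable (borel :: (complex \<times> complex) measure)"
      by (rule measurable_compose[OF _ borel_measurable_indicator[of "ball 0 1" borel]]) (auto intro: borel_measurable_continuous_onI[OF continuous_on_fst[OF continuous_on_id]])
    moreover have "(\<lambda>z. indicator (ball 0 1) (snd z) :: ennreal) \<in> borel_measurable (borel :: (complex \<times> complex) measure)"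
      by (rule measurable_compose[OF _ borel_measurable_indicator[of "ball 0 1" borel]]) (auto intro: borel_measurable_continuous_onI[OF continuous_on_snd[OF continuous_on_id]])
    ultimately show ?thesis by (simp add: lborel_prod)
  qed
  have ae: "AE y in lborel. y \<noteq> (0::complex)" using AE_lborel_singleton[of "0::complex"] .
  have "(\<integral>\<^sup>+z. ennreal (norm (h z) powr (- 2 * c)) * indicator (ball 0 1) z \<partial>lborel)
    \<le> (\<integral>\<^sup>+z. ennreal (norm (h z) powr (- 2 * c)) * (indicator (ball 0 1) (fst z) * indicator (ball 0 1) (snd z)) \<partial>lborel)"
  proof (intro nn_integral_mono)
    fix z :: "complex \<times> complex"
    have "norm (fst z) \<le> norm z" "norm (snd z) \<le> norm z" by (simp_all add: norm_prod_def real_le_rsqrt)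
    then show "ennreal (norm (h z) powr (- 2 * c)) * indicator (ball 0 1) z \<le> ennreal (norm (h z) powr (- 2 * c)) * (indicator (ball 0 1) (fst z) * indicator (ball 0 1) (snd z))"
      by (auto simp: indicator_def)
  qed
  also have "\<dots> = (\<integral>\<^sup>+y. \<integral>\<^sup>+x. ennreal (norm (h (x, y)) powr (- 2 * c)) * (indicator (ball 0 1) x * indicator (ball 0 1) y) \<partial>lborel \<partial>lborel)"
    using lborel_pair.nn_integral_snd[OF mh] by (simp add: lborel_prod)
  also have "\<dots> \<le> (\<integral>\<^sup>+y. ennreal (norm (y::complex) powr (- \<rho>)) * indicator (ball 0 1) y * (ennreal K * (of_nat N * C)) \<partial>lborel)"
  proof (rule nn_integral_mono_AE)
    show "AE y in lborel. (\<integral>\<^sup>+x. ennreal (norm (h (x, y)) powr (- 2 * c)) * (indicator (ball 0 1) x * indicator (ball 0 1) y) \<partial>lborel)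
      \<le> ennreal (norm y powr (- \<rho>)) * indicator (ball 0 1) y * (ennreal K * (of_nat N * C))"
      using ae
    proof eventually_elim
    case (elim y)
    show ?case
    proof (cases "y \<in> ball 0 1")
      case True
      have "(\<integral>\<^sup>+x. ennreal (norm (h (x, y)) powr (- 2 * c)) * (indicator (ball 0 1) x * indicator (ball 0 1) y) \<partial>lborel)
         = (\<integral>\<^sup>+x. ennreal (norm (h (x, y)) powr (- 2 * c)) * indicator (ball 0 1) x \<partial>lborel)"
        using True by simp
      also have "\<dots> \<le> ennreal (K * norm y powr (- \<rho>)) * (of_nat N * C)" by (rule inner[OF elim])
      also have "\<dots> = ennreal (norm y powr (- \<rho>)) * (ennreal K * (of_nat N * C))" using K by (simp add: ennreal_mult mult_ac)
      finally show ?thesis using True by simp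
    qed simp
    qed
  qed
  also have "\<dots> = (\<integral>\<^sup>+y. ennreal (norm (y::complex) powr (- \<rho>)) * indicator (ball 0 1) y \<partial>lborel) * (ennreal K * (of_nat N * C))"
    by (rule nn_integral_multc) (simp add: borel_measurable_powr_indicator)
  also have "\<dots> < \<infinity>"
  proof -
    have "(\<integral>\<^sup>+y. ennreal (norm (y::complex) powr (- \<rho>)) * indicator (ball 0 1) y \<partial>lborel) < \<infinity>"
      using \<rho>' by (intro nn_integral_norm_powr_ball) auto
    then show ?thesis using C by (simp add: ennreal_mult_less_top of_nat_less_top)
  qed
  finally show ?thesis
    unfolding int_near_def by (intro exI[of _ 1]) (simp add: set_integrable_iff_nn_integral)
qed

section \<open>The normal forms A, D, E\<close>

lemma simple_normal_form_measurable:
  assumes "simple_normal_form h" shows "h \<in> borel_measurable borel"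
proof -
  have "continuous_on UNIV h"
    using assms by cases (auto simp: case_prod_unfold intro!: continuous_intros)
  then show ?thesis by (rule borel_measurable_continuous_onI)
qed

lemma sqrt_norm_power: "sqrt (norm (y::complex) ^ n) = norm y powr (real n / 2)" if "n > 0"
proof (cases "y = 0")
  case False
  then show ?thesis by (simp add: powr_half_sqrt[symmetric] powr_realpow[symmetric] powr_powr)
qed (use that in auto)

text \<open>The two roots in \<open>x\<close> are at distance 2 |y|^(n/2). With c = 1/2 + \<epsilon>
  the choice \<theta> = 1 - 3 \<epsilon> makes \<open>2 * c + \<theta>\<close> equal to 2 -
  \<epsilon> and leaves the exponent 5 \<epsilon> for the separation.\<close>

lemma int_near_square_roots:
  assumes hm: "h \<in> borel_measurable borel" and h: "\<And>x y. h (x, y) = y ^ e * (x ^ 2 + y ^ n)"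
    and n: "n > 0" and eps: "0 < \<epsilon>" "\<epsilon> \<le> 1/3" and \<rho>: "(1 + 2 * \<epsilon>) * real e + real n / 2 * (5 * \<epsilon>) < 2"
  shows "int_near (1/2 + \<epsilon>) h"
proof -
  define a where "a i y = (if i = (0::nat) then csqrt (- (y ^ n)) else - csqrt (- (y ^ n)))" for i y
  have norm_b: "norm (csqrt (- (y ^ n))) = norm y powr (real n / 2)" for y :: complex
    using n by (simp add: norm_csqrt norm_power sqrt_norm_power)
  show ?thesis
  proof (rule int_near_roots[OF hm, where N = 2 and a = a and e = e and q = "real n / 2" and \<theta> = "1 - 3 * \<epsilon>"])
    show "h (x, y) = y ^ e * (\<Prod>i<2. x - a i y)" for x y
    proof -
      have "(x - csqrt (- (y ^ n))) * (x + csqrt (- (y ^ n))) = x ^ 2 - (csqrt (- (y ^ n))) ^ 2"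
        by (simp add: algebra_simps power2_eq_square)
      also have "\<dots> = x ^ 2 + y ^ n" by simp
      finally show ?thesis by (simp add: h a_def numeral_2_eq_2)
    qed
    show "norm y powr (real n / 2) \<le> norm (a i y - a j y)" if "i < 2" "j < 2" "i \<noteq> j" for y i j
    proof -
      have "norm (a i y - a j y) = 2 * norm (csqrt (- (y ^ n)))"
      proof -
        have "a i y - a j y = 2 * csqrt (- (y ^ n)) \<or> a i y - a j y = - (2 * csqrt (- (y ^ n)))"
          using that by (auto simp: a_def)
        then show ?thesis by (auto simp: norm_mult)
      qed
      then show ?thesis using norm_b by simp
    qed
  qed (use eps \<rho> in \<open>auto simp: algebra_simps\<close>)
qed

text \<open>For E6, E7, E8 the separation exponents are 4/3, 3/2, 5/3. With c = 1/2 + \<epsilon> and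
  \<theta> = 1 - 3 \<epsilon> the separation is raised to the power 1 + 7 \<epsilon>, and 5/3 times
  this stays below 2 for \<epsilon> < 1/35; the value 1/50 is a convenient one.\<close>

lemma int_near_cubic_roots:
  fixes a :: "nat \<Rightarrow> complex \<Rightarrow> complex"
  assumes hm: "h \<in> borel_measurable borel" and h: "\<And>x y. h (x, y) = (\<Prod>i<3. x - a i y)"
    and sep: "\<And>y i j. i < 3 \<Longrightarrow> j < 3 \<Longrightarrow> i \<noteq> j \<Longrightarrow> norm (a i y - a j y) \<ge> norm y powr q" and q: "0 \<le> q" "q \<le> 5/3"
  shows "int_near (1/2 + 1/50) h"
proof (rule int_near_roots[OF hm, where N = 3 and a = a and e = 0 and q = q and \<theta> = "1 - 3/50"])
  show "h (x, y) = y ^ 0 * (\<Prod>i<3. x - a i y)" for x y by (simp add: h)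
  have "q * (57/50) \<le> 5/3 * (57/50)" using q by (intro mult_right_mono) auto
  then show "2 * (1/2 + 1/50) * real 0 + q * (2 * (1/2 + 1/50) * (real 3 - 1) - (1 - 3/50)) < 2" by simp
qed (use sep q in auto)

lemma int_near_cube:
  assumes hm: "h \<in> borel_measurable borel" and h: "\<And>x y. h (x, y) = x ^ 3 + y ^ n" and n: "n > 0" "n \<le> 5"
  shows "int_near (1/2 + 1/50) h"
proof -
  define \<omega> where "\<omega> = Complex (- 1 / 2) (sqrt 3 / 2)"
  have w: "\<omega> + cnj \<omega> = - 1" "\<omega> * cnj \<omega> = 1"
    by (simp_all add: \<omega>_def complex_eq_iff)
  have d: "norm (1 - \<omega>) \<ge> 1" "norm (1 - cnj \<omega>) \<ge> 1" "norm (\<omega> - cnj \<omega>) \<ge> 1"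
    by (simp_all add: \<omega>_def cmod_def power2_eq_square real_le_rsqrt)
  have "\<exists>b. b ^ 3 = - (y ^ n)" for y :: complex
    by (metis exists_complex_root zero_neq_numeral)
  note root = this
  \<comment> \<open>Any choice of a cube root will do, as only the distances between the roots
    enter. They are |y|^(n/3) times distances between cube roots of unity, which are at least
    1.\<close>
  define \<beta> where "\<beta> y = (SOME b. b ^ 3 = - (y ^ n))" for y :: complex
  have \<beta>: "\<beta> y ^ 3 = - (y ^ n)" for y unfolding \<beta>_def by (rule someI_ex[OF root])
  have norm_\<beta>: "norm (\<beta> y) = norm y powr (real n / 3)" for y
  proof (cases "y = 0")
    case True
    then have "\<beta> y ^ 3 = 0" using \<beta>[of y] n by simp
    then show ?thesis using True by simp
  next
    case False
    have "norm (\<beta> y) ^ 3 = norm y ^ n" using arg_cong[OF \<beta>[of y], of norm] by (simp add: norm_power)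
    also have "\<dots> = (norm y powr (real n / 3)) ^ 3"
      using False by (simp add: powr_realpow[symmetric] powr_powr powr_power)
    finally show ?thesis by (rule power_eq_imp_eq_base) auto
  qed
  define a where "a i y = (if i = (0::nat) then 1 else if i = 1 then \<omega> else cnj \<omega>) * \<beta> y" for i y
  show ?thesis
  proof (rule int_near_cubic_roots[OF hm, where a = a and q = "real n / 3"])
    show "h (x, y) = (\<Prod>i<3. x - a i y)" for x y
    proof -
      have "(x - \<beta> y) * (x - \<omega> * \<beta> y) * (x - cnj \<omega> * \<beta> y) = x ^ 3 - \<beta> y ^ 3"
        using w by algebra
      also have "\<dots> = h (x, y)" by (simp add: \<beta> h)
      finally have "h (x, y) = (x - \<beta> y) * (x - \<omega> * \<beta> y) * (x - cnj \<omega> * \<beta> y)" ..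
      moreover have "(\<Prod>i<3. x - a i y) = (x - \<beta> y) * (x - \<omega> * \<beta> y) * (x - cnj \<omega> * \<beta> y)"
        by (simp add: a_def numeral_3_eq_3 lessThan_Suc mult_ac)
      ultimately show ?thesis by simp
    qed
    show "norm y powr (real n / 3) \<le> norm (a i y - a j y)" if "i < 3" "j < 3" "i \<noteq> j" for y i j
    proof -
      define c where "c i = (if i = (0::nat) then 1 else if i = 1 then \<omega> else cnj \<omega>)" for i
      have "norm (c i - c j) \<ge> 1"
        using that d by (auto simp: c_def norm_minus_commute less_Suc_eq numeral_3_eq_3)
      then have "1 * norm (\<beta> y) \<le> norm (c i - c j) * norm (\<beta> y)" by (rule mult_right_mono) simp
      also have "\<dots> = norm (a i y - a j y)" by (simp add: a_def c_def norm_mult[symmetric] left_diff_distrib)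
      finally show ?thesis by (simp add: norm_\<beta>)
    qed
  qed (use n in auto)
qed

lemma int_near_E7: "int_near (1/2 + 1/50) (\<lambda>(x, y). x ^ 3 + x * y ^ 3)"
proof -
  define a where "a i y = (if i = (0::nat) then 0 else if i = 1 then csqrt (- (y ^ 3)) else - csqrt (- (y ^ 3)))" for i and y :: complex
  have norm_b: "norm (csqrt (- (y ^ 3))) = norm y powr (3 / 2)" for y :: complex
    using sqrt_norm_power[of 3 y] by (simp add: norm_csqrt norm_power)
  show ?thesis
  proof (rule int_near_cubic_roots[where a = a and q = "3 / 2"])
    show "(\<lambda>(x, y). x ^ 3 + x * y ^ 3) \<in> borel_measurable (borel :: (complex \<times> complex) measure)"
      by (rule simple_normal_form_measurable[OF E7])
    show "(case (x, y) of (x, y) \<Rightarrow> x ^ 3 + x * y ^ 3) = (\<Prod>i<3. x - a i y)" for x y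
    proof -
      have "x * (x - csqrt (- (y ^ 3))) * (x + csqrt (- (y ^ 3))) = x * (x ^ 2 - (csqrt (- (y ^ 3))) ^ 2)"
        by (simp add: algebra_simps power2_eq_square)
      also have "\<dots> = x * (x ^ 2 - - (y ^ 3))" by (simp only: power2_csqrt)
      also have "\<dots> = x ^ 3 + x * y ^ 3" by (simp add: algebra_simps power2_eq_square power3_eq_cube)
      finally show ?thesis by (simp add: a_def eval_nat_numeral lessThan_Suc mult_ac)
    qed
    show "norm y powr (3 / 2) \<le> norm (a i y - a j y)" if "i < 3" "j < 3" "i \<noteq> j" for y i j
    proof -
      let ?b = "csqrt (- (y ^ 3))"
      have "i \<in> {0, 1, 2}" "j \<in> {0, 1, 2}" using that by auto
      then have "a i y - a j y \<in> {?b, - ?b, ?b + ?b, - (?b + ?b)}"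
        using that(3) by (auto simp: a_def)
      moreover have "norm v \<ge> norm b" if "v \<in> {b, - b, b + b, - (b + b)}" for v b :: complex
      proof -
        have "norm (b + b) = 2 * norm b" by (simp add: norm_mult flip: mult_2)
        moreover have "norm v = norm b \<or> norm v = norm (b + b)"
          using that by (auto simp only: insert_iff empty_iff norm_minus_cancel)
        ultimately show ?thesis by auto
      qed
      ultimately have "norm (a i y - a j y) \<ge> norm ?b" by blast
      then show ?thesis using norm_b by simp
    qed
  qed auto
qed

lemma int_near_simple_normal_form:
  assumes "simple_normal_form h" shows "\<exists>c>1/2. int_near c h"
proof -
  note hm = simple_normal_form_measurable[OF assms]
  show ?thesis using assms
  proof cases
    case (A k)
    \<comment> \<open>Chosen so that the separation term (k + 1)/2 * 5 \<epsilon> equals 1/2 for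
      every \<open>k\<close>.\<close>
    define \<epsilon> where "\<epsilon> = 1 / (5 * (real k + 1))"
    have "int_near (1/2 + \<epsilon>) h"
    proof (rule int_near_square_roots[OF hm, where e = 0 and n = "k + 1"])
      show "(1 + 2 * \<epsilon>) * real 0 + real (k + 1) / 2 * (5 * \<epsilon>) < 2" by (simp add: \<epsilon>_def field_simps)
    qed (use A in \<open>auto simp: \<epsilon>_def field_simps\<close>)
    moreover have "\<epsilon> > 0" by (simp add: \<epsilon>_def)
    ultimately show ?thesis by (intro exI[of _ "1/2 + \<epsilon>"]) auto
  next
    case (D k)
    \<comment> \<open>The factor \<open>y\<close> of the normal form costs 1 + 2 \<epsilon> and the
      separation at most 1/2, which together remain below 2.\<close>
    define \<epsilon> where "\<epsilon> = 1 / (5 * (real k + 1))"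
    have e1: "\<epsilon> > 0" "\<epsilon> \<le> 1/3" using D by (auto simp: \<epsilon>_def field_simps)
    have "int_near (1/2 + \<epsilon>) h"
    proof (rule int_near_square_roots[OF hm, where e = 1 and n = "k - 2"])
      show "h (x, y) = y ^ 1 * (x ^ 2 + y ^ (k - 2))" for x y
      proof -
        have "k - 1 = Suc (k - 2)" using D by simp
        then show ?thesis using D(1) by (simp add: algebra_simps)
      qed
      have "real (k - 2) / 2 * (5 * \<epsilon>) \<le> (real k + 1) / 2 * (5 * \<epsilon>)"
        using e1 by (intro mult_right_mono) auto
      also have "\<dots> = 1 / 2" by (simp add: \<epsilon>_def field_simps)
      finally have 1: "real (k - 2) / 2 * (5 * \<epsilon>) \<le> 1 / 2" .
      have "\<epsilon> \<le> 1 / 5" by (simp add: \<epsilon>_def field_simps)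
      moreover have "(1 + 2 * \<epsilon>) * real 1 = 1 + 2 * \<epsilon>" by simp
      ultimately show "(1 + 2 * \<epsilon>) * real 1 + real (k - 2) / 2 * (5 * \<epsilon>) < 2" using 1 by linarith
    qed (use D e1 in auto)
    then show ?thesis using e1 by (intro exI[of _ "1/2 + \<epsilon>"]) auto
  next
    case E6
    have "int_near (1/2 + 1/50) h" by (rule int_near_cube[OF hm, of 4]) (auto simp: E6)
    then show ?thesis by (intro exI[of _ "1/2 + 1/50"]) auto
  next
    case E7
    then show ?thesis using int_near_E7 by (intro exI[of _ "1/2 + 1/50"]) auto
  next
    case E8
    have "int_near (1/2 + 1/50) h" by (rule int_near_cube[OF hm, of 5]) (auto simp: E8)
    then show ?thesis by (intro exI[of _ "1/2 + 1/50"]) auto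
  qed
qed

lemma simple_normal_form_isolated:
  assumes "simple_normal_form h" "(h has_derivative (\<lambda>_. 0)) (at x)" shows "x = 0"
proof -
  obtain a b where x: "x = (a, b)" by force
  have F: "((\<lambda>x. h (x, b)) has_field_derivative 0) (at a)"
  proof -
    have "((\<lambda>x. (x, b)) has_derivative (\<lambda>v. (v, 0))) (at a)" by (intro derivative_intros)
    from has_derivative_compose[OF this, of h "\<lambda>_. 0"] assms(2) x
    show ?thesis by (simp add: has_field_derivative_def lambda_zero)
  qed
  have S: "((\<lambda>y. h (a, y)) has_field_derivative 0) (at b)"
  proof -
    have "((\<lambda>y. (a, y)) has_derivative (\<lambda>v. (0, v))) (at b)" by (intro derivative_intros)
    from has_derivative_compose[OF this, of h "\<lambda>_. 0"] assms(2) x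
    show ?thesis by (simp add: has_field_derivative_def lambda_zero)
  qed
  from assms(1) have "a = 0 \<and> b = 0"
  proof cases
    case (A k)
    have "((\<lambda>x. h (x, b)) has_field_derivative (2 * a)) (at a)"
      unfolding A by (auto intro!: derivative_eq_intros)
    moreover have "((\<lambda>y. h (a, y)) has_field_derivative (of_nat (k + 1) * b ^ k)) (at b)"
      unfolding A prod.case Suc_eq_plus1[symmetric]
      by (rule DERIV_cong[OF DERIV_add[OF DERIV_const DERIV_power_Suc[OF DERIV_ident]]]) simp
    ultimately show ?thesis using F S DERIV_unique A(2) by (fastforce simp del: of_nat_Suc of_nat_add)
  next
    case (D k)
    have 1: "((\<lambda>x. h (x, b)) has_field_derivative (2 * a * b)) (at a)"
      unfolding D by (auto intro!: derivative_eq_intros)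
    have 2: "((\<lambda>y. h (a, y)) has_field_derivative (a\<^sup>2 + of_nat (k - 1) * b ^ (k - 2))) (at b)"
      unfolding D by (auto intro!: derivative_eq_intros simp: numeral_2_eq_2)
    have e: "2 * a * b = 0" "a\<^sup>2 + of_nat (k - 1) * b ^ (k - 2) = 0"
      using DERIV_unique[OF 1 F] DERIV_unique[OF 2 S] by auto
    have k: "k - 2 > 0" "of_nat (k - 1) \<noteq> (0::complex)" using D(2) by auto
    show ?thesis
    proof (cases "b = 0")
      case True
      then show ?thesis using e k by (simp add: power_0_left)
    next
      case False
      then have "a = 0" using e by simp
      then show ?thesis using e k False by (simp del: of_nat_diff)
    qed
  next
    case E6
    have 1: "((\<lambda>x. h (x, b)) has_field_derivative (3 * a ^ 2)) (at a)"
      unfolding E6 by (auto intro!: derivative_eq_intros)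
    have 2: "((\<lambda>y. h (a, y)) has_field_derivative (4 * b ^ 3)) (at b)"
      unfolding E6 by (auto intro!: derivative_eq_intros)
    show ?thesis using DERIV_unique[OF 1 F] DERIV_unique[OF 2 S] by simp
  next
    case E7
    have 1: "((\<lambda>x. h (x, b)) has_field_derivative (3 * a ^ 2 + b ^ 3)) (at a)"
      unfolding E7 by (auto intro!: derivative_eq_intros)
    have 2: "((\<lambda>y. h (a, y)) has_field_derivative (a * (3 * b ^ 2))) (at b)"
      unfolding E7 by (auto intro!: derivative_eq_intros)
    show ?thesis using DERIV_unique[OF 1 F] DERIV_unique[OF 2 S] by auto
  next
    case E8
    have 1: "((\<lambda>x. h (x, b)) has_field_derivative (3 * a ^ 2)) (at a)"
      unfolding E8 by (auto intro!: derivative_eq_intros)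
    have 2: "((\<lambda>y. h (a, y)) has_field_derivative (5 * b ^ 4)) (at b)"
      unfolding E8 by (auto intro!: derivative_eq_intros)
    show ?thesis using DERIV_unique[OF 1 F] DERIV_unique[OF 2 S] by simp
  qed
  then show ?thesis by (simp add: x zero_prod_def)
qed

text \<open>Coordinate changes and units preserve the condition that function and derivative both
  vanish, and a normal form has the origin as its only critical point.\<close>

lemma germ_isolated:
  assumes germ: "germ_equivalent g h" and h: "simple_normal_form h"
  shows "\<exists>V. open V \<and> 0 \<in> V \<and> (\<forall>y\<in>V. g y = 0 \<longrightarrow> (g has_derivative (\<lambda>_. 0)) (at y) \<longrightarrow> y = 0)"
proof -
  obtain U V \<phi> u where *: "0 \<in> U" "biholomorphic2 \<phi> U V" "\<phi> 0 = 0" "holomorphic2_on u U" "\<forall>x\<in>U. u x \<noteq> 0 \<and> g (\<phi> x) = u x * h x"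
    using germ unfolding germ_equivalent_def by blast
  have UV: "open U" "open V" "\<phi> ` U = V" "holomorphic2_on (fst \<circ> \<phi>) U" "holomorphic2_on (snd \<circ> \<phi>) U"
    using *(2) by (auto simp: biholomorphic2_def bij_betw_def)
  have "y = 0" if y: "y \<in> V" "g y = 0" "(g has_derivative (\<lambda>_. 0)) (at y)" for y
  proof -
    obtain x where x: "x \<in> U" "y = \<phi> x" using y(1) UV(3) by blast
    obtain a1 b1 a2 b2 where d: "((fst \<circ> \<phi>) has_derivative (\<lambda>(h, k). a1 * h + b1 * k)) (at x)"
      "((snd \<circ> \<phi>) has_derivative (\<lambda>(h, k). a2 * h + b2 * k)) (at x)"
      using UV(4,5) x(1) unfolding holomorphic2_on_def by meson
    from has_derivative_Pair[OF d]
    have d\<phi>: "(\<phi> has_derivative (\<lambda>v. ((\<lambda>(h, k). a1 * h + b1 * k) v, (\<lambda>(h, k). a2 * h + b2 * k) v))) (at x)" by simp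
    have 1: "((\<lambda>x. g (\<phi> x)) has_derivative (\<lambda>_. 0)) (at x)"
      using has_derivative_compose[OF d\<phi>, of g "\<lambda>_. 0"] y(3) x(2) by simp
    obtain a b where du: "(u has_derivative (\<lambda>(h, k). a * h + b * k)) (at x)"
      using *(4) x(1) unfolding holomorphic2_on_def by blast
    have ux: "u x \<noteq> 0" using * x by blast
    have hx: "h x = 0" using *(5) x y(2) by force
    \<comment> \<open>Dividing by the unit adds a term with its derivative, but this is multiplied
      by the value of \<open>g\<close>, which is 0 at the point.\<close>
    have "((\<lambda>x. inverse (u x) * g (\<phi> x)) has_derivative (\<lambda>_. 0)) (at x)"
    proof -
      have "((\<lambda>x. inverse (u x) * g (\<phi> x)) has_derivative (\<lambda>v. inverse (u x) * 0 + - (inverse (u x) * (\<lambda>(h, k). a * h + b * k) v * inverse (u x)) * g (\<phi> x))) (at x)"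
        by (intro has_derivative_mult Deriv.has_derivative_inverse ux du 1)
      then show ?thesis using y(2) x(2) by simp
    qed
    then have "(h has_derivative (\<lambda>_. 0)) (at x)"
    proof (rule has_derivative_transform_within_open[OF _ UV(1) x(1)])
      fix z assume "z \<in> U"
      then show "inverse (u z) * g (\<phi> z) = h z" using *(5) by simp
    qed
    then have "x = 0" by (rule simple_normal_form_isolated[OF h])
    then show "y = 0" using x *(3) by simp
  qed
  moreover have "0 \<in> V" using *(1,3) UV(3) by force
  ultimately show ?thesis using UV(2) by blast
qed


section \<open>Singular points and affine charts\<close>

definition chart :: "complex^3 \<Rightarrow> 3" where
  "chart p = (if p $ 1 \<noteq> 0 then 1 else if p $ 2 \<noteq> 0 then 2 else 3)"

definition chart_incl :: "3 \<Rightarrow> complex \<times> complex \<Rightarrow> complex^3" where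
  "chart_incl j z = (if j = 1 then vector [0, fst z, snd z] else if j = 2 then vector [fst z, 0, snd z] else vector [fst z, snd z, 0])"

definition chart_proj :: "3 \<Rightarrow> complex^3 \<Rightarrow> complex \<times> complex" where
  "chart_proj j v = (if j = 1 then (v $ 2, v $ 3) else if j = 2 then (v $ 1, v $ 3) else (v $ 1, v $ 2))"

text \<open>Complex scalar multiplication on pairs, whose vector space structure is the real
  one.\<close>

definition pscale :: "complex \<Rightarrow> complex \<times> complex \<Rightarrow> complex \<times> complex" where
  "pscale c z = (c * fst z, c * snd z)"

lemma local_equation_chart: "local_equation f p z = eval f (p + chart_incl (chart p) z)"
  by (cases z) (simp add: local_equation_def chart_def chart_incl_def)

lemma chart_nonzero: "p \<noteq> 0 \<Longrightarrow> p $ chart p \<noteq> 0"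
  by (auto simp: chart_def vec_eq_iff forall_3)

lemma chart_smult: "c \<noteq> 0 \<Longrightarrow> chart (c *s p) = chart p"
  by (simp add: chart_def)

lemma chart_incl_proj: "chart_incl j (chart_proj j v) = v - (v $ j) *s axis j 1"
  using exhaust_3[of j] by (auto simp: chart_incl_def chart_proj_def vec_eq_iff forall_3 axis_def)

lemma bounded_linear_chart_incl: "bounded_linear (chart_incl j)"
  by (simp add: linear_conv_bounded_linear[symmetric])
     (auto intro!: linearI simp: chart_incl_def vec_eq_iff forall_3 scaleR_conv_of_real[where 'a = complex])

lemma bounded_linear_chart_proj: "bounded_linear (chart_proj j)"
  by (simp add: linear_conv_bounded_linear[symmetric])
     (auto intro!: linearI simp: chart_proj_def)

lemma norm_chart_incl [simp]: "norm (chart_incl j z) = norm z"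
  using exhaust_3[of j] by (auto simp: chart_incl_def norm_vec_def L2_set_def sum_3 norm_prod_def)

lemma chart_incl_pscale: "chart_incl j (pscale c z) = c *s chart_incl j z"
  by (auto simp: chart_incl_def pscale_def vec_eq_iff forall_3)

lemma bounded_linear_pscale: "bounded_linear (pscale c)"
  by (simp add: linear_conv_bounded_linear[symmetric])
     (auto intro!: linearI simp: pscale_def algebra_simps)

lemma norm_pscale [simp]: "norm (pscale c z) = norm c * norm z"
proof -
  have "(norm c)\<^sup>2 * (norm (fst z))\<^sup>2 + (norm c)\<^sup>2 * (norm (snd z))\<^sup>2 = (norm c)\<^sup>2 * ((norm (fst z))\<^sup>2 + (norm (snd z))\<^sup>2)"
    by (simp add: algebra_simps)
  then show ?thesis
    by (simp add: pscale_def norm_prod_def norm_mult power_mult_distrib real_sqrt_mult)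
qed

lemma pscale_pscale: "pscale a (pscale b z) = pscale (a * b) z" "pscale 1 z = z"
  by (simp_all add: pscale_def mult.assoc)

lemma continuous_pscale [continuous_intros]:
  "continuous_on S a \<Longrightarrow> continuous_on S g \<Longrightarrow> continuous_on S (\<lambda>x. pscale (a x) (g x))"
  unfolding pscale_def by (intro continuous_intros)

lemma continuous_chart [continuous_intros]:
  "continuous_on S g \<Longrightarrow> continuous_on S (\<lambda>x. chart_proj j (g x))"
  "continuous_on S h \<Longrightarrow> continuous_on S (\<lambda>x. chart_incl j (h x))"
  by (auto intro: bounded_linear.continuous_on[OF bounded_linear_chart_proj] bounded_linear.continuous_on[OF bounded_linear_chart_incl])

text \<open>Every point off the plane \<open>x $ j = 0\<close> is a scalar multiple of a point of
  the affine slice through \<open>p\<close> that defines the local equation.\<close>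

lemma chart_coordinates:
  assumes "p $ j \<noteq> 0" "x $ j \<noteq> 0"
  defines "l \<equiv> x $ j / p $ j"
  shows "x = l *s (p + chart_incl j (pscale (inverse l) (chart_proj j x) - chart_proj j p))"
proof -
  have l: "l \<noteq> 0" using assms by simp
  interpret bounded_linear "chart_incl j" by (rule bounded_linear_chart_incl)
  have "chart_incl j (pscale (inverse l) (chart_proj j x) - chart_proj j p) =
     inverse l *s (x - (x $ j) *s axis j 1) - (p - (p $ j) *s axis j 1)"
    by (simp only: diff chart_incl_pscale chart_incl_proj)
  also have "\<dots> = inverse l *s x - p"
    using assms l by (simp add: vec_eq_iff field_simps)
  finally have e: "chart_incl j (pscale (inverse l) (chart_proj j x) - chart_proj j p) = inverse l *s x - p" .
  show ?thesis unfolding e using l by (simp add: vec_eq_iff)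
qed

lemma borel_measurable_eval [measurable]: "eval f \<in> borel_measurable borel"
  using continuous_on_eval[OF continuous_on_id] by (intro borel_measurable_continuous_onI) simp

lemma continuous_local_equation: "continuous_on S (local_equation f p)"
  unfolding local_equation_chart[abs_def] by (intro continuous_intros)

lemma borel_measurable_local_equation [measurable]: "local_equation f p \<in> borel_measurable borel"
  by (rule borel_measurable_continuous_onI[OF continuous_local_equation])

text \<open>By homogeneity the local equation at \<open>c *s p\<close> in rescaled coordinates is
  \<open>c ^ d\<close> times the one at \<open>p\<close>. Thus integrability does not depend on the
  homogeneous coordinates.\<close>

lemma int_near_local_equation_scale:
  assumes f: "homogeneous d f" and c: "c \<noteq> 0" and t: "t \<ge> 0" "int_near t (local_equation f p)"
  shows "int_near t (local_equation f (c *s p))"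
proof -
  have surj: "pscale c ` UNIV = UNIV"
    using c by (intro surjI[of _ "pscale (inverse c)"]) (simp add: pscale_pscale)
  have inj: "inj_on (pscale c) UNIV"
    using c by (intro inj_on_inverseI[of _ "pscale (inverse c)"]) (simp add: pscale_pscale)
  have inv: "the_inv_into UNIV (pscale c) = pscale (inverse c)"
    using c by (intro ext the_inv_into_f_eq[OF inj]) (auto simp: pscale_pscale)
  have hol: "holomorphic2_on (fst \<circ> pscale c) UNIV" "holomorphic2_on (snd \<circ> pscale c) UNIV"
  proof -
    have "((fst \<circ> pscale c) has_derivative (\<lambda>(h, k). c * h + 0 * k)) (at x)" for x
      by (rule has_derivative_eq_rhs[OF bounded_linear_imp_has_derivative[OF bounded_linear_compose[OF bounded_linear_fst bounded_linear_pscale, folded o_def]]])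
         (auto simp: pscale_def)
    moreover have "((snd \<circ> pscale c) has_derivative (\<lambda>(h, k). 0 * h + c * k)) (at x)" for x
      by (rule has_derivative_eq_rhs[OF bounded_linear_imp_has_derivative[OF bounded_linear_compose[OF bounded_linear_snd bounded_linear_pscale, folded o_def]]])
         (auto simp: pscale_def)
    ultimately show "holomorphic2_on (fst \<circ> pscale c) UNIV" "holomorphic2_on (snd \<circ> pscale c) UNIV"
      unfolding holomorphic2_on_def by blast+
  qed
  have eq: "local_equation f (c *s p) (pscale c x) = c ^ d * local_equation f p x" for x
  proof -
    have "c *s p + chart_incl (chart p) (pscale c x) = c *s (p + chart_incl (chart p) x)"
      by (simp add: chart_incl_pscale vector_add_ldistrib)
    then show ?thesis
      by (simp only: local_equation_chart chart_smult[OF c] eval_scale[OF f])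
  qed
  show ?thesis
    by (rule int_near_transfer[where U = UNIV and V = UNIV and \<phi> = "pscale c" and u = "\<lambda>_. c ^ d", OF t(1) _ _ _ _ _ _ surj inj hol _ _ _ t(2)])
       (use c eq in \<open>auto simp: inv pscale_def zero_prod_def intro!: continuous_intros\<close>)
qed

lemma gradient_scale_0:
  assumes "homogeneous d f" "gradient f q = 0" shows "gradient f (c *s q) = 0"
proof -
  have "gradient f (c *s q) $ i = c ^ (d - 1) * gradient f q $ i" for i
    unfolding gradient_nth by (rule eval_scale[OF homogeneous_pd[OF assms(1)]])
  then show ?thesis using assms(2) by (simp add: vec_eq_iff)
qed

lemma has_derivative_local_equation:
  "(local_equation f p has_derivative (\<lambda>h. \<Sum>i\<in>UNIV. gradient f (p + chart_incl (chart p) z) $ i * chart_incl (chart p) h $ i)) (at z)"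
proof -
  have "((\<lambda>z. p + chart_incl (chart p) z) has_derivative chart_incl (chart p)) (at z)"
    using has_derivative_add[OF has_derivative_const bounded_linear_imp_has_derivative[OF bounded_linear_chart_incl]] by simp
  from has_derivative_compose[OF this has_derivative_eval]
  show ?thesis by (simp add: local_equation_chart[abs_def])
qed

text \<open>A nearby singular point has chart coordinates \<open>Y q\<close> near 0 at which the
  local equation and its derivative vanish, so \<open>Y q = 0\<close>. On the cone this isolates
  \<open>p\<close> up to scalars only.\<close>

lemma simple_singularity_isolated:
  assumes f: "homogeneous d f" and p: "p \<in> singular_points f"
    and s: "simple_normal_form h" "germ_equivalent (local_equation f p) h"
  shows "\<exists>e>0. \<forall>q\<in>singular_points f. dist q p < e \<longrightarrow> (\<exists>c. q = c *s p)"
proof -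
  obtain V where V: "open V" "0 \<in> V" "\<And>y. y \<in> V \<Longrightarrow> local_equation f p y = 0 \<Longrightarrow> (local_equation f p has_derivative (\<lambda>_. 0)) (at y) \<Longrightarrow> y = 0"
    using germ_isolated[OF s(2,1)] by blast
  define j where "j = chart p"
  have pj: "p $ j \<noteq> 0" using chart_nonzero p by (auto simp: j_def singular_points_def)
  define Y where "Y q = pscale (inverse (q $ j / p $ j)) (chart_proj j q) - chart_proj j p" for q
  have Yp: "Y p = 0" using pj by (simp add: Y_def pscale_pscale)
  have opn: "open {q::complex^3. q $ j \<noteq> 0}" by (intro open_Collect_neq continuous_intros)
  have "continuous_on {q. q $ j \<noteq> 0} Y"
    unfolding Y_def using pj by (intro continuous_intros) auto
  then have "open (Y -` V \<inter> {q. q $ j \<noteq> 0})"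
    using continuous_open_preimage[OF _ opn V(1), of Y] by (simp add: Int_commute)
  moreover have "p \<in> Y -` V \<inter> {q. q $ j \<noteq> 0}" using pj Yp V(2) by simp
  ultimately obtain e where e: "e > 0" "ball p e \<subseteq> Y -` V \<inter> {q. q $ j \<noteq> 0}" using open_contains_ball by blast
  have "\<exists>c. q = c *s p" if q: "q \<in> singular_points f" "dist q p < e" for q
  proof -
    have q2: "Y q \<in> V" "q $ j \<noteq> 0" using e(2) q(2) by (auto simp: dist_commute subset_iff)
    define l where "l = q $ j / p $ j"
    have l: "l \<noteq> 0" using q2 pj by (simp add: l_def)
    have ql: "q = l *s (p + chart_incl j (Y q))"
      unfolding Y_def l_def by (rule chart_coordinates[OF pj q2(2)])
    have q': "p + chart_incl j (Y q) = inverse l *s q"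
      by (subst (2) ql) (use l in \<open>simp add: vec_eq_iff\<close>)
    have "local_equation f p (Y q) = 0"
      using q(1) unfolding local_equation_chart j_def[symmetric] q' eval_scale[OF f]
      by (simp add: singular_points_def)
    moreover have "gradient f (p + chart_incl j (Y q)) = 0"
      unfolding q' using q(1) by (intro gradient_scale_0[OF f]) (simp add: singular_points_def)
    then have "(local_equation f p has_derivative (\<lambda>_. 0)) (at (Y q))"
      using has_derivative_local_equation[of f p "Y q"] by (simp add: j_def[symmetric])
    ultimately have "Y q = 0" using V(3) q2(1) by blast
    then have "q = l *s p" using ql linear_0[OF bounded_linear.linear[OF bounded_linear_chart_incl]] by simp
    then show ?thesis by blast
  qed
  then show ?thesis using e(1) by blast
qed

lemma singular_points_smult:
  assumes "homogeneous d f" "p \<in> singular_points f" "c \<noteq> 0" shows "c *s p \<in> singular_points f"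
  using assms gradient_scale_0[OF assms(1), of p c] by (auto simp: singular_points_def eval_scale[OF assms(1)])

text \<open>The singular points of norm 1 form a compact set. Each has a neighbourhood containing
  only its own multiples, and finitely many such neighbourhoods suffice.\<close>

lemma finite_singular_points:
  assumes f: "homogeneous d f" and s: "only_simple_singularities f"
  shows "\<exists>S. finite S \<and> S \<subseteq> singular_points f \<and> (\<forall>q\<in>singular_points f. \<exists>v\<in>S. \<exists>c. q = c *s v)"
proof -
  define K where "K = {p \<in> sphere 0 1. eval f p = 0 \<and> (\<forall>i. eval (pd i f) p = 0)}"
  have KS: "p \<in> singular_points f" if "p \<in> K" for p
  proof -
    have "gradient f p = 0" using that by (simp add: K_def vec_eq_iff gradient_nth)
    then show ?thesis using that by (auto simp: K_def singular_points_def)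
  qed
  have "closed K"
  proof -
    have "K = sphere 0 1 \<inter> ({p. eval f p = 0} \<inter> (\<Inter>i. {p. eval (pd i f) p = 0}))" by (auto simp: K_def)
    moreover have "closed {p. eval g p = 0}" for g by (intro closed_Collect_eq continuous_intros)
    ultimately show ?thesis by (auto intro!: closed_Int closed_INT)
  qed
  moreover have "bounded K" by (rule bounded_subset[OF bounded_sphere[of 0 1]]) (auto simp: K_def)
  ultimately have "compact K" by (simp add: compact_eq_bounded_closed)
  have "\<exists>e>0. \<forall>q\<in>singular_points f. dist q p < e \<longrightarrow> (\<exists>c. q = c *s p)" if "p \<in> K" for p
    using simple_singularity_isolated[OF f KS[OF that]] s KS[OF that] unfolding only_simple_singularities_def by blast
  then obtain e where e: "\<And>p. p \<in> K \<Longrightarrow> e p > 0" "\<And>p q. p \<in> K \<Longrightarrow> q \<in> singular_points f \<Longrightarrow> dist q p < e p \<Longrightarrow> \<exists>c. q = c *s p"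
    by metis
  obtain S where S: "S \<subseteq> K" "finite S" "K \<subseteq> (\<Union>p\<in>S. ball p (e p))"
  proof (rule compactE_image[OF \<open>compact K\<close>, of K "\<lambda>p. ball p (e p)"])
    show "K \<subseteq> (\<Union>p\<in>K. ball p (e p))" using e(1) by force
  qed auto
  have "\<exists>v\<in>S. \<exists>c. q = c *s v" if q: "q \<in> singular_points f" for q
  proof -
    have q0: "q \<noteq> 0" using q by (simp add: singular_points_def)
    define q' where "q' = inverse (of_real (norm q)) *s q"
    have nq: "norm q' = 1" 
    proof -
      have "q' = inverse (norm q) *\<^sub>R q" by (simp add: q'_def scaleR_smult)
      then show ?thesis using q0 by simp
    qed
    have q's: "q' \<in> singular_points f" unfolding q'_def using q0 by (intro singular_points_smult[OF f q]) simp
    then have "q' \<in> K" using nq by (auto simp: K_def singular_points_def vec_eq_iff gradient_nth)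
    then obtain v where v: "v \<in> S" "dist q' v < e v" using S(3) by (auto simp: dist_commute)
    then obtain c where c: "q' = c *s v" using e(2)[of v q'] S(1) q's by blast
    have "q = of_real (norm q) *s q'" using q0 by (simp add: q'_def vector_smult_assoc)
    then have "q = (of_real (norm q) * c) *s v" by (simp only: c vector_smult_assoc)
    then show ?thesis using v by blast
  qed
  then show ?thesis using S KS by blast
qed

section \<open>Order of vanishing at singular points, and null sets\<close>

lemma norm_nth3: "norm (x $ i) \<le> norm (x :: complex^3)"
  by (rule Finite_Cartesian_Product.norm_nth_le)

lemma eval_lipschitz_at_zero:
  fixes p :: "complex^3"
  shows "\<exists>M\<ge>0. \<forall>v. norm v \<le> 1 \<longrightarrow> norm (eval g (p + v) - eval g p) \<le> M * norm v"
proof -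
  have "continuous_on (cball p 1) (\<lambda>x. \<Sum>i\<in>UNIV. norm (gradient g x $ i))"
    unfolding gradient_nth by (intro continuous_intros)
  then have "bounded ((\<lambda>x. \<Sum>i\<in>UNIV. norm (gradient g x $ i)) ` cball p 1)"
    by (intro compact_imp_bounded compact_continuous_image) auto
  then obtain M where "\<forall>y\<in>(\<lambda>x. \<Sum>i\<in>UNIV. norm (gradient g x $ i)) ` cball p 1. norm y \<le> M" unfolding bounded_iff by blast
  then have M: "(\<Sum>i\<in>UNIV. norm (gradient g x $ i)) \<le> M" if "x \<in> cball p 1" for x
  proof -
    have "norm (\<Sum>i\<in>UNIV. norm (gradient g x $ i)) \<le> M"
      using \<open>\<forall>y\<in>(\<lambda>x. \<Sum>i\<in>UNIV. norm (gradient g x $ i)) ` cball p 1. norm y \<le> M\<close> that by blast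
    then show ?thesis by simp
  qed
  have "0 \<le> (\<Sum>i\<in>UNIV. norm (gradient g p $ i))" by (rule sum_nonneg) simp
  then have M0: "M \<ge> 0" using M[of p] by simp
  have "norm (eval g (p + v) - eval g p) \<le> M * norm (p + v - p)" if "norm v \<le> 1" for v
  proof (rule differentiable_bound[where S = "cball p 1", OF convex_cball has_derivative_at_withinI[OF has_derivative_eval]])
    fix x assume "x \<in> cball p 1"
    show "onorm (\<lambda>h. \<Sum>i\<in>UNIV. gradient g x $ i * h $ i) \<le> M"
    proof (rule onorm_le)
      fix h :: "complex^3"
      have "norm (\<Sum>i\<in>UNIV. gradient g x $ i * h $ i) \<le> (\<Sum>i\<in>UNIV. norm (gradient g x $ i) * norm h)"
        by (rule order_trans[OF norm_sum]) (auto simp: norm_mult intro!: sum_mono mult_left_mono norm_nth3)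
      also have "\<dots> \<le> M * norm h"
        unfolding sum_distrib_right[symmetric] by (intro mult_right_mono M \<open>x \<in> cball p 1\<close>) simp
      finally show "norm (\<Sum>i\<in>UNIV. gradient g x $ i * h $ i) \<le> M * norm h" .
    qed
  qed (use that in \<open>auto simp: dist_norm\<close>)
  then show ?thesis using M0 by auto
qed

text \<open>The gradient vanishes at \<open>p\<close> and satisfies a Lipschitz estimate there, so
  the mean value inequality on the ball of radius |v| gains a second factor |v|.\<close>

lemma eval_quadratic_bound:
  assumes z: "eval f p = 0" "gradient f p = 0"
  shows "\<exists>M>0. \<forall>v. norm v \<le> 1 \<longrightarrow> norm (eval f (p + v)) \<le> M * (norm v)\<^sup>2"
proof -
  have "\<exists>M\<ge>0. \<forall>v. norm v \<le> 1 \<longrightarrow> norm (eval (pd i f) (p + v) - eval (pd i f) p) \<le> M * norm v" for i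
    by (rule eval_lipschitz_at_zero)
  then obtain M where M: "\<And>i. M i \<ge> 0" "\<And>i v. norm v \<le> 1 \<Longrightarrow> norm (eval (pd i f) (p + v) - eval (pd i f) p) \<le> M i * norm v" by metis
  have g: "norm (gradient f (p + v) $ i) \<le> M i * norm v" if "norm v \<le> 1" for v i
    using M(2)[OF that, of i] z(2) by (simp add: gradient_nth[symmetric])
  define N where "N = (\<Sum>i\<in>UNIV. M i) + 1"
  have N: "N > 0" using sum_nonneg[of UNIV M] M(1) by (simp add: N_def)
  have "norm (eval f (p + v)) \<le> N * (norm v)\<^sup>2" if v: "norm v \<le> 1" for v
  proof -
    have "norm (eval f (p + v) - eval f p) \<le> (N * norm v) * norm (p + v - p)"
    proof (rule differentiable_bound[where S = "cball p (norm v)", OF convex_cball has_derivative_at_withinI[OF has_derivative_eval]])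
      fix x assume x: "x \<in> cball p (norm v)"
      show "onorm (\<lambda>h. \<Sum>i\<in>UNIV. gradient f x $ i * h $ i) \<le> N * norm v"
      proof (rule onorm_le)
        fix h :: "complex^3"
        have gx: "norm (gradient f x $ i) \<le> M i * norm v" for i
        proof -
          have nx: "norm (x - p) \<le> norm v" using x by (simp add: dist_norm norm_minus_commute)
          then have "norm (gradient f (p + (x - p)) $ i) \<le> M i * norm (x - p)" using v by (intro g) simp
          also have "\<dots> \<le> M i * norm v" using nx M(1) by (intro mult_left_mono)
          finally show ?thesis by simp
        qed
        have "norm (\<Sum>i\<in>UNIV. gradient f x $ i * h $ i) \<le> (\<Sum>i\<in>UNIV. (M i * norm v) * norm h)"
          by (rule order_trans[OF norm_sum]) (auto simp: norm_mult intro!: sum_mono mult_mono norm_nth3 gx mult_nonneg_nonneg M(1))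
        also have "\<dots> = (\<Sum>i\<in>UNIV. M i) * norm v * norm h" by (simp add: sum_distrib_right)
        also have "\<dots> \<le> N * norm v * norm h" by (intro mult_right_mono) (auto simp: N_def)
        finally show "norm (\<Sum>i\<in>UNIV. gradient f x $ i * h $ i) \<le> N * norm v * norm h" .
      qed
    qed (auto simp: dist_norm)
    then show ?thesis using z(1) by (simp add: power2_eq_square mult.assoc)
  qed
  then show ?thesis using N by blast
qed

lemma AE_eval_nonzero: assumes "f \<noteq> 0" shows "AE x in lborel. eval f x \<noteq> 0"
proof -
  obtain y where y: "eval f y \<noteq> 0" using eval_eq_0_imp assms by blast
  have "\<exists>P. \<forall>t. eval f (y + t *\<^sub>R x) = poly P (of_real t)" for x
  proof -
    show ?thesis using eval_line[of f y x] by (auto simp: scaleR_smult)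
  qed
  from AE_nonzero_if_polynomial_on_rays[OF borel_measurable_eval y this] show ?thesis .
qed

lemma AE_local_equation_nonzero:
  assumes f: "homogeneous d f" "f \<noteq> 0" and p: "p \<noteq> 0"
  shows "AE z in lborel. local_equation f p z \<noteq> 0"
proof -
  define j where "j = chart p"
  have pj: "p $ j \<noteq> 0" using chart_nonzero[OF p] by (simp add: j_def)
  have "\<exists>y. local_equation f p y \<noteq> 0"
  proof (rule ccontr)
    assume z: "\<not> ?thesis"
    have "eval (f * var j) x = 0" for x
    proof (cases "x $ j = 0")
      case False
      define l where "l = x $ j / p $ j"
      define y where "y = pscale (inverse l) (chart_proj j x) - chart_proj j p"
      have "x = l *s (p + chart_incl j y)" unfolding y_def l_def by (rule chart_coordinates[OF pj False])
      then have "eval f x = l ^ d * eval f (p + chart_incl j y)"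
        by (simp only: eval_scale[OF f(1)])
      then have "eval f x = l ^ d * local_equation f p y"
        by (simp add: local_equation_chart j_def[symmetric])
      moreover have "local_equation f p y = 0" using z by blast
      ultimately show ?thesis by simp
    qed simp
    then have "f * var j = 0" by (rule eval_eq_0_imp)
    moreover have "var j \<noteq> 0" by (simp add: var_def)
    ultimately show False using f(2) by simp
  qed
  then obtain y where y: "local_equation f p y \<noteq> 0" by blast
  have "\<exists>P. \<forall>t. local_equation f p (y + t *\<^sub>R x) = poly P (of_real t)" for x
  proof -
    interpret bounded_linear "chart_incl (chart p)" by (rule bounded_linear_chart_incl)
    have *: "p + chart_incl (chart p) (y + t *\<^sub>R x) = (p + chart_incl (chart p) y) + of_real t *s chart_incl (chart p) x" for t
      by (simp add: add scaleR vec_eq_iff scaleR_conv_of_real[where 'a = complex])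
    obtain P where "\<And>t. eval f ((p + chart_incl (chart p) y) + t *s chart_incl (chart p) x) = poly P t"
      using eval_line by blast
    then show ?thesis unfolding local_equation_chart * by blast
  qed
  from AE_nonzero_if_polynomial_on_rays[OF borel_measurable_local_equation y this] show ?thesis .
qed

text \<open>At a singular point the equation is O(|z|^2), so the integrand is at least a multiple of
  |z|^(-4c), which is not integrable in real dimension 4 for c \<ge> 1. This keeps the supremum
  defining the Arnold exponent meaningful and bounds it by 1.\<close>

lemma int_near_singular_less_1:
  assumes f: "homogeneous d f" "f \<noteq> 0" and p: "p \<in> singular_points f" and int: "int_near c (local_equation f p)"
  shows "c < 1"
proof (rule ccontr)
  assume c: "\<not> c < 1"
  obtain M where M: "M > 0" "\<And>v. norm v \<le> 1 \<Longrightarrow> norm (eval f (p + v)) \<le> M * (norm v)\<^sup>2"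
    using eval_quadratic_bound[of f p] p by (auto simp: singular_points_def)
  obtain r where r: "r > 0" "set_integrable lborel (ball 0 r) (\<lambda>x. norm (local_equation f p x) powr (- 2 * c))"
    using int unfolding int_near_def by blast
  have fin: "(\<integral>\<^sup>+x. ennreal (norm (local_equation f p x) powr (- 2 * c)) * indicator (ball 0 r) x \<partial>lborel) < \<infinity>"
    using r(2) by (subst (asm) set_integrable_iff_nn_integral) auto
  define r' where "r' = min r 1"
  have r': "r' > 0" "r' \<le> r" "r' \<le> 1" using r by (auto simp: r'_def)
  have "(\<integral>\<^sup>+x. ennreal (norm (x::complex \<times> complex) powr (- (4 * c))) * indicator (ball 0 r') x \<partial>lborel) = \<infinity>"
    using c r' by (intro nn_integral_norm_powr_ball_infinite) auto
  moreover have "(\<integral>\<^sup>+x. ennreal (M powr (- 2 * c)) * (ennreal (norm (x::complex \<times> complex) powr (- (4 * c))) * indicator (ball 0 r') x) \<partial>lborel)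
     \<le> (\<integral>\<^sup>+x. ennreal (norm (local_equation f p x) powr (- 2 * c)) * indicator (ball 0 r) x \<partial>lborel)"
  proof (rule nn_integral_mono_AE)
    have "AE z in lborel. local_equation f p z \<noteq> 0"
      using p by (intro AE_local_equation_nonzero[OF f]) (simp add: singular_points_def)
    then show "AE x in lborel. ennreal (M powr (- 2 * c)) * (ennreal (norm x powr (- (4 * c))) * indicator (ball 0 r') x)
       \<le> ennreal (norm (local_equation f p x) powr (- 2 * c)) * indicator (ball 0 r) x"
    proof eventually_elim
      case (elim x)
      show ?case
      proof (cases "x \<in> ball 0 r'")
        case True
        then have x: "norm x \<le> 1" "x \<in> ball 0 r" using r' by auto
        have "norm (local_equation f p x) \<le> M * (norm x)\<^sup>2"
          using M(2)[of "chart_incl (chart p) x"] x by (simp add: local_equation_chart)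
        then have "(M * (norm x)\<^sup>2) powr (- 2 * c) \<le> norm (local_equation f p x) powr (- 2 * c)"
          using c elim by (intro powr_mono2') auto
        moreover have "(M * (norm x)\<^sup>2) powr (- 2 * c) = M powr (- 2 * c) * norm x powr (- (4 * c))"
        proof (cases "x = 0")
          case False
          then have "(norm x)\<^sup>2 = norm x powr 2" by simp
          then show ?thesis by (simp only: powr_mult powr_powr) simp
        qed simp
        ultimately show ?thesis using True x by (simp add: ennreal_mult[symmetric] ennreal_leI)
      qed simp
    qed
  qed
  moreover have "(\<integral>\<^sup>+x. ennreal (M powr (- 2 * c)) * (ennreal (norm (x::complex \<times> complex) powr (- (4 * c))) * indicator (ball 0 r') x) \<partial>lborel)
    = ennreal (M powr (- 2 * c)) * (\<integral>\<^sup>+x. ennreal (norm (x::complex \<times> complex) powr (- (4 * c))) * indicator (ball 0 r') x \<partial>lborel)"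
    by (rule nn_integral_cmult) (simp add: borel_measurable_powr_indicator)
  ultimately show False using fin M(1) by (simp add: ennreal_mult_top)
qed


section \<open>Local integrability on the affine cone\<close>

definition loc_int :: "real \<Rightarrow> poly3 \<Rightarrow> complex^3 \<Rightarrow> bool" where
  "loc_int s f p \<longleftrightarrow> (\<exists>r>0. (\<integral>\<^sup>+x. ennreal (norm (eval f x) powr (- 2 * s)) * indicator (ball p r) x \<partial>lborel) < \<infinity>)"

lemma loc_int_nonzero:
  assumes s: "s \<ge> 0" and nz: "eval f p \<noteq> 0" shows "loc_int s f p"
proof -
  have "continuous (at p) (eval f)" by (rule has_derivative_continuous[OF has_derivative_eval])
  moreover have "norm (eval f p) / 2 > 0" using nz by simp
  ultimately obtain r where r: "r > 0" "\<And>x. dist x p < r \<Longrightarrow> dist (eval f x) (eval f p) < norm (eval f p) / 2"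
    unfolding continuous_at_eps_delta by blast
  define C where "C = (norm (eval f p) / 2) powr (- 2 * s)"
  have "(\<integral>\<^sup>+x. ennreal (norm (eval f x) powr (- 2 * s)) * indicator (ball p r) x \<partial>lborel) \<le> (\<integral>\<^sup>+x. ennreal C * indicator (ball p r) x \<partial>lborel)"
  proof (rule nn_integral_mono)
    fix x :: "complex^3"
    have "norm (eval f x) powr (- 2 * s) \<le> C" if "x \<in> ball p r"
    proof -
      have "norm (eval f x - eval f p) < norm (eval f p) / 2" using r(2)[of x] that by (simp add: dist_norm norm_minus_commute)
      then have "norm (eval f p) / 2 \<le> norm (eval f x)"
        using norm_triangle_ineq2[of "eval f p" "eval f p - eval f x"] by (simp add: norm_minus_commute)
      then show ?thesis unfolding C_def using s nz by (intro powr_mono2') auto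
    qed
    then show "ennreal (norm (eval f x) powr (- 2 * s)) * indicator (ball p r) x \<le> ennreal C * indicator (ball p r) x"
      by (auto simp: indicator_def intro!: ennreal_leI)
  qed
  also have "\<dots> = ennreal C * emeasure lborel (ball p r)" by (rule nn_integral_cmult_indicator) simp
  also have "\<dots> < \<infinity>" using emeasure_bounded_finite[OF bounded_ball, of p r] by (simp add: ennreal_mult_less_top)
  finally show ?thesis using r(1) unfolding loc_int_def by blast
qed

text \<open>Let \<open>t0\<close> minimise |\<theta>| on the disc. Then c |t - t0| \<le> |\<theta>
  t| + |\<theta> t0| \<le> 2 |\<theta> t|, whether or not \<theta> has a zero. The bound depends on
  \<theta> through \<open>c\<close> only.\<close>

lemma nn_integral_inverse_expanding:
  fixes \<theta> :: "complex \<Rightarrow> complex"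
  assumes s: "0 \<le> s" and c: "c > 0" and \<rho>: "\<rho> > 0" and cont: "continuous_on (cball 0 \<rho>) \<theta>"
    and ex: "\<And>t t'. t \<in> cball 0 \<rho> \<Longrightarrow> t' \<in> cball 0 \<rho> \<Longrightarrow> norm (\<theta> t - \<theta> t') \<ge> c * norm (t - t')"
  shows "(\<integral>\<^sup>+t. ennreal (norm (\<theta> t) powr (- 2 * s)) * indicator (ball 0 \<rho>) t \<partial>lborel)
    \<le> ennreal ((c / 2) powr (- 2 * s)) * (\<integral>\<^sup>+t. ennreal (norm (t::complex) powr (- 2 * s)) * indicator (ball 0 (2 * \<rho>)) t \<partial>lborel)"
proof -
  have "\<exists>t0\<in>cball 0 \<rho>. \<forall>t\<in>cball 0 \<rho>. norm (\<theta> t0) \<le> norm (\<theta> t)"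
    using \<rho> by (intro continuous_attains_inf continuous_intros cont) auto
  then obtain t0 where t0: "t0 \<in> cball 0 \<rho>" "\<And>t. t \<in> cball 0 \<rho> \<Longrightarrow> norm (\<theta> t0) \<le> norm (\<theta> t)" by blast
  let ?g = "\<lambda>t::complex. ennreal (norm t powr (- 2 * s)) * indicator (ball 0 (2 * \<rho>)) t"
  have m: "?g \<in> borel_measurable borel" by (rule borel_measurable_powr_indicator) auto
  have "(\<integral>\<^sup>+t. ennreal (norm (\<theta> t) powr (- 2 * s)) * indicator (ball 0 \<rho>) t \<partial>lborel)
     \<le> (\<integral>\<^sup>+t. ennreal ((c / 2) powr (- 2 * s)) * ?g (t - t0) \<partial>lborel)"
  proof (rule nn_integral_mono_AE)
    show "AE t in lborel. ennreal (norm (\<theta> t) powr (- 2 * s)) * indicator (ball 0 \<rho>) t \<le> ennreal ((c / 2) powr (- 2 * s)) * ?g (t - t0)"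
      using AE_lborel_singleton[of t0]
    proof eventually_elim
      case (elim t)
      show ?case
      proof (cases "t \<in> ball 0 \<rho>")
        case True
        then have t: "t \<in> cball 0 \<rho>" by auto
        have "c * norm (t - t0) \<le> norm (\<theta> t - \<theta> t0)" by (rule ex[OF t t0(1)])
        also have "\<dots> \<le> 2 * norm (\<theta> t)" using norm_triangle_ineq4[of "\<theta> t" "\<theta> t0"] t0(2)[OF t] by simp
        finally have "c / 2 * norm (t - t0) \<le> norm (\<theta> t)" by simp
        then have "norm (\<theta> t) powr (- 2 * s) \<le> (c / 2 * norm (t - t0)) powr (- 2 * s)"
          using elim c s by (intro powr_mono2') auto
        also have "\<dots> = (c / 2) powr (- 2 * s) * norm (t - t0) powr (- 2 * s)" by (rule powr_mult)
        finally have 1: "norm (\<theta> t) powr (- 2 * s) \<le> (c / 2) powr (- 2 * s) * norm (t - t0) powr (- 2 * s)" .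
        have "norm (t - t0) < 2 * \<rho>" using norm_triangle_ineq4[of t t0] True t0(1) by simp
        then show ?thesis using True 1 by (simp add: ennreal_mult[symmetric] ennreal_leI)
      qed simp
    qed
  qed
  also have "\<dots> = ennreal ((c / 2) powr (- 2 * s)) * (\<integral>\<^sup>+t. ?g (t - t0) \<partial>lborel)"
    by (rule nn_integral_cmult) (use measurable_compose[OF _ m, of "\<lambda>t. t - t0"] in simp)
  also have "(\<integral>\<^sup>+t. ?g (t - t0) \<partial>lborel) = (\<integral>\<^sup>+t. ?g t \<partial>lborel)"
    using lborel_nn_integral_affine[OF m, of 1 "- t0"] by simp
  finally show ?thesis .
qed

text \<open>In a coordinate direction where the partial derivative at \<open>p\<close> is some w
  \<noteq> 0, \<open>f\<close> expands distances on short discs by |w|/2, uniformly in the base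
  point. The slices are thus uniformly bounded, and averaging gives the full integral. The condition
  s < 1 makes |t|^(-2s) integrable near 0 in the plane.\<close>

lemma loc_int_smooth:
  assumes s: "0 \<le> s" "s < 1" and grad: "gradient f p \<noteq> 0" shows "loc_int s f p"
proof -
  obtain i where i: "gradient f p $ i \<noteq> 0" using grad by (auto simp: vec_eq_iff)
  define w where "w = gradient f p $ i"
  define v :: "complex^3" where "v = axis i 1"
  have nv: "norm (t *s v) = norm t" for t
    using exhaust_3[of i] by (auto simp: v_def norm_vec_def L2_set_def sum_3 axis_def)
  have "continuous (at p) (eval (pd i f))" by (rule has_derivative_continuous[OF has_derivative_eval])
  moreover have "norm w / 2 > 0" using i by (simp add: w_def)
  ultimately obtain e where e: "e > 0" "\<And>x. dist x p < e \<Longrightarrow> dist (eval (pd i f) x) (eval (pd i f) p) < norm w / 2"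
    unfolding continuous_at_eps_delta by blast
  \<comment> \<open>Base points range over radius 2 \<rho> and discs have radius \<rho>, so
    everything stays within \<open>e\<close>.\<close>
  define \<rho> where "\<rho> = e / 4"
  have \<rho>: "\<rho> > 0" "e = 4 * \<rho>" using e by (auto simp: \<rho>_def)
  define J where "J = (\<integral>\<^sup>+t. ennreal (norm (t::complex) powr (- 2 * s)) * indicator (ball 0 (2 * \<rho>)) t \<partial>lborel)"
  have "J < \<infinity>" unfolding J_def using nn_integral_norm_powr_ball[where 'a = complex, of "2 * s" "2 * \<rho>"] s by simp
  have line: "(\<integral>\<^sup>+t. ennreal (norm (eval f (x + t *s v)) powr (- 2 * s)) * indicator (ball 0 \<rho>) t \<partial>lborel)
      \<le> ennreal ((norm w / 2 / 2) powr (- 2 * s)) * J" if x: "x \<in> ball p (2 * \<rho>)" for x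
    unfolding J_def
  proof (rule nn_integral_inverse_expanding[OF s(1) _ \<rho>(1)])
    show "norm w / 2 > 0" using i by (simp add: w_def)
    show "continuous_on (cball 0 \<rho>) (\<lambda>t. eval f (x + t *s v))"
      by (intro continuous_intros bounded_linear.continuous_on[OF bounded_linear_vector_scalar_left])
    fix t t' :: complex assume t: "t \<in> cball 0 \<rho>" "t' \<in> cball 0 \<rho>"
    \<comment> \<open>Subtracting the linear part \<open>w * t\<close> leaves a function with
      Lipschitz constant |w|/2, whence the lower bound for \<open>f\<close> by the triangle
      inequality.\<close>
    have "norm ((\<lambda>t. eval f (x + t *s v) - w * t) t - (\<lambda>t. eval f (x + t *s v) - w * t) t') \<le> (norm w / 2) * norm (t - t')"
    proof (rule differentiable_bound[where S = "cball 0 \<rho>" and f' = "\<lambda>t h. (eval (pd i f) (x + t *s v) - w) * h", OF convex_cball])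
      fix y :: complex assume y: "y \<in> cball 0 \<rho>"
      have "((\<lambda>t. x + t *s v) has_derivative (\<lambda>h. h *s v)) (at y)"
        using has_derivative_add[OF has_derivative_const bounded_linear_imp_has_derivative[OF bounded_linear_vector_scalar_left]] by simp
      from has_derivative_compose[OF this has_derivative_eval]
      have "((\<lambda>t. eval f (x + t *s v)) has_derivative (\<lambda>h. \<Sum>k\<in>UNIV. gradient f (x + y *s v) $ k * (h *s v) $ k)) (at y)" .
      moreover have "(\<Sum>k\<in>UNIV. gradient f (x + y *s v) $ k * (h *s v) $ k) = eval (pd i f) (x + y *s v) * h" for h
        using exhaust_3[of i] by (auto simp: v_def sum_3 axis_def gradient_nth)
      ultimately have "((\<lambda>t. eval f (x + t *s v)) has_derivative (\<lambda>h. eval (pd i f) (x + y *s v) * h)) (at y)" by simp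
      moreover have "((\<lambda>t. w * t) has_derivative (\<lambda>h. w * h)) (at y)" by (intro derivative_intros)
      ultimately have "((\<lambda>t. eval f (x + t *s v) - w * t) has_derivative (\<lambda>h. eval (pd i f) (x + y *s v) * h - w * h)) (at y)"
        by (rule has_derivative_diff)
      then show "((\<lambda>t. eval f (x + t *s v) - w * t) has_derivative (\<lambda>h. (eval (pd i f) (x + y *s v) - w) * h)) (at y within cball 0 \<rho>)"
        by (simp only: left_diff_distrib has_derivative_at_withinI)
      have "dist (x + y *s v) p \<le> dist x p + norm (y *s v)"
        using norm_triangle_ineq[of "x - p" "y *s v"] by (simp add: dist_norm algebra_simps)
      also have "\<dots> < e" using x y \<rho> by (simp add: nv dist_commute)
      finally have "norm (eval (pd i f) (x + y *s v) - w) \<le> norm w / 2"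
        using e(2)[of "x + y *s v"] by (simp add: dist_norm w_def gradient_nth)
      then show "onorm (\<lambda>h. (eval (pd i f) (x + y *s v) - w) * h) \<le> norm w / 2"
        by (intro onorm_le) (simp only: norm_mult mult_right_mono norm_ge_zero)
    qed (use t in auto)
    then have "norm ((eval f (x + t *s v) - eval f (x + t' *s v)) - w * (t - t')) \<le> norm w / 2 * norm (t - t')"
      by (simp add: algebra_simps)
    then have "norm (w * (t - t')) - norm w / 2 * norm (t - t') \<le> norm (eval f (x + t *s v) - eval f (x + t' *s v))"
      using norm_triangle_ineq2[of "w * (t - t')" "w * (t - t') - (eval f (x + t *s v) - eval f (x + t' *s v))"]
      by (simp add: norm_minus_commute)
    then show "norm w / 2 * norm (t - t') \<le> norm (eval f (x + t *s v) - eval f (x + t' *s v))"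
      by (simp add: norm_mult)
  qed
  have "(\<integral>\<^sup>+x. ennreal (norm (eval f x) powr (- 2 * s)) * indicator (ball p \<rho>) x \<partial>lborel) < \<infinity>"
  proof (rule nn_integral_averaging[where \<iota> = "\<lambda>t. t *s v" and A = "ball 0 \<rho>" and B' = "ball p (2 * \<rho>)"
        and K = "ennreal ((norm w / 2 / 2) powr (- 2 * s)) * J"])
    show "(\<lambda>t. t *s v) \<in> borel_measurable borel"
      by (intro borel_measurable_continuous_onI bounded_linear.continuous_on[OF bounded_linear_vector_scalar_left]) auto
    show "emeasure lborel (ball (0::complex) \<rho>) \<noteq> 0" using \<rho>(1) by (simp add: emeasure_ball unit_ball_vol_pos less_imp_neq[symmetric])
    show "emeasure lborel (ball (0::complex) \<rho>) \<noteq> \<infinity>" using emeasure_bounded_finite[OF bounded_ball, of "0::complex" \<rho>] by auto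
    show "emeasure lborel (ball p (2 * \<rho>)) < \<infinity>" using emeasure_bounded_finite[OF bounded_ball] by auto
    show "x \<in> ball p (2 * \<rho>)" if "t \<in> ball 0 \<rho>" "x + t *s v \<in> ball p \<rho>" for x t
    proof -
      have "norm (p - x) \<le> norm (p - (x + t *s v)) + norm (t *s v)"
        using norm_triangle_ineq[of "p - (x + t *s v)" "t *s v"] by simp
      then show ?thesis using that by (simp add: nv dist_norm)
    qed
    show "ennreal ((norm w / 2 / 2) powr (- 2 * s)) * J < \<infinity>" using \<open>J < \<infinity>\<close> by (simp add: ennreal_mult_less_top)
  qed (use line in auto)
  then show ?thesis unfolding loc_int_def using \<rho>(1) by blast
qed

text \<open>For a \<ge> 0 the power with the smaller exponent is at most the one with the larger
  exponent plus 1, and the ball has finite measure.\<close>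

lemma int_near_mono:
  assumes g: "g \<in> borel_measurable borel" and st: "0 \<le> s" "s \<le> t" and int: "int_near t g"
  shows "int_near s g"
proof -
  note [measurable] = g
  obtain r where r: "r > 0" "(\<integral>\<^sup>+x. ennreal (norm (g x) powr (- 2 * t)) * indicator (ball 0 r) x \<partial>lborel) < \<infinity>"
    using int unfolding int_near_def by (auto simp: set_integrable_iff_nn_integral[OF g])
  have le: "a powr (- 2 * s) \<le> a powr (- 2 * t) + 1" if "a \<ge> 0" for a :: real
  proof (cases "a \<le> 1")
    case True
    have "a powr (- 2 * s) \<le> a powr (- 2 * t)"
    proof (cases "a = 0")
      case False
      then show ?thesis using st that True by (intro powr_mono') auto
    qed simp
    then show ?thesis by simp
  next
    case False
    then have "a powr (- 2 * s) \<le> 1 powr (- 2 * s)" using st by (intro powr_mono2') auto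
    then show ?thesis by (simp add: add_increasing)
  qed
  have "(\<integral>\<^sup>+x. ennreal (norm (g x) powr (- 2 * s)) * indicator (ball 0 r) x \<partial>lborel)
    \<le> (\<integral>\<^sup>+x. ennreal (norm (g x) powr (- 2 * t)) * indicator (ball 0 r) x + indicator (ball 0 r) x \<partial>lborel)"
  proof (rule nn_integral_mono)
    fix x
    have "ennreal (norm (g x) powr (- 2 * s)) \<le> ennreal (norm (g x) powr (- 2 * t)) + 1"
      using le[of "norm (g x)"] by (simp add: ennreal_leI flip: ennreal_plus ennreal_1)
    then show "ennreal (norm (g x) powr (- 2 * s)) * indicator (ball 0 r) x \<le> ennreal (norm (g x) powr (- 2 * t)) * indicator (ball 0 r) x + indicator (ball 0 r) x"
      by (auto simp: indicator_def)
  qed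
  also have "\<dots> = (\<integral>\<^sup>+x. ennreal (norm (g x) powr (- 2 * t)) * indicator (ball 0 r) x \<partial>lborel) + emeasure lborel (ball (0::complex \<times> complex) r)"
    by (subst nn_integral_add) (auto intro!: borel_measurable_powr_indicator borel_measurable_indicator)
  also have "\<dots> < \<infinity>" using r(2) emeasure_bounded_finite[OF bounded_ball, of "0::complex \<times> complex" r] by simp
  finally show ?thesis unfolding int_near_def using r(1) by (auto simp: set_integrable_iff_nn_integral[OF g])
qed

text \<open>A slice through a point \<open>x\<close> near \<open>p\<close>, parallel to the chart
  plane, is an affinely rescaled copy of the slice through \<open>p\<close>, on which
  \<open>f\<close> becomes \<open>l x ^ d\<close> times the local equation. Since \<open>l x\<close>
  is close to 1, the integrals over these slices have a common bound, and averaging over them gives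
  integrability on the cone.\<close>

lemma loc_int_singular:
  assumes f: "homogeneous d f" and p: "p \<noteq> 0" and s: "s \<ge> 0" "int_near s (local_equation f p)"
  shows "loc_int s f p"
proof -
  define j where "j = chart p"
  have pj: "p $ j \<noteq> 0" using chart_nonzero[OF p] by (simp add: j_def)
  define g where "g = local_equation f p"
  have g [measurable]: "g \<in> borel_measurable borel" by (simp add: g_def)
  obtain r0 where r0: "r0 > 0" "(\<integral>\<^sup>+x. ennreal (norm (g x) powr (- 2 * s)) * indicator (ball 0 r0) x \<partial>lborel) < \<infinity>"
    using s(2) unfolding int_near_def g_def[symmetric] by (auto simp: set_integrable_iff_nn_integral[OF g])
  define l where "l x = x $ j / p $ j" for x
  define b where "b x = pscale (inverse (l x)) (chart_proj j x) - chart_proj j p" for x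
  have lp: "l p = 1" "b p = 0" using pj by (simp_all add: l_def b_def pscale_pscale)
  have opn: "open {q::complex^3. q $ j \<noteq> 0}" by (intro open_Collect_neq continuous_intros)
  have "continuous_on {q. q $ j \<noteq> 0} b"
    unfolding b_def l_def using pj by (intro continuous_intros) auto
  then have "continuous (at p) b" using opn pj continuous_on_eq_continuous_at by blast
  then obtain e1 where e1: "e1 > 0" "\<And>x. dist x p < e1 \<Longrightarrow> dist (b x) (b p) < r0 / 2"
    unfolding continuous_at_eps_delta using r0(1) by (metis half_gt_zero)
  have "continuous_on UNIV l" unfolding l_def using pj by (intro continuous_intros) auto
  then have "continuous (at p) l" by (simp add: continuous_on_eq_continuous_at)
  then obtain e2 where e2: "e2 > 0" "\<And>x. dist x p < e2 \<Longrightarrow> dist (l x) (l p) < 1 / 2"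
    unfolding continuous_at_eps_delta by (metis half_gt_zero zero_less_one)
  define e where "e = min e1 e2"
  have e: "e > 0" "e \<le> e1" "e \<le> e2" using e1 e2 by (auto simp: e_def)
  \<comment> \<open>Half of \<open>e\<close> keeps base points within \<open>e\<close>; with 2
    \<rho> \<le> r0/2 the rescaled slice, of centre \<open>b x\<close>, stays inside the ball of
    radius \<open>r0\<close>.\<close>
  define \<rho> where "\<rho> = min (e / 2) (r0 / 4)"
  have \<rho>: "\<rho> > 0" "2 * \<rho> \<le> e" "4 * \<rho> \<le> r0" using e r0 by (auto simp: \<rho>_def)
  define C where "C = ennreal (jac_const 2) * (ennreal ((1/2) powr (- 2 * s * real d)) *
     (\<integral>\<^sup>+x. ennreal (norm (g x) powr (- 2 * s)) * indicator (ball 0 r0) x \<partial>lborel))"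
  have C: "C < \<infinity>" using r0(2) by (simp add: C_def ennreal_mult_less_top)
  have slice: "(\<integral>\<^sup>+t. ennreal (norm (eval f (x + chart_incl j t)) powr (- 2 * s)) * indicator (ball 0 \<rho>) t \<partial>lborel) \<le> C"
    if x: "x \<in> ball p e" for x
  proof -
    have "dist (l x) 1 < 1 / 2" using e2(2)[of x] x e by (simp add: lp dist_commute)
    then have lx: "norm (l x) \<ge> 1 / 2" "norm (l x) \<le> 2"
      using norm_triangle_ineq2[of 1 "1 - l x"] norm_triangle_ineq[of 1 "l x - 1"] by (simp_all add: dist_norm norm_minus_commute)
    then have l0: "l x \<noteq> 0" by auto
    have bx: "norm (b x) < r0 / 2" using e1(2)[of x] x e by (simp add: lp dist_commute)
    \<comment> \<open>Mutually inverse affine maps between the displacement \<open>t\<close> in the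
      slice through \<open>x\<close> and the chart coordinate \<open>w\<close> at
      \<open>p\<close>.\<close>
    define \<psi> where "\<psi> t = pscale (inverse (l x)) t + b x" for t
    define \<phi> where "\<phi> w = pscale (l x) (w - b x)" for w
    have inv: "\<psi> (\<phi> w) = w" "\<phi> (\<psi> t) = t" for w t using l0 by (simp_all add: \<psi>_def \<phi>_def pscale_pscale)
    define W where "W = \<phi> -` ball 0 \<rho>"
    have \<phi>c: "continuous_on UNIV \<phi>" "continuous_on UNIV \<psi>" unfolding \<phi>_def \<psi>_def by (intro continuous_intros)+
    have W_open: "open W" unfolding W_def by (rule open_vimage[OF open_ball \<phi>c(1)])
    have W_sub: "W \<subseteq> ball 0 r0"
    proof
      fix w assume "w \<in> W"
      then have "norm (\<phi> w) < \<rho>" by (simp add: W_def)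
      have "norm w = norm (pscale (inverse (l x)) (\<phi> w) + b x)" using inv(1)[of w] by (simp add: \<psi>_def)
      also have "\<dots> \<le> norm (inverse (l x)) * norm (\<phi> w) + norm (b x)" by (rule order_trans[OF norm_triangle_ineq]) simp
      also have "\<dots> \<le> 2 * \<rho> + norm (b x)"
      proof -
        have "inverse (norm (l x)) \<le> inverse (1 / 2)" using lx(1) by (intro le_imp_inverse_le) auto
        then have "norm (inverse (l x)) \<le> 2" by (simp add: norm_inverse)
        then have "norm (inverse (l x)) * norm (\<phi> w) \<le> 2 * \<rho>" using \<open>norm (\<phi> w) < \<rho>\<close> by (intro mult_mono) auto
        then show ?thesis by simp
      qed
      also have "\<dots> < r0" using bx \<rho> by simp
      finally show "w \<in> ball 0 r0" by simp
    qed
    have img: "\<phi> ` W = ball 0 \<rho>" 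
    proof (intro equalityI subsetI)
      fix t :: "complex \<times> complex" assume "t \<in> ball 0 \<rho>"
      then have "\<psi> t \<in> W" by (simp add: W_def inv)
      then show "t \<in> \<phi> ` W" using inv(2)[of t] by (metis imageI)
    qed (auto simp: W_def)
    have der: "(\<phi> has_derivative pscale (l x)) (at w)" for w
    proof -
      interpret bounded_linear "pscale (l x)" by (rule bounded_linear_pscale)
      have "(\<phi> has_derivative (\<lambda>h. pscale (l x) (h - 0))) (at w)"
        unfolding \<phi>_def by (intro has_derivative derivative_intros)
      then show ?thesis by simp
    qed
    have on: "onorm (pscale (l x)) \<le> 2" using lx(2) by (intro onorm_le) (simp add: mult_right_mono)
    define k where "k t = ennreal (norm (eval f (x + chart_incl j t)) powr (- 2 * s))" for t
    have cm: "(\<lambda>t. eval f (x + chart_incl j t)) \<in> borel_measurable borel"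
      by (intro borel_measurable_continuous_onI continuous_intros)
    have k: "k \<in> borel_measurable borel" unfolding k_def using cm by measurable
    have kp: "k (\<phi> w) = ennreal (norm (l x) powr (- 2 * s * real d)) * ennreal (norm (g w) powr (- 2 * s))" for w
    proof -
      have xj: "x $ j \<noteq> 0" using l0 by (auto simp: l_def)
      interpret ci: bounded_linear "chart_incl j" by (rule bounded_linear_chart_incl)
      have "x + chart_incl j (\<phi> w) = l x *s (p + chart_incl j (b x)) + l x *s chart_incl j (w - b x)"
        using chart_coordinates[OF pj xj] by (simp only: \<phi>_def chart_incl_pscale b_def l_def)
      also have "\<dots> = l x *s (p + chart_incl j w)"
        by (simp add: ci.diff vec_eq_iff algebra_simps)
      finally have "eval f (x + chart_incl j (\<phi> w)) = l x ^ d * g w"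
        by (simp only: eval_scale[OF f] g_def local_equation_chart j_def)
      then show ?thesis using l0
        by (simp add: k_def norm_mult norm_power powr_mult powr_realpow[symmetric] powr_powr ennreal_mult mult_ac)
    qed
    have "(\<integral>\<^sup>+t. k t * indicator (ball 0 \<rho>) t \<partial>lborel) \<le> ennreal (jac_const 2) * (\<integral>\<^sup>+w. k (\<phi> w) * indicator W w \<partial>lborel)"
      unfolding img[symmetric]
      by (rule nn_integral_image_le[OF W_open bounded_subset[OF bounded_ball W_sub] der on inv(1) _ _ k])
         (auto simp: img intro: continuous_on_subset[OF \<phi>c(2)])
    also have "(\<integral>\<^sup>+w. k (\<phi> w) * indicator W w \<partial>lborel) \<le> (\<integral>\<^sup>+w. ennreal ((1/2) powr (- 2 * s * real d)) * (ennreal (norm (g w) powr (- 2 * s)) * indicator (ball 0 r0) w) \<partial>lborel)"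
    proof (rule nn_integral_mono)
      fix w
      have "norm (l x) powr (- 2 * s * real d) \<le> (1/2) powr (- 2 * s * real d)"
        using lx s(1) by (intro powr_mono2') auto
      then have "k (\<phi> w) \<le> ennreal ((1/2) powr (- 2 * s * real d)) * ennreal (norm (g w) powr (- 2 * s))"
        unfolding kp by (intro mult_right_mono ennreal_leI) auto
      then show "k (\<phi> w) * indicator W w \<le> ennreal ((1/2) powr (- 2 * s * real d)) * (ennreal (norm (g w) powr (- 2 * s)) * indicator (ball 0 r0) w)"
        using W_sub by (auto simp: indicator_def)
    qed
    also have "\<dots> = ennreal ((1/2) powr (- 2 * s * real d)) * (\<integral>\<^sup>+w. ennreal (norm (g w) powr (- 2 * s)) * indicator (ball 0 r0) w \<partial>lborel)"
      by (rule nn_integral_cmult) (simp add: borel_measurable_powr_indicator)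
    finally show ?thesis unfolding k_def C_def by (simp add: mult_left_mono)
  qed
  have "(\<integral>\<^sup>+x. ennreal (norm (eval f x) powr (- 2 * s)) * indicator (ball p \<rho>) x \<partial>lborel) < \<infinity>"
  proof (rule nn_integral_averaging[where \<iota> = "chart_incl j" and A = "ball 0 \<rho>" and B' = "ball p e" and K = C])
    show "chart_incl j \<in> borel_measurable borel"
      by (intro borel_measurable_continuous_onI bounded_linear.continuous_on[OF bounded_linear_chart_incl]) auto
    show "emeasure lborel (ball (0::complex \<times> complex) \<rho>) \<noteq> 0" using \<rho>(1) by (simp add: emeasure_ball unit_ball_vol_pos less_imp_neq[symmetric])
    show "emeasure lborel (ball (0::complex \<times> complex) \<rho>) \<noteq> \<infinity>" using emeasure_bounded_finite[OF bounded_ball, of "0::complex \<times> complex" \<rho>] by auto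
    show "emeasure lborel (ball p e) < \<infinity>" using emeasure_bounded_finite[OF bounded_ball] by auto
    show "x \<in> ball p e" if "t \<in> ball 0 \<rho>" "x + chart_incl j t \<in> ball p \<rho>" for x t
    proof -
      have "norm (p - x) \<le> norm (p - (x + chart_incl j t)) + norm (chart_incl j t)"
        using norm_triangle_ineq[of "p - (x + chart_incl j t)" "chart_incl j t"] by simp
      then show ?thesis using that \<rho> by (simp add: dist_norm)
    qed
  qed (use slice C in auto)
  then show ?thesis unfolding loc_int_def using \<rho>(1) by blast
qed

text \<open>Finitely many balls of local integrability cover the compact shell.\<close>

lemma integrable_shell:
  assumes loc: "\<And>p. p \<noteq> 0 \<Longrightarrow> loc_int s f p"
  shows "integrable lborel (\<lambda>x. indicator {x. 1 \<le> norm x \<and> norm x \<le> 4} x * cmod (eval f x) powr (- 2 * s))"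
proof -
  define A where "A = {x::complex^3. 1 \<le> norm x \<and> norm x \<le> 4}"
  define G where "G x = ennreal (norm (eval f x) powr (- 2 * s))" for x
  have G [measurable]: "G \<in> borel_measurable borel" unfolding G_def by measurable
  have "closed A" unfolding A_def by (intro closed_Collect_conj closed_Collect_le continuous_intros)
  moreover have "bounded A" by (rule bounded_subset[OF bounded_cball[of 0 4]]) (auto simp: A_def)
  ultimately have cA: "compact A" by (simp add: compact_eq_bounded_closed)
  have "\<exists>r>0. (\<integral>\<^sup>+x. G x * indicator (ball p r) x \<partial>lborel) < \<infinity>" if "p \<in> A" for p
    using loc[of p] that unfolding loc_int_def G_def A_def by fastforce
  then obtain r where r: "\<And>p. p \<in> A \<Longrightarrow> r p > 0" "\<And>p. p \<in> A \<Longrightarrow> (\<integral>\<^sup>+x. G x * indicator (ball p (r p)) x \<partial>lborel) < \<infinity>"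
    by metis
  obtain S where S: "S \<subseteq> A" "finite S" "A \<subseteq> (\<Union>p\<in>S. ball p (r p))"
  proof (rule compactE_image[OF cA, of A "\<lambda>p. ball p (r p)"])
    show "A \<subseteq> (\<Union>p\<in>A. ball p (r p))" using r(1) by force
  qed auto
  have "(\<integral>\<^sup>+x. G x * indicator A x \<partial>lborel) \<le> (\<integral>\<^sup>+x. (\<Sum>p\<in>S. G x * indicator (ball p (r p)) x) \<partial>lborel)"
  proof (rule nn_integral_mono)
    fix x
    show "G x * indicator A x \<le> (\<Sum>p\<in>S. G x * indicator (ball p (r p)) x)"
    proof (cases "x \<in> A")
      case True
      then obtain p where p: "p \<in> S" "x \<in> ball p (r p)" using S(3) by blast
      have "G x * indicator (ball p (r p)) x \<le> (\<Sum>p\<in>S. G x * indicator (ball p (r p)) x)"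
        using S(2) p(1) by (intro member_le_sum) auto
      then show ?thesis using p(2) True by simp
    qed simp
  qed
  also have "\<dots> = (\<Sum>p\<in>S. \<integral>\<^sup>+x. G x * indicator (ball p (r p)) x \<partial>lborel)"
    by (rule nn_integral_sum) (simp add: G_def borel_measurable_powr_indicator)
  also have "\<dots> < \<infinity>" using r(2) S(1,2) by (auto simp: ennreal_sum_less_top)
  finally have "(\<integral>\<^sup>+x. G x * indicator A x \<partial>lborel) < \<infinity>" .
  then have "set_integrable lborel A (\<lambda>x. norm (eval f x) powr (- 2 * s))"
    unfolding G_def using \<open>closed A\<close> by (subst set_integrable_iff_nn_integral) auto
  then show ?thesis by (simp add: set_integrable_def A_def)
qed


section \<open>Free curves with simple singularities\<close>

lemma arnold_exponent_eq: "arnold_exponent f p = Sup {c. c > 0 \<and> int_near c (local_equation f p)}"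
  by (simp add: arnold_exponent_def log_canonical_threshold_def int_near_def)

lemma bdd_above_exponents:
  assumes "homogeneous d f" "f \<noteq> 0" "p \<in> singular_points f"
  shows "bdd_above {c. c > 0 \<and> int_near c (local_equation f p)}"
  using int_near_singular_less_1[OF assms] by (intro bdd_aboveI[of _ 1]) force

lemma arnold_exponent_ge:
  assumes "homogeneous d f" "f \<noteq> 0" "p \<in> singular_points f" "c > 0" "int_near c (local_equation f p)"
  shows "c \<le> arnold_exponent f p"
  unfolding arnold_exponent_eq using assms by (intro cSup_upper bdd_above_exponents) auto

lemma int_near_less_arnold_exponent:
  assumes "0 \<le> s" "s < arnold_exponent f p" and ne: "c > 0" "int_near c (local_equation f p)"
  shows "int_near s (local_equation f p)"
proof -
  have "{c. c > 0 \<and> int_near c (local_equation f p)} \<noteq> {}" using ne by blast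
  then obtain t where t: "int_near t (local_equation f p)" "s < t"
    using less_cSupE[OF assms(2)[unfolded arnold_exponent_eq]] by blast
  show ?thesis
    by (rule int_near_mono[OF borel_measurable_local_equation assms(1) less_imp_le[OF t(2)] t(1)])
qed

text \<open>The infimum in \<open>curve_exponent\<close> runs over all homogeneous coordinate
  vectors. One exponent above 1/2 that works for every one of them bounds it away from 1/2; it
  exists because there are finitely many singular points up to scaling.\<close>

lemma simple_singularities_uniform_exponent:
  assumes f: "homogeneous d f" and s: "only_simple_singularities f"
  shows "\<exists>c>1/2. \<forall>q\<in>singular_points f. int_near c (local_equation f q)"
proof -
  obtain S where S: "finite S" "S \<subseteq> singular_points f" "\<forall>q\<in>singular_points f. \<exists>v\<in>S. \<exists>c. q = c *s v"
    using finite_singular_points[OF f s] by blast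
  have "\<exists>c>1/2. int_near c (local_equation f v)" if "v \<in> S" for v
  proof -
    have "v \<in> singular_points f" using S(2) that by blast
    then obtain h where h: "simple_normal_form h" "germ_equivalent (local_equation f v) h"
      using s by (auto simp only: only_simple_singularities_def)
    obtain c where c: "c > 1/2" "int_near c h" using int_near_simple_normal_form[OF h(1)] by blast
    have "int_near c (local_equation f v)"
      by (rule int_near_germ_equivalent[OF _ borel_measurable_local_equation simple_normal_form_measurable[OF h(1)] h(2) c(2)])
         (use c in simp)
    then show ?thesis using c by blast
  qed
  then have "\<forall>v\<in>S. \<exists>c. c > 1/2 \<and> int_near c (local_equation f v)" by blast
  from bchoice[OF this] obtain c
    where c: "\<And>v. v \<in> S \<Longrightarrow> c v > 1/2" "\<And>v. v \<in> S \<Longrightarrow> int_near (c v) (local_equation f v)" by blast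
  \<comment> \<open>The inserted 1 keeps the minimum over a nonempty set.\<close>
  define c0 where "c0 = Min (insert 1 (c ` S))"
  have c0: "c0 > 1/2" "\<And>v. v \<in> S \<Longrightarrow> c0 \<le> c v"
  proof -
    have fin: "finite (insert 1 (c ` S))" using S(1) by simp
    show "c0 > 1/2" unfolding c0_def using c(1) by (subst Min_gr_iff[OF fin]) auto
    show "c0 \<le> c v" if "v \<in> S" for v unfolding c0_def using that by (intro Min_le[OF fin]) simp
  qed
  have "int_near c0 (local_equation f q)" if q: "q \<in> singular_points f" for q
  proof -
    obtain v a where v: "v \<in> S" "q = a *s v" using S(3) q by blast
    have "a \<noteq> 0" using q v(2) by (auto simp: singular_points_def)
    moreover have "int_near c0 (local_equation f v)"
      using c0 v(1) by (intro int_near_mono[OF borel_measurable_local_equation _ _ c(2)]) auto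
    ultimately show ?thesis unfolding v(2) using c0(1) by (intro int_near_local_equation_scale[OF f]) auto
  qed
  then show ?thesis using c0(1) by blast
qed

theorem corollary4p4:
  fixes f :: "complex poly poly poly" and d :: nat
  assumes "homogeneous d f" and "squarefree f"
    and "singular_points f \<noteq> {}" and "only_simple_singularities f"
    and "(odd d \<and> real d > 3 / (2 * curve_exponent f - 1)) \<or>
         (even d \<and> real d > 2 / (2 * curve_exponent f - 1))"
  shows "\<not> free_curve f"
proof
  assume free: "free_curve f"
  note f = assms(1)
  have f0: "f \<noteq> 0" using assms(2) by auto
  obtain p0 where p0: "p0 \<in> singular_points f" using assms(3) by blast
  \<comment> \<open>In degree 0 the polynomial is constant, and it vanishes at a singular
    point.\<close>
  have d: "d > 0"
  proof (rule ccontr)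
    assume "\<not> d > 0"
    then have c: "eval f (0 *s x) = eval f x" for x using eval_scale[OF f, of 0 x] by simp
    have "eval f p0 = 0" using p0 by (simp add: singular_points_def)
    then have "eval f x = 0" for x using c[of x] c[of p0] by simp
    then show False using eval_eq_0_imp f0 by blast
  qed
  obtain c0 where c0: "c0 > 1/2" "\<And>q. q \<in> singular_points f \<Longrightarrow> int_near c0 (local_equation f q)"
    using simple_singularities_uniform_exponent[OF f assms(4)] by blast
  define \<alpha> where "\<alpha> = curve_exponent f"
  have ge: "c0 \<le> arnold_exponent f q" if "q \<in> singular_points f" for q
    using c0 that by (intro arnold_exponent_ge[OF f f0 that]) auto
  have \<alpha>_ge: "c0 \<le> \<alpha>"
    unfolding \<alpha>_def curve_exponent_def by (rule cINF_greatest[OF assms(3) ge])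
  have \<alpha>_le: "\<alpha> \<le> arnold_exponent f q" if "q \<in> singular_points f" for q
    unfolding \<alpha>_def curve_exponent_def by (rule cINF_lower[OF _ that]) (use ge in \<open>auto intro!: bdd_belowI[of _ c0]\<close>)
  have "arnold_exponent f p0 \<le> 1"
    unfolding arnold_exponent_eq
    by (rule cSup_least) (use c0(1) c0(2)[OF p0] int_near_singular_less_1[OF f f0 p0] in force)+
  then have \<alpha>_1: "\<alpha> \<le> 1" using \<alpha>_le[OF p0] by simp
  obtain S where S: "finite S" "S \<subseteq> singular_points f" "\<And>q. q \<in> singular_points f \<Longrightarrow> \<exists>v\<in>S. \<exists>c. q = c *s v"
    using finite_singular_points[OF f assms(4)] by blast
  have "S \<noteq> {}" using S(3)[OF p0] by blast
  then obtain \<delta> m where \<delta>: "2 * m + 1 \<le> d" "\<And>i. homogeneous m (\<delta> i)"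
    "\<And>p. (\<Sum>i\<in>UNIV. eval (\<delta> i) p * gradient f p $ i) = 0" "\<exists>i. \<delta> i \<noteq> 0"
    using free_curve_syzygy[OF f d f0 free S(1) S(3) S(2)] by blast
  define s where "s = (real m + 2) / real d"
  have s0: "s \<ge> 0" by (simp add: s_def)
  have s_less: "s < \<alpha>"
  proof -
    \<comment> \<open>Both alternatives for \<open>d\<close> can be multiplied out because the
      denominator is positive.\<close>
    have a: "2 * \<alpha> - 1 > 0" using \<alpha>_ge c0(1) by simp
    have "real m + 2 < \<alpha> * real d"
      using assms(5)
    proof
      assume "odd d \<and> real d > 3 / (2 * curve_exponent f - 1)"
      then have "3 < real d * (2 * \<alpha> - 1)" using a by (simp add: \<alpha>_def pos_divide_less_eq)
      moreover have "2 * real m + 1 \<le> real d" using \<delta>(1) by linarith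
      ultimately show ?thesis by (simp add: algebra_simps)
    next
      assume e: "even d \<and> real d > 2 / (2 * curve_exponent f - 1)"
      then have "2 < real d * (2 * \<alpha> - 1)" using a by (simp add: \<alpha>_def pos_divide_less_eq)
      moreover obtain b where "d = 2 * b" using e by (auto elim: evenE)
      \<comment> \<open>The odd number \<open>2 * m + 1\<close> cannot equal an even
        \<open>d\<close>; this unit is what improves the constant from 3 to 2.\<close>
      then have "2 * m + 2 \<le> d" using \<delta>(1) by presburger
      then have "2 * real m + 2 \<le> real d" by linarith
      ultimately show ?thesis by (simp add: algebra_simps)
    qed
    then show ?thesis using d by (simp add: s_def pos_divide_less_eq)
  qed
  have loc: "loc_int s f p" if p: "p \<noteq> 0" for p
  proof -
    consider "eval f p \<noteq> 0" | "gradient f p \<noteq> 0" | "p \<in> singular_points f"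
      using p by (auto simp: singular_points_def)
    then show ?thesis
    proof cases
      case 1
      then show ?thesis by (rule loc_int_nonzero[OF s0])
    next
      case 2
      \<comment> \<open>Smooth points ask for s < 1, and this follows from the bound \<alpha> \<le>
        1 obtained at a singular point.\<close>
      then show ?thesis using s_less \<alpha>_1 by (intro loc_int_smooth[OF s0]) auto
    next
      case 3
      have "int_near s (local_equation f p)"
        using s_less \<alpha>_le[OF 3] c0(1) c0(2)[OF 3] by (intro int_near_less_arnold_exponent[OF s0, of f p c0]) auto
      then show ?thesis by (rule loc_int_singular[OF f p s0])
    qed
  qed
  have "jacobian_syzygy f \<delta> d m"
    using f d \<delta>(2,3) integrable_shell[OF loc] AE_eval_nonzero[OF f0]
    by unfold_locales (simp_all add: s_def)
  then show False using jacobian_syzygy.syzygy_eq_0 \<delta>(4) by blast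
qed


end
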